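(* Let $T^3-AT+B$ be in standard form, with function field $\mathcal{F}$ and field discriminant $\Delta$. Let $P\in\mathbb{F}_q[x]$ be an irreducible polynomial and let $q_1=q^{\deg P}$. Let $a,b$ be the residues of $A,B$ modulo $P$, so that $T^3-aT+b\equiv T^3-AT+B \pmod P$. Then the principal ideal $(P)=P\mathcal{O}_{\mathcal{F}}$ splits into prime ideals of $\mathcal{O}_{\mathcal{F}}$ as follows, where different letters denote distinct prime ideals: 1. If $v_P(\Delta)>2$, then $(P)=\mathfrak{p}^3$. 2. If $v_P(\Delta)=1$, then $(P)=\mathfrak{q}\mathfrak{p}^2$. 3. Otherwise $P\nmid A$; let $d=\gcd(T^{q_1}-T,\ T^3-aT+b)$, computed in $(\mathbb{F}_q[x]/(P))[T]$. (a) If $\deg d=0$, then $(P)=\mathfrak{p}$. (b) If $\deg d=1$, then $(P)=\mathfrak{p}\mathfrak{q}$. (c) If $\deg d=3$, then $(P)=\mathfrak{p}\mathfrak{q}\mathfrak{r}$.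
   Context: $q$ is a power of $3$. $A,B\in\mathbb{F}_q[x]$, $A\neq 0$, and $T^3-AT+B\in\mathbb{F}_q[x,T]$ is absolutely irreducible; $\mathcal{F}=\mathbb{F}_q(x,y)$ with $y^3-Ay+B=0$, and $\mathcal{O}_{\mathcal{F}}$ is the integral closure of $\mathbb{F}_q[x]$ in $\mathcal{F}$. The polynomial $T^3-AT+B$ is in standard form if (a) there are no non-constant $Q\in\mathbb{F}_q[x]$ and $i\in\mathbb{F}_q[x]$ with $Q^2\mid A$ and $Q^3\mid i^3-iA+B$, and (b) either $3\nmid\deg B$ and $2\deg B>3\deg A$, or $2\deg B\le 3\deg A$. $\Delta=\mathrm{disc}(\mathcal{F})$ is the discriminant of an $\mathbb{F}_q[x]$-basis of $\mathcal{O}_{\mathcal{F}}$ (well defined up to squares of nonzero constants), and $v_P$ is the $P$-adic valuation on $\mathbb{F}_q(x)$. *)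

theory Defs
  imports
    "HOL-Analysis.Determinants"
    "HOL-Algebra.Algebraic_Closure_Type"
    "HOL-Algebra.Ideal_Product"
    "HOL-Algebra.Generated_Fields"
    "HOL-Algebra.Polynomial_Divisibility"
    "HOL-Computational_Algebra.Computational_Algebra"
begin

section \<open>The cubic and its standard form\<close>

text \<open>Bivariate polynomials in $x$ and $T$ are rendered as polynomials in $T$ whose coefficients
  are polynomials in $x$.\<close>

definition cubic :: "'a::field poly \<Rightarrow> 'a poly \<Rightarrow> 'a poly poly" where
  "cubic A B = [:B, - A, 0, 1:]"

definition absolutely_irreducible :: "'a::field poly poly \<Rightarrow> bool" where
  "absolutely_irreducible f \<longleftrightarrow> Factorial_Ring.irreducible (map_poly (map_poly to_ac) f)"

definition standard_form :: "'a::field poly \<Rightarrow> 'a poly \<Rightarrow> bool" where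
  "standard_form A B \<longleftrightarrow>
     \<not> (\<exists>Q i. Polynomial.degree Q > 0 \<and> Q ^ 2 dvd A \<and> Q ^ 3 dvd i ^ 3 - i * A + B) \<and>
     (\<not> 3 dvd Polynomial.degree B \<and> 2 * Polynomial.degree B > 3 * Polynomial.degree A
      \<or> 2 * Polynomial.degree B \<le> 3 * Polynomial.degree A)"


section \<open>The function field and its ring of integers\<close>

text \<open>The function field lives inside an arbitrary ambient field \<open>'f\<close>, which contains the rational
  function field through a ring homomorphism \<open>\<iota>\<close> (injective, since its domain is a field);
  \<open>y\<close> is the adjoined root.\<close>

definition function_field :: "('a::field poly fract \<Rightarrow> 'f::field) \<Rightarrow> 'f \<Rightarrow> 'f set" where
  "function_field \<iota> y = generate_field ring_of_type_algebra (insert y (range \<iota>))"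

definition integral_closure :: "('r::comm_ring_1 \<Rightarrow> 'f::field) \<Rightarrow> 'f set \<Rightarrow> 'f set" where
  "integral_closure h F =
     {z \<in> F. \<exists>p. Polynomial.lead_coeff p = 1 \<and> poly (map_poly h p) z = 0}"

definition integers_ring :: "('a::field poly fract \<Rightarrow> 'f::field) \<Rightarrow> 'f \<Rightarrow> 'f ring" where
  "integers_ring \<iota> y =
     ring_of_type_algebra
       \<lparr>carrier := integral_closure (\<lambda>g. \<iota> (to_fract g)) (function_field \<iota> y)\<rparr>"


section \<open>Trace and discriminant\<close>

text \<open>\<open>w\<close> is a basis of \<open>V\<close> over the scalars \<open>'r\<close>, which act through \<open>h\<close>: every element of \<open>V\<close> has
  exactly one coordinate vector, and every linear combination lies in \<open>V\<close>.\<close>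

definition is_basis :: "('r \<Rightarrow> 'f::field) \<Rightarrow> 'f set \<Rightarrow> 'f ^ 'n \<Rightarrow> bool" where
  "is_basis h V w \<longleftrightarrow> bij_betw (\<lambda>c :: 'r ^ 'n. \<Sum>i\<in>UNIV. h (c $ i) * w $ i) UNIV V"

text \<open>The trace of multiplication by \<open>\<alpha>\<close> on a cubic extension \<open>F\<close>: the trace of its matrix \<open>M\<close> with
  respect to a basis, which does not depend on the basis chosen.\<close>

definition field_trace :: "('k::field \<Rightarrow> 'f::field) \<Rightarrow> 'f set \<Rightarrow> 'f \<Rightarrow> 'k" where
  "field_trace \<iota> F \<alpha> =
     (THE t. \<exists>(w :: 'f ^ 3) (M :: 'k ^ 3 ^ 3). is_basis \<iota> F w \<and>
        (\<forall>j. \<alpha> * w $ j = (\<Sum>i\<in>UNIV. \<iota> (M $ i $ j) * w $ i)) \<and> t = trace M)"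

definition disc_of :: "('k::field \<Rightarrow> 'f::field) \<Rightarrow> 'f set \<Rightarrow> 'f ^ 3 \<Rightarrow> 'k" where
  "disc_of \<iota> F w = det (\<chi> i j. field_trace \<iota> F (w $ i * w $ j))"

definition is_field_disc ::
    "('a::field poly fract \<Rightarrow> 'f::field) \<Rightarrow> 'f \<Rightarrow> 'a poly fract \<Rightarrow> bool" where
  "is_field_disc \<iota> y \<Delta> \<longleftrightarrow>
     (\<exists>w :: 'f ^ 3. is_basis (\<lambda>g. \<iota> (to_fract g)) (carrier (integers_ring \<iota> y)) w \<and>
        \<Delta> = disc_of \<iota> (function_field \<iota> y) w)"

text \<open>The \<open>P\<close>-adic valuation of a nonzero rational function (no meaning is given to the value at
  zero).\<close>

definition padic_val :: "'a::field poly \<Rightarrow> 'a poly fract \<Rightarrow> int" where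
  "padic_val P r =
     (THE n. \<exists>u v. \<not> P dvd u \<and> \<not> P dvd v \<and> r = to_fract P powi n * Fract u v)"


section \<open>Polynomials over the residue field\<close>

definition residue_field :: "'a::field poly \<Rightarrow> 'a poly set ring" where
  "residue_field P = ring_of_type_algebra Quot (PIdl\<^bsub>ring_of_type_algebra\<^esub> P)"

definition residue :: "'a::field poly \<Rightarrow> 'a poly \<Rightarrow> 'a poly set" where
  "residue P g = (PIdl\<^bsub>ring_of_type_algebra\<^esub> P) +>\<^bsub>ring_of_type_algebra\<^esub> g"

text \<open>Elements of \<^const>\<open>poly_ring\<close> are coefficient lists, leading coefficient first.\<close>

definition residue_cubic :: "'a::field poly \<Rightarrow> 'a poly \<Rightarrow> 'a poly \<Rightarrow> 'a poly set list" where
  "residue_cubic P A B =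
     [\<one>\<^bsub>residue_field P\<^esub>, \<zero>\<^bsub>residue_field P\<^esub>,
      \<ominus>\<^bsub>residue_field P\<^esub> residue P A, residue P B]"

definition frobenius_poly :: "'a::field poly \<Rightarrow> nat \<Rightarrow> 'a poly set list" where
  "frobenius_poly P n =
     (X\<^bsub>residue_field P\<^esub> [^]\<^bsub>poly_ring (residue_field P)\<^esub> n)
       \<ominus>\<^bsub>poly_ring (residue_field P)\<^esub> X\<^bsub>residue_field P\<^esub>"

end

theory Submission
  imports Defs
begin

text \<open>The proof is local at \<open>P\<close>. Suppose first that \<open>P\<close> does not divide \<open>A\<close>. Then the reduced cubic
  \<open>T\<^sup>3 - a T + b\<close> is separable, \<open>k[x][y]\<close> is already maximal at \<open>P\<close>, and the primes above \<open>P\<close>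
  correspond to the irreducible factors of the reduced cubic. Cubing is additive in characteristic
  three, so the roots of that cubic are \<open>t\<close>, \<open>t + s\<close>, \<open>t - s\<close> with \<open>s\<^sup>2 = a\<close>; the residue field
  therefore contains none, exactly one, or all three of them, and their number is the degree of the
  gcd with \<open>T\<^sup>q\<^sup>1 - T\<close>, whose roots are the elements of the residue field.

  Suppose now that \<open>P\<close> divides \<open>A\<close>. The residue field is perfect, so some \<open>i\<close> makes \<open>P\<close> divide
  \<open>C = i\<^sup>3 - i A + B\<close>, and \<open>y - i\<close> is a root of \<open>T\<^sup>3 - A T + C\<close>. If \<open>P\<^sup>2\<close> does not divide \<open>C\<close>, this
  polynomial is Eisenstein and \<open>P\<close> is totally ramified. Otherwise \<open>(y - i)\<^sup>2 / P\<close> is integral, and the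
  Newton polygon decides: if \<open>P\<^sup>2\<close> does not divide \<open>A\<close>, then \<open>P\<close> is partially ramified; if it does, the
  standard form forbids \<open>P\<^sup>3\<close> to divide \<open>C\<close>, and \<open>P\<close> is again totally ramified.\<close>

text \<open>All these cases are instances of one family of orders. With \<open>A = \<pi> a\<close>, \<open>C = \<pi>\<^sup>2 c\<close> and
  \<open>\<theta> = (y - i)\<^sup>2 / \<pi>\<close>, where \<open>\<pi>\<close> is \<open>1\<close> or \<open>P\<close>, the elements \<open>1\<close>, \<open>y - i\<close>, \<open>\<theta>\<close> span an order of
  discriminant \<open>\<pi> a\<^sup>3\<close> (\<open>disc_of_standard_basis\<close>). Three facts about such orders carry the proof.

  \<^item> The order is maximal at \<open>P\<close> (\<open>maximal_if_unramified\<close>, \<open>maximal_if_partially_ramified\<close>,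
    \<open>maximal_if_totally_ramified\<close>). The tool is \<open>integral_quotient\<close>: if \<open>u / P\<close> is integral, then \<open>u\<close>
    vanishes under every homomorphism from the order to an extension of the residue field.
  \<^item> Maximality makes the index of the order in the ring of integers prime to \<open>P\<close>
    (\<open>index_prime_to_P\<close>), so that the discriminant of the field has the \<open>P\<close>-adic valuation of
    \<open>\<pi> a\<^sup>3\<close>: it is \<open>0\<close>, \<open>1\<close>, or at least \<open>3\<close> in the three cases.
  \<^item> The homomorphisms extend to the ring of integers (\<open>character_exists\<close>), their kernels are the
    primes above \<open>P\<close>, and explicit generators show that the expected product of these kernels is the
    ideal of multiples of \<open>P\<close> (\<open>totally_ramified\<close>, \<open>partially_ramified\<close>, \<open>inert\<close>,
    \<open>partially_split\<close>, \<open>totally_split\<close>).\<close>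



section \<open>Polynomials over a field\<close>

text \<open>A nonzero element of least degree in the ideal generated by \<open>g\<close> and \<open>P\<close> divides both.\<close>

lemma irreducible_bezout:
  fixes P g :: "'a::field poly"
  assumes irr: "Factorial_Ring.irreducible P" and ndvd: "\<not> P dvd g"
  obtains u v where "u * g + v * P = 1"
proof -
  define J where "J = {u * g + v * P | u v. True}"
  have addJ: "x + r * x' \<in> J" if xx: "x \<in> J" "x' \<in> J" for x x' r
  proof -
    from xx obtain u v u' v' where "x = u * g + v * P" "x' = u' * g + v' * P"
      unfolding J_def by blast
    hence "x + r * x' = (u + r * u') * g + (v + r * v') * P"
      by (simp add: algebra_simps)
    thus ?thesis unfolding J_def by blast
  qed
  have "P = 0 * g + 1 * P" "g = 1 * g + 0 * P" by simp_all
  hence PJ: "P \<in> J" and gJ: "g \<in> J" unfolding J_def by blast+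
  have P0: "P \<noteq> 0" using irr by auto
  obtain m where m: "m \<in> J" "m \<noteq> 0"
    and least: "\<And>x. x \<in> J \<Longrightarrow> x \<noteq> 0 \<Longrightarrow> Polynomial.degree m \<le> Polynomial.degree x"
    using ex_has_least_nat[of "\<lambda>m. m \<in> J \<and> m \<noteq> 0" P Polynomial.degree] PJ P0 by blast
  have dvdJ: "m dvd x" if "x \<in> J" for x
  proof -
    have "x mod m = x + (- (x div m)) * m"
      by (simp add: minus_div_mult_eq_mod[symmetric])
    hence "x mod m \<in> J" using addJ[OF that m(1)] by metis
    moreover have "x mod m = 0 \<or> Polynomial.degree (x mod m) < Polynomial.degree m"
      using degree_mod_less[of m x] m(2) by blast
    ultimately show ?thesis using least by fastforce
  qed
  obtain k where k: "P = m * k" using dvdJ[OF PJ] by (rule dvdE)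
  have "m dvd 1"
  proof (rule ccontr)
    assume "\<not> m dvd 1"
    with irr k have "k dvd 1" by (metis Factorial_Ring.irreducibleD)
    hence "P dvd m" using k by (metis dvd_mult_unit_iff dvd_refl mult.commute)
    thus False using ndvd dvdJ[OF gJ] dvd_trans by blast
  qed
  then obtain l where "1 = m * l" by (rule dvdE)
  moreover obtain u v where "m = u * g + v * P" using m(1) unfolding J_def by blast
  ultimately have "(l * u) * g + (l * v) * P = 1" by (simp add: algebra_simps)
  thus thesis by (rule that)
qed

lemma irreducible_dvd_mult_iff:
  fixes P :: "'a::field poly"
  assumes "Factorial_Ring.irreducible P"
  shows "P dvd a * b \<longleftrightarrow> P dvd a \<or> P dvd b"
  using field_poly_irreducible_imp_prime[OF assms] by (rule prime_elem_dvd_mult_iff)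

lemma irreducible_dvd_power_iff:
  fixes P :: "'a::field poly"
  assumes "Factorial_Ring.irreducible P" "n > 0"
  shows "P dvd a ^ n \<longleftrightarrow> P dvd a"
  using prime_elem_dvd_power[OF field_poly_irreducible_imp_prime[OF assms(1)], of a n]
    dvd_power[OF disjI1[OF assms(2)], of a] dvd_trans by blast

lemma irreducible_degree_pos:
  fixes P :: "'a::field poly"
  assumes "Factorial_Ring.irreducible P"
  shows "Polynomial.degree P > 0"
  using assms is_unit_iff_degree[of P] by (auto simp: Factorial_Ring.irreducible_def)

lemma irreducible_factor_exists:
  fixes g :: "'a::field poly"
  assumes "g \<noteq> 0" "\<not> g dvd 1"
  obtains p where "Factorial_Ring.irreducible p" "p dvd g"
  using assms
proof (induction "Polynomial.degree g" arbitrary: g thesis rule: less_induct)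
  case less
  show ?case
  proof (cases "Factorial_Ring.irreducible g")
    case True
    thus ?thesis using less.prems(1)[of g] by simp
  next
    case False
    then obtain a b where ab: "g = a * b" "\<not> a dvd 1" "\<not> b dvd 1"
      using less.prems by (auto simp: Factorial_Ring.irreducible_def)
    hence nz: "a \<noteq> 0" "b \<noteq> 0" using less.prems by auto
    hence "Polynomial.degree b > 0" using ab(3) is_unit_iff_degree by blast
    hence "Polynomial.degree a < Polynomial.degree g"
      using ab(1) nz by (simp add: Polynomial.degree_mult_eq)
    then obtain p where "Factorial_Ring.irreducible p" "p dvd a"
      using less.hyps[of a] nz ab(2) by blast
    thus ?thesis using ab(1) less.prems(1)[of p] by simp
  qed
qed

lemma split_off_power:
  fixes P g :: "'a::field poly"
  assumes irr: "Factorial_Ring.irreducible P" and "g \<noteq> 0"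
  obtains n u where "g = P ^ n * u" "\<not> P dvd u"
  using assms(2)
proof (induction "Polynomial.degree g" arbitrary: g thesis rule: less_induct)
  case less
  show ?case
  proof (cases "P dvd g")
    case False
    thus ?thesis using less.prems(1)[of 0 g] by simp
  next
    case True
    then obtain k where k: "g = P * k" by (rule dvdE)
    with less.prems have "k \<noteq> 0" "P \<noteq> 0" by auto
    hence "Polynomial.degree k < Polynomial.degree g"
      using k irreducible_degree_pos[OF irr] by (simp add: Polynomial.degree_mult_eq)
    then obtain n u where "k = P ^ n * u" "\<not> P dvd u"
      using less.hyps[of k] \<open>k \<noteq> 0\<close> by metis
    thus ?thesis using k less.prems(1)[of "Suc n" u] by simp
  qed
qed

lemma fract_to_fract: "Fract u v = to_fract u / to_fract v"
  by (cases "v = 0") (simp_all add: to_fract_def eq_fract)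

lemma to_fract_power: "to_fract (x ^ n) = to_fract x ^ n"
  by (induction n) (simp_all add: to_fract_mult)

text \<open>The exponent in a factorization of this shape is unique: if two exponents differed, then \<open>P\<close> would
  divide a product of numerators and denominators, none of which it divides.\<close>

lemma padic_val_eqI:
  fixes P u v :: "'a::field poly"
  assumes irr: "Factorial_Ring.irreducible P" and uv: "\<not> P dvd u" "\<not> P dvd v"
    and r: "r = to_fract P powi n * Fract u v"
  shows "padic_val P r = n"
  unfolding padic_val_def
proof (rule the_equality)
  show "\<exists>u v. \<not> P dvd u \<and> \<not> P dvd v \<and> r = to_fract P powi n * Fract u v"
    using uv r by blast
next
  fix m assume "\<exists>u v. \<not> P dvd u \<and> \<not> P dvd v \<and> r = to_fract P powi m * Fract u v"
  then obtain u' v' where uv': "\<not> P dvd u'" "\<not> P dvd v'"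
    and r': "r = to_fract P powi m * Fract u' v'" by blast
  have le: "m \<le> n"
    if "\<not> P dvd u" "\<not> P dvd v" "\<not> P dvd u'" "\<not> P dvd v'"
       "to_fract P powi m * Fract u' v' = to_fract P powi n * Fract u v"
    for m n u v u' v'
  proof (rule ccontr)
    assume "\<not> m \<le> n"
    then obtain k where k: "m = n + int (Suc k)"
      by (metis not_le zless_iff_Suc_zadd)
    have nz: "to_fract P \<noteq> 0" "to_fract v \<noteq> 0" "to_fract v' \<noteq> 0"
      using irr that by (auto simp: to_fract_eq_0_iff)
    have "to_fract P powi n * (to_fract P ^ Suc k * Fract u' v') = to_fract P powi n * Fract u v"
      using that(5) nz power_int_add[of "to_fract P" n "int (Suc k)"] unfolding k
      by (simp del: power_Suc of_nat_Suc add: mult.assoc)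
    hence "to_fract P ^ Suc k * Fract u' v' = Fract u v"
      using nz by (metis mult_left_cancel power_int_eq_0_iff)
    hence "to_fract (P ^ Suc k * u' * v) = to_fract (u * v')"
      using nz unfolding fract_to_fract by (simp add: field_simps to_fract_power to_fract_mult)
    hence "P ^ Suc k * u' * v = u * v'" by (simp only: to_fract_eq_iff)
    hence "P dvd u * v'" by (metis dvd_triv_left dvd_mult2 power_Suc)
    thus False using that irreducible_dvd_mult_iff[OF irr] by blast
  qed
  show "m = n" using le[OF uv uv', of m n] le[OF uv' uv, of n m] r r' by force
qed

text \<open>If the root is written as \<open>u / v\<close> with \<open>v\<close> of least degree, then an irreducible factor of \<open>v\<close> would
  divide \<open>u\<^sup>3\<close>, hence \<open>u\<close>, and could be cancelled.\<close>

lemma rational_root_of_cubic: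
  fixes A B :: "'a::field poly"
  assumes "r ^ 3 - to_fract A * r + to_fract B = 0"
  obtains g where "r = to_fract g"
proof -
  define D where "D v \<longleftrightarrow> v \<noteq> 0 \<and> (\<exists>u. r = Fract u v)" for v
  obtain u0 v0 where "r = Fract u0 v0" "v0 \<noteq> 0" by (cases r) auto
  hence "D v0" unfolding D_def by blast
  then obtain v where v: "D v" and least: "\<And>x. D x \<Longrightarrow> Polynomial.degree v \<le> Polynomial.degree x"
    using ex_has_least_nat[of D v0 Polynomial.degree] by blast
  obtain u where u: "r = Fract u v" and v0: "v \<noteq> 0" using v unfolding D_def by blast
  have "to_fract (u ^ 3 - A * u * v ^ 2 + B * v ^ 3) = 0"
    using assms v0 unfolding u fract_to_fract
    by (simp add: field_simps power2_eq_square power3_eq_cube to_fract_eq_0_iff)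
  hence eq: "u ^ 3 - A * u * v ^ 2 + B * v ^ 3 = 0" by (simp only: to_fract_eq_0_iff)
  have "v dvd 1"
  proof (rule ccontr)
    assume nu: "\<not> v dvd 1"
    then obtain p where p: "Factorial_Ring.irreducible p" "p dvd v"
      using v0 irreducible_factor_exists[of v] by blast
    have "u ^ 3 = v * (A * u * v - B * v ^ 2)" using eq by (simp add: power2_eq_square power3_eq_cube algebra_simps)
    hence "p dvd u ^ 3" using p(2) by simp
    hence "p dvd u" using irreducible_dvd_power_iff[OF p(1)] by simp
    then obtain u' v' where uv: "u = p * u'" "v = p * v'" using p(2) by (auto elim!: dvdE)
    hence "p \<noteq> 0" "v' \<noteq> 0" using v0 by auto
    hence "D v'" unfolding D_def u uv fract_to_fract by (auto simp: to_fract_eq_0_iff to_fract_mult)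
    from least[OF this] show False using uv \<open>p \<noteq> 0\<close> \<open>v' \<noteq> 0\<close> irreducible_degree_pos[OF p(1)]
      by (simp add: Polynomial.degree_mult_eq)
  qed
  then obtain k where k: "1 = v * k" by (rule dvdE)
  have "to_fract v * to_fract k = 1" by (metis k to_fract_1 to_fract_mult)
  hence "r = to_fract (u * k)" using v0 unfolding u fract_to_fract
    by (simp add: field_simps to_fract_eq_0_iff to_fract_mult)
  thus thesis by (rule that)
qed

section \<open>Characteristic three\<close>

text \<open>Adding one permutes the ring, so it does not change the sum of all elements.\<close>

lemma of_nat_card_eq_0: "of_nat CARD('a::{finite,ring_1}) = (0::'a)"
proof -
  have "(\<Sum>x\<in>UNIV. x) = (\<Sum>x\<in>UNIV. x + 1 :: 'a)"
    by (rule sum.reindex_bij_witness[of _ "\<lambda>x. x + 1" "\<lambda>x. x - 1"]) auto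
  thus ?thesis by (simp add: sum.distrib)
qed

lemma three_eq_0:
  assumes "CARD('a::{finite,field}) = 3 ^ e"
  shows "(3::'a) = 0"
proof -
  have "(3::'a) ^ e = 0" using of_nat_card_eq_0[where 'a = 'a] assms by simp
  thus ?thesis by simp
qed


section \<open>Cubic extensions and their traces\<close>

text \<open>A quadratic relation \<open>t\<^sup>2 = a + b t\<close>, inserted into the cubic, either gives \<open>t \<in> k\<close> or shows that
  \<open>-b\<close> is a root of the cubic in \<open>k\<close>. The subfield \<open>k\<close> is a set because the lemma is applied to the
  image of the rational functions as well as to a residue field inside an algebraic closure.\<close>

lemma cubic_root_independent:
  fixes t \<alpha> \<beta> c0 c1 c2 :: "'f::field" and k :: "'f set"
  assumes k: "0 \<in> k" "\<And>u v. u \<in> k \<Longrightarrow> v \<in> k \<Longrightarrow> u - v \<in> k"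
      "\<And>u v. u \<in> k \<Longrightarrow> v \<in> k \<Longrightarrow> u / v \<in> k"
    and \<alpha>\<beta>: "\<alpha> \<in> k" "\<beta> \<in> k" and root: "t ^ 3 - \<alpha> * t + \<beta> = 0"
    and noroot: "\<And>r. r \<in> k \<Longrightarrow> r ^ 3 - \<alpha> * r + \<beta> \<noteq> 0"
    and c: "c0 \<in> k" "c1 \<in> k" "c2 \<in> k" and eq: "c0 + c1 * t + c2 * t ^ 2 = 0"
  shows "c0 = 0 \<and> c1 = 0 \<and> c2 = 0"
proof -
  have neg: "- u \<in> k" if "u \<in> k" for u using k(2)[OF k(1) that] by simp
  have mult: "u * v \<in> k" if "u \<in> k" "v \<in> k" for u v
  proof (cases "v = 0")
    case False
    have "v / v / v \<in> k" using that k(3) by blast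
    hence "u / (v / v / v) \<in> k" using that k(3) by blast
    thus ?thesis using False by simp
  qed (simp add: k(1))
  have add: "u + v \<in> k" if "u \<in> k" "v \<in> k" for u v
    using k(2)[OF that(1) neg[OF that(2)]] by simp
  have t: "t \<notin> k" using root noroot by blast
  have c2: "c2 = 0"
  proof (rule ccontr)
    assume nz: "c2 \<noteq> 0"
    define a b where "a = - c0 / c2" and "b = - c1 / c2"
    have ab: "a \<in> k" "b \<in> k" unfolding a_def b_def using c neg k(3) by blast+
    have "c2 * a = - c0" "c2 * b = - c1" using nz unfolding a_def b_def by simp_all
    moreover have "c2 * (a + b * t) = c2 * a + (c2 * b) * t" by (simp add: algebra_simps)
    moreover have "c2 * t ^ 2 = - c0 - c1 * t" using eq by (simp add: algebra_simps eq_neg_iff_add_eq_0)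
    ultimately have "c2 * t ^ 2 = c2 * (a + b * t)" by simp
    hence t2: "t ^ 2 = a + b * t" using nz by simp
    have "t ^ 3 = t * (a + b * t)" by (simp add: t2[symmetric] power2_eq_square power3_eq_cube)
    also have "\<dots> = a * t + b * t ^ 2" by (simp add: power2_eq_square algebra_simps)
    finally have t3: "t ^ 3 = a * t + b * (a + b * t)" by (simp only: t2)
    have "(\<alpha> - (a + b * b)) * t = a * b + \<beta> - (t ^ 3 - \<alpha> * t + \<beta>)"
      unfolding t3 by (simp add: algebra_simps)
    hence lin: "(\<alpha> - (a + b * b)) * t = a * b + \<beta>" unfolding root by simp
    show False
    proof (cases "\<alpha> = a + b * b")
      case False
      hence "t = (a * b + \<beta>) / (\<alpha> - (a + b * b))" using lin by (simp add: field_simps)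
      thus False using t ab \<alpha>\<beta> k(2,3) mult add by simp
    next
      case True
      have "(- b) ^ 3 - \<alpha> * (- b) + \<beta> = a * b + \<beta>"
        unfolding True by (simp add: power3_eq_cube algebra_simps)
      hence "(- b) ^ 3 - \<alpha> * (- b) + \<beta> = 0" using lin True by simp
      thus False using noroot neg ab by blast
    qed
  qed
  have "c1 = 0"
  proof (rule ccontr)
    assume "c1 \<noteq> 0"
    moreover have "t * c1 = - c0" using eq c2 by (simp add: eq_neg_iff_add_eq_0 ac_simps)
    ultimately have "t = - c0 / c1" by (simp only: nonzero_eq_divide_eq not_False_eq_True)
    thus False using t c neg k(3) by simp
  qed
  thus ?thesis using c2 eq by simp
qed

text \<open>The relations are those satisfied by \<open>y\<close> and \<open>\<theta> = y\<^sup>2 / \<pi>\<close> when \<open>y\<^sup>3 = \<pi> a y - \<pi>\<^sup>2 c\<close>. The scalars \<open>'k\<close>,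
  embedded by \<open>j\<close>, are polynomials when the span of \<open>1\<close>, \<open>y\<close>, \<open>\<theta>\<close> is considered as an order, and
  rational functions when it is considered as a cubic field.\<close>

locale cubic_algebra =
  fixes j :: "'k::idom \<Rightarrow> 'f::field" and \<pi> a c :: 'k and y \<theta> :: 'f
  assumes j_add: "j (u + v) = j u + j v" and j_mult: "j (u * v) = j u * j v" and j_1: "j (1::'k) = (1::'f)"
    and yy: "y * y = j \<pi> * \<theta>" and y\<theta>: "y * \<theta> = j a * y - j \<pi> * j c"
    and \<theta>\<theta>: "\<theta> * \<theta> = j a * \<theta> - j c * y"
    and indep: "j c0 + j c1 * y + j c2 * \<theta> = 0 \<Longrightarrow> c0 = 0 \<and> c1 = 0 \<and> c2 = 0"
begin

definition lin :: "'k \<Rightarrow> 'k \<Rightarrow> 'k \<Rightarrow> 'f" where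
  "lin c0 c1 c2 = j c0 + j c1 * y + j c2 * \<theta>"

lemma j_0: "j 0 = 0"
proof -
  have "j 0 + j 0 = j 0 + 0" using j_add[of 0 0] by simp
  thus ?thesis by (simp only: add_left_cancel)
qed

lemma j_minus: "j (- u) = - j u" using j_add[of u "- u"] j_0 by (simp add: eq_neg_iff_add_eq_0 add.commute)
lemma j_diff: "j (u - v) = j u - j v" using j_add[of u "- v"] j_minus by simp
lemma j_power: "j (u ^ n) = j u ^ n" by (induction n) (simp_all add: j_1 j_mult)
lemma j_eq_0_iff: "j u = 0 \<longleftrightarrow> u = 0" using indep[of u 0 0] by (auto simp: j_0)
lemmas j_simps = j_0 j_1 j_add j_mult j_minus j_diff j_power

lemma lin_1: "lin 1 0 0 = (1::'f)" and lin_y: "lin 0 1 0 = y" and lin_\<theta>: "lin 0 0 1 = \<theta>"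
  and lin_const: "lin u 0 0 = j u"
  by (simp_all add: lin_def j_simps)

lemma lin_add: "lin a0 a1 a2 + lin b0 b1 b2 = lin (a0 + b0) (a1 + b1) (a2 + b2)"
  and lin_diff: "lin a0 a1 a2 - lin b0 b1 b2 = lin (a0 - b0) (a1 - b1) (a2 - b2)"
  and lin_minus: "- lin a0 a1 a2 = lin (- a0) (- a1) (- a2)"
  and lin_scale: "j s * lin a0 a1 a2 = lin (s * a0) (s * a1) (s * a2)"
  by (simp_all add: lin_def j_simps algebra_simps)

lemma lin_mult: "lin a0 a1 a2 * lin b0 b1 b2 =
    lin (a0 * b0 - (a1 * b2 + a2 * b1) * (\<pi> * c))
        (a0 * b1 + a1 * b0 + a * (a1 * b2 + a2 * b1) - c * (a2 * b2))
        (a0 * b2 + a2 * b0 + \<pi> * (a1 * b1) + a * (a2 * b2))"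
proof -
  have "lin a0 a1 a2 * lin b0 b1 b2 =
     j a0 * j b0 + (j a0 * j b1 + j a1 * j b0) * y + (j a0 * j b2 + j a2 * j b0) * \<theta>
     + (j a1 * j b1) * (y * y) + (j a1 * j b2 + j a2 * j b1) * (y * \<theta>) + (j a2 * j b2) * (\<theta> * \<theta>)"
    unfolding lin_def by (simp add: algebra_simps)
  also have "\<dots> = lin (a0 * b0 - (a1 * b2 + a2 * b1) * (\<pi> * c))
        (a0 * b1 + a1 * b0 + a * (a1 * b2 + a2 * b1) - c * (a2 * b2))
        (a0 * b2 + a2 * b0 + \<pi> * (a1 * b1) + a * (a2 * b2))"
    unfolding yy y\<theta> \<theta>\<theta> lin_def by (simp add: j_simps algebra_simps)
  finally show ?thesis .
qed

lemma lin_eq_0_iff: "lin c0 c1 c2 = 0 \<longleftrightarrow> c0 = 0 \<and> c1 = 0 \<and> c2 = 0"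
  using indep by (auto simp: lin_def j_0)

lemma lin_eq_iff: "lin a0 a1 a2 = lin b0 b1 b2 \<longleftrightarrow> a0 = b0 \<and> a1 = b1 \<and> a2 = b2"
  using lin_eq_0_iff[of "a0 - b0" "a1 - b1" "a2 - b2"] by (simp add: lin_diff[symmetric])

definition lin_span :: "'f set" where "lin_span = {lin c0 c1 c2 | c0 c1 c2. True}"

lemma lin_in_lin_span: "lin c0 c1 c2 \<in> lin_span" unfolding lin_span_def by blast

lemma lin_spanE: assumes "z \<in> lin_span" obtains c0 c1 c2 where "z = lin c0 c1 c2"
  using assms unfolding lin_span_def by blast

lemma lin_span_add: "u \<in> lin_span \<Longrightarrow> v \<in> lin_span \<Longrightarrow> u + v \<in> lin_span"
  and lin_span_mult: "u \<in> lin_span \<Longrightarrow> v \<in> lin_span \<Longrightarrow> u * v \<in> lin_span"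
  and lin_span_minus: "u \<in> lin_span \<Longrightarrow> - u \<in> lin_span"
  and lin_span_scale: "v \<in> lin_span \<Longrightarrow> j s * v \<in> lin_span"
  by (auto elim!: lin_spanE simp: lin_add lin_mult lin_minus lin_scale lin_in_lin_span)

lemma lin_span_const: "j s \<in> lin_span" using lin_in_lin_span[of s 0 0] by (simp add: lin_const)

lemma lin_span_sum: "(\<And>x. x \<in> U \<Longrightarrow> g x \<in> lin_span) \<Longrightarrow> sum g U \<in> lin_span"
  by (induction U rule: infinite_finite_induct) (use lin_span_const[of 0] in \<open>auto simp: j_0 lin_span_add\<close>)

lemma is_basis_lin_span: "is_basis j lin_span (vector [1, y, \<theta>] :: 'f ^ 3)"
  unfolding is_basis_def
proof (rule bij_betw_imageI)
  let ?f = "\<lambda>v :: 'k ^ 3. \<Sum>i\<in>UNIV. j (v $ i) * (vector [1, y, \<theta>] :: 'f ^ 3) $ i"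
  have f: "?f v = lin (v $ 1) (v $ 2) (v $ 3)" for v by (simp add: sum_3 lin_def)
  show "inj_on ?f UNIV" unfolding f by (auto simp: inj_on_def lin_eq_iff vec_eq_iff forall_3)
  show "range ?f = lin_span"
  proof
    show "range ?f \<subseteq> lin_span" unfolding f using lin_in_lin_span by auto
    show "lin_span \<subseteq> range ?f"
    proof
      fix z assume "z \<in> lin_span"
      then obtain c0 c1 c2 where "z = lin c0 c1 c2" by (rule lin_spanE)
      hence "z = ?f (vector [c0, c1, c2])" unfolding f by simp
      thus "z \<in> range ?f" by blast
    qed
  qed
qed

end

text \<open>Two matrices of one multiplication map are conjugate, so they have the same trace.\<close>

lemma trace_basis_independent:
  fixes j :: "'k::field \<Rightarrow> 'f::field" and w w' :: "'f ^ 3" and M M' :: "'k ^ 3 ^ 3"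
  assumes j: "\<And>u v. j (u + v) = j u + j v" "\<And>u v. j (u * v) = j u * j v" "j 0 = 0" "j 1 = 1"
    and w: "is_basis j F w" and w': "is_basis j F w'"
    and M: "\<And>i. \<alpha> * w $ i = (\<Sum>l\<in>UNIV. j (M $ l $ i) * w $ l)"
    and M': "\<And>i. \<alpha> * w' $ i = (\<Sum>l\<in>UNIV. j (M' $ l $ i) * w' $ l)"
  shows "trace M = trace M'"
proof -
  have j_sum: "j (sum g U) = (\<Sum>x\<in>U. j (g x))" for g :: "3 \<Rightarrow> 'k" and U
    by (induction U rule: infinite_finite_induct) (simp_all add: j)
  have uniq: "U = Y"
    if "is_basis j F w" "\<And>i. (\<Sum>l\<in>UNIV. j (U $ l $ i) * w $ l) = (\<Sum>l\<in>UNIV. j (Y $ l $ i) * w $ l)"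
    for U Y :: "'k ^ 3 ^ 3" and w :: "'f ^ 3"
  proof -
    have inj: "inj (\<lambda>v :: 'k ^ 3. \<Sum>i\<in>UNIV. j (v $ i) * w $ i)"
      using that(1) unfolding is_basis_def by (rule bij_betw_imp_inj_on)
    have "(\<chi> l. U $ l $ i) = (\<chi> l. Y $ l $ i)" for i
      by (rule injD[OF inj]) (simp add: that(2))
    thus ?thesis by (simp add: vec_eq_iff)
  qed
  have memF: "w $ i \<in> F" if "is_basis j F w" for w :: "'f ^ 3" and i
  proof -
    have "(\<Sum>l\<in>UNIV. j ((axis i 1 :: 'k ^ 3) $ l) * w $ l) = (\<Sum>l\<in>UNIV. if l = i then w $ l else 0)"
      by (rule sum.cong) (auto simp: axis_def j)
    hence "w $ i = (\<Sum>l\<in>UNIV. j ((axis i 1 :: 'k ^ 3) $ l) * w $ l)" by simp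
    thus ?thesis using that unfolding is_basis_def bij_betw_def by blast
  qed
  have coord: "\<exists>C :: 'k ^ 3 ^ 3. \<forall>i. v $ i = (\<Sum>l\<in>UNIV. j (C $ l $ i) * w $ l)"
    if "is_basis j F w" "is_basis j F v" for w v :: "'f ^ 3"
  proof -
    have "\<exists>x :: 'k ^ 3. v $ i = (\<Sum>l\<in>UNIV. j (x $ l) * w $ l)" for i
      using memF[OF that(2), of i] that(1) unfolding is_basis_def bij_betw_def by blast
    then obtain x :: "3 \<Rightarrow> 'k ^ 3" where "\<And>i. v $ i = (\<Sum>l\<in>UNIV. j (x i $ l) * w $ l)" by metis
    thus ?thesis by (intro exI[of _ "\<chi> l i. x i $ l"]) simp
  qed
  have comp: "(\<Sum>i\<in>UNIV. j (Y $ i $ m) * (\<Sum>l\<in>UNIV. j (U $ l $ i) * w $ l)) =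
      (\<Sum>l\<in>UNIV. j ((U ** Y) $ l $ m) * w $ l)" for U Y :: "'k ^ 3 ^ 3" and w :: "'f ^ 3" and m
  proof -
    have "(\<Sum>i\<in>UNIV. j (Y $ i $ m) * (\<Sum>l\<in>UNIV. j (U $ l $ i) * w $ l)) =
      (\<Sum>i\<in>UNIV. \<Sum>l\<in>UNIV. j (U $ l $ i * Y $ i $ m) * w $ l)"
      by (simp add: sum_distrib_left j mult_ac)
    also have "\<dots> = (\<Sum>l\<in>UNIV. \<Sum>i\<in>UNIV. j (U $ l $ i * Y $ i $ m) * w $ l)" by (rule sum.swap)
    also have "\<dots> = (\<Sum>l\<in>UNIV. j ((U ** Y) $ l $ m) * w $ l)"
      by (simp add: matrix_matrix_mult_def j_sum sum_distrib_right)
    finally show ?thesis .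
  qed
  obtain C C' :: "'k ^ 3 ^ 3" where
    C: "\<And>i. w' $ i = (\<Sum>l\<in>UNIV. j (C $ l $ i) * w $ l)" and
    C': "\<And>i. w $ i = (\<Sum>l\<in>UNIV. j (C' $ l $ i) * w' $ l)"
    using coord[OF w w'] coord[OF w' w] by blast
  have "C ** C' = mat 1"
  proof (rule uniq[OF w])
    fix m
    have "(\<Sum>l\<in>UNIV. j ((C ** C') $ l $ m) * w $ l) = w $ m"
      unfolding comp[symmetric] C[symmetric] C'[symmetric] ..
    also have "w $ m = (\<Sum>l\<in>UNIV. if l = m then w $ l else 0)" by simp
    also have "\<dots> = (\<Sum>l\<in>UNIV. j ((mat 1 :: 'k ^ 3 ^ 3) $ l $ m) * w $ l)"
      by (rule sum.cong) (auto simp: mat_def j)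
    finally show "(\<Sum>l\<in>UNIV. j ((C ** C') $ l $ m) * w $ l) =
      (\<Sum>l\<in>UNIV. j ((mat 1 :: 'k ^ 3 ^ 3) $ l $ m) * w $ l)" .
  qed
  moreover have "M ** C = C ** M'"
  proof (rule uniq[OF w])
    fix m
    have "(\<Sum>l\<in>UNIV. j ((C ** M') $ l $ m) * w $ l) = \<alpha> * w' $ m"
      unfolding comp[symmetric] C[symmetric] M' ..
    also have "\<dots> = (\<Sum>i\<in>UNIV. j (C $ i $ m) * (\<alpha> * w $ i))"
      unfolding C by (simp add: sum_distrib_left mult_ac)
    also have "\<dots> = (\<Sum>l\<in>UNIV. j ((M ** C) $ l $ m) * w $ l)" unfolding M comp ..
    finally show "(\<Sum>l\<in>UNIV. j ((M ** C) $ l $ m) * w $ l) =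
      (\<Sum>l\<in>UNIV. j ((C ** M') $ l $ m) * w $ l)" ..
  qed
  ultimately have "M = C ** M' ** C'"
    by (metis matrix_mul_assoc matrix_mul_rid)
  hence "trace M = trace ((C ** M') ** C')" by simp
  also have "\<dots> = trace (C' ** (C ** M'))" by (rule trace_mul_sym)
  also have "\<dots> = trace M'"
    using matrix_left_right_inverse[of C C'] \<open>C ** C' = mat 1\<close>
    by (simp add: matrix_mul_assoc matrix_mul_lid)
  finally show ?thesis .
qed

locale cubic_field_algebra = cubic_algebra j \<pi> a c y \<theta>
  for j :: "'k::field \<Rightarrow> 'f::field" and \<pi> a c y \<theta>
begin

lemma field_trace_lin: "field_trace j lin_span (lin c0 c1 c2) = 3 * c0 + 2 * a * c2"
proof -
  let ?b = "vector [1, y, \<theta>] :: 'f ^ 3"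
  define M where "M = (vector [vector [c0, - (c2 * (\<pi> * c)), - (c1 * (\<pi> * c))],
    vector [c1, c0 + a * c2, a * c1 - c * c2], vector [c2, \<pi> * c1, c0 + a * c2]] :: 'k ^ 3 ^ 3)"
  have bl: "?b $ i = (if i = 1 then lin 1 0 0 else if i = 2 then lin 0 1 0 else lin 0 0 1)" for i :: 3
    using exhaust_3[of i] by (auto simp: lin_1 lin_y lin_\<theta>)
  have M: "lin c0 c1 c2 * ?b $ i = (\<Sum>l\<in>UNIV. j (M $ l $ i) * ?b $ l)" for i
  proof -
    have "(\<Sum>l\<in>UNIV. j (M $ l $ i) * ?b $ l) = lin (M $ 1 $ i) (M $ 2 $ i) (M $ 3 $ i)"
      by (simp add: sum_3 lin_def)
    thus ?thesis unfolding bl using exhaust_3[of i]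
      by (auto simp: lin_mult M_def algebra_simps)
  qed
  have trM: "trace M = 3 * c0 + 2 * a * c2"
    by (simp add: trace_def sum_3 M_def algebra_simps)
  show ?thesis unfolding field_trace_def trM[symmetric]
  proof (rule the_equality)
    show "\<exists>(w :: 'f ^ 3) M'. is_basis j lin_span w \<and>
        (\<forall>i. lin c0 c1 c2 * w $ i = (\<Sum>l\<in>UNIV. j (M' $ l $ i) * w $ l)) \<and> trace M = trace M'"
      using is_basis_lin_span M by (intro exI[of _ ?b] exI[of _ M]) simp
  next
    fix t assume "\<exists>(w :: 'f ^ 3) M'. is_basis j lin_span w \<and>
        (\<forall>i. lin c0 c1 c2 * w $ i = (\<Sum>l\<in>UNIV. j (M' $ l $ i) * w $ l)) \<and> t = trace M'"
    then obtain w :: "'f ^ 3" and M' where "is_basis j lin_span w" "t = trace M'"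
      "\<And>i. lin c0 c1 c2 * w $ i = (\<Sum>l\<in>UNIV. j (M' $ l $ i) * w $ l)" by blast
    thus "t = trace M"
      using trace_basis_independent[OF j_add j_mult j_0 j_1 is_basis_lin_span, of w "lin c0 c1 c2" M M'] M
      by metis
  qed
qed

lemma field_trace_add: "u \<in> lin_span \<Longrightarrow> v \<in> lin_span \<Longrightarrow>
    field_trace j lin_span (u + v) = field_trace j lin_span u + field_trace j lin_span v"
  and field_trace_scale: "v \<in> lin_span \<Longrightarrow> field_trace j lin_span (j s * v) = s * field_trace j lin_span v"
  by (auto elim!: lin_spanE simp: lin_add lin_scale field_trace_lin algebra_simps)

lemma field_trace_sum: "(\<And>x. x \<in> U \<Longrightarrow> g x \<in> lin_span) \<Longrightarrow> finite U \<Longrightarrow>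
    field_trace j lin_span (sum g U) = (\<Sum>x\<in>U. field_trace j lin_span (g x))"
proof (induction U rule: infinite_finite_induct)
  case empty
  show ?case using field_trace_lin[of 0 0 0] by (simp add: lin_const j_0)
qed (auto simp: field_trace_add lin_span_sum)

text \<open>If \<open>G\<close> is the Gram matrix of the trace form on \<open>w\<close>, then \<open>D G D\<^sup>T\<close> is the one on \<open>b\<close>.\<close>

lemma disc_of_change:
  fixes w b :: "'f ^ 3" and D :: "'k ^ 3 ^ 3"
  assumes w: "\<And>i. w $ i \<in> lin_span" and b: "\<And>i. b $ i = (\<Sum>l\<in>UNIV. j (D $ i $ l) * w $ l)"
  shows "disc_of j lin_span b = det D ^ 2 * disc_of j lin_span w"
proof -
  define G where "G = (\<chi> i l. field_trace j lin_span (w $ i * w $ l))"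
  have tr: "field_trace j lin_span (b $ i * b $ m) = (\<Sum>l\<in>UNIV. \<Sum>n\<in>UNIV. D $ i $ l * D $ m $ n * G $ l $ n)"
    for i m
  proof -
    have "b $ i * b $ m = (\<Sum>l\<in>UNIV. \<Sum>n\<in>UNIV. j (D $ i $ l * D $ m $ n) * (w $ l * w $ n))"
      unfolding b by (simp add: sum_product j_mult mult_ac)
    thus ?thesis
      by (simp add: field_trace_sum field_trace_scale lin_span_sum lin_span_scale lin_span_mult w G_def)
  qed
  have "(\<chi> i l. field_trace j lin_span (b $ i * b $ l)) = D ** G ** transpose D"
    by (simp add: vec_eq_iff tr matrix_matrix_mult_def transpose_def sum_3 algebra_simps)
  thus ?thesis unfolding disc_of_def G_def[symmetric]
    by (simp add: det_mul det_transpose power2_eq_square mult_ac)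
qed

text \<open>In characteristic three the trace is \<open>2 a\<close> times the coefficient of \<open>\<theta>\<close>. The Gram matrix therefore
  vanishes above the antidiagonal, whose entries are \<open>2 a\<close>, \<open>2 \<pi> a\<close>, \<open>2 a\<close>.\<close>

lemma disc_of_standard_basis:
  assumes "(3::'k) = 0"
  shows "disc_of j lin_span (vector [1, y, \<theta>]) = \<pi> * a ^ 3"
proof -
  define T where "T = field_trace j lin_span"
  have Tr: "T (lin c0 c1 c2) = 2 * a * c2" for c0 c1 c2
    using field_trace_lin assms unfolding T_def by simp
  have yy': "y * y = lin 0 0 \<pi>" "y * \<theta> = lin (- (\<pi> * c)) a 0" "\<theta> * y = lin (- (\<pi> * c)) a 0"
    "\<theta> * \<theta> = lin 0 (- c) a"
    using yy y\<theta> \<theta>\<theta> by (simp_all add: lin_def j_simps mult.commute)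
  have T: "T 1 = 0" "T y = 0" "T \<theta> = 2 * a" "T (y * y) = 2 * a * \<pi>" "T (y * \<theta>) = 0" "T (\<theta> * y) = 0"
    "T (\<theta> * \<theta>) = 2 * a * a"
    using Tr[of 1 0 0] Tr[of 0 1 0] Tr[of 0 0 1] by (simp_all add: yy' Tr lin_1 lin_y lin_\<theta>)
  have "disc_of j lin_span (vector [1, y, \<theta>]) = - (8 * (\<pi> * a ^ 3))"
    unfolding disc_of_def T_def[symmetric] det_3
    by (simp add: T power3_eq_cube algebra_simps)
  also have "\<dots> = \<pi> * a ^ 3 - 3 * (3 * (\<pi> * a ^ 3))" by simp
  finally show ?thesis using assms by simp
qed

end


section \<open>The function field\<close>

lemma ring_of_type_algebra_simps:
  "carrier ring_of_type_algebra = UNIV" "monoid.mult ring_of_type_algebra = (*)"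
  "monoid.one ring_of_type_algebra = 1" "ring.zero ring_of_type_algebra = 0"
  "ring.add ring_of_type_algebra = (+)"
  by (simp_all add: ring_of_type_algebra_def)

lemma a_inv_ring_of_type_algebra:
  fixes x :: "'f::comm_ring_1"
  shows "a_inv ring_of_type_algebra x = - x"
proof -
  interpret cring "ring_of_type_algebra :: 'f ring" by (rule cring_from_type_algebra)
  show ?thesis by (rule minus_equality) (simp_all add: ring_of_type_algebra_simps)
qed

lemma m_inv_ring_of_type_algebra:
  fixes x :: "'f::field"
  assumes "x \<noteq> 0"
  shows "m_inv ring_of_type_algebra x = inverse x"
proof -
  interpret cring "ring_of_type_algebra :: 'f ring" by (rule cring_from_type_algebra)
  show ?thesis by (rule comm_inv_char) (use assms in \<open>simp_all add: ring_of_type_algebra_simps\<close>)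
qed

lemma ring_hom_type_algebra:
  assumes "\<iota> \<in> ring_hom ring_of_type_algebra ring_of_type_algebra"
  shows "\<iota> (u + v) = \<iota> u + \<iota> v" "\<iota> (u * v) = \<iota> u * \<iota> v" "\<iota> 1 = 1"
  using ring_hom_add[OF assms, of u v] ring_hom_mult[OF assms, of u v] ring_hom_one[OF assms]
  by (simp_all add: ring_of_type_algebra_simps)

context cubic_field_algebra
begin

text \<open>Multiplication by \<open>y - s\<close> for a suitable \<open>s\<close> removes the coefficient of \<open>\<theta>\<close>. What remains is a
  scalar or a multiple of some \<open>y - r\<close>, and \<open>y - r\<close> divides the value of the defining cubic at \<open>r\<close>.\<close>

lemma inverse_in_lin_span:
  assumes \<pi>: "\<pi> \<noteq> 0" and "z \<in> lin_span"
  shows "inverse z \<in> lin_span"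
proof -
  have linear: "inverse (lin c0 c1 0) \<in> lin_span" for c0 c1
  proof (cases "c1 = 0")
    case True
    have "inverse (j c0) = j (inverse c0)"
      by (cases "c0 = 0") (auto simp: j_0 intro!: inverse_unique simp: j_mult[symmetric] j_1)
    thus ?thesis using True lin_span_const by (simp add: lin_const)
  next
    case False
    define r where "r = - c0 / c1"
    define N where "N = - (r ^ 3 - \<pi> * a * r + \<pi> * \<pi> * c)"
    define g where "g = lin (r * r - \<pi> * a) r \<pi>"
    have z: "lin c0 c1 0 = j c1 * lin (- r) 1 0"
      unfolding lin_scale lin_eq_iff r_def using False by simp
    have prod: "lin (- r) 1 0 * g = j N"
      unfolding g_def lin_mult lin_const[symmetric] lin_eq_iff N_def
      by (simp add: algebra_simps power3_eq_cube)
    have "lin (- r) 1 0 \<noteq> 0" "g \<noteq> 0" unfolding g_def lin_eq_0_iff using \<pi> by simp_all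
    hence N: "j N \<noteq> 0" using prod by (metis mult_eq_0_iff)
    hence "N \<noteq> 0" using j_0 by blast
    have "lin c0 c1 0 * (j (inverse (c1 * N)) * g) = j (c1 * inverse (c1 * N)) * (lin (- r) 1 0 * g)"
      unfolding z j_mult by (simp add: mult_ac)
    also have "\<dots> = j (c1 * inverse (c1 * N) * N)" unfolding prod j_mult ..
    also have "c1 * inverse (c1 * N) * N = 1" using False \<open>N \<noteq> 0\<close> by (simp add: field_simps)
    also have "j 1 = 1" by (rule j_1)
    finally have "inverse (lin c0 c1 0) = j (inverse (c1 * N)) * g" by (rule inverse_unique)
    thus ?thesis unfolding g_def using lin_span_scale[OF lin_in_lin_span] by simp
  qed
  obtain c0 c1 c2 where z: "z = lin c0 c1 c2" using assms(2) by (rule lin_spanE)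
  show ?thesis
  proof (cases "c2 = 0 \<or> z = 0")
    case True
    thus ?thesis using linear z lin_span_const[of 0] by (auto simp: j_0)
  next
    case False
    define s where "s = \<pi> * c1 / c2"
    have "\<exists>d0 d1. z * lin (- s) 1 0 = lin d0 d1 0"
      unfolding z lin_mult lin_eq_iff s_def using False by simp
    then obtain d0 d1 where d: "z * lin (- s) 1 0 = lin d0 d1 0" by blast
    have "lin (- s) 1 0 \<noteq> 0" by (simp add: lin_eq_0_iff)
    hence nz: "lin d0 d1 0 \<noteq> 0" using d False by (metis mult_eq_0_iff)
    hence "z * (lin (- s) 1 0 * inverse (lin d0 d1 0)) = 1"
      using d by (simp add: mult.assoc[symmetric])
    hence "inverse z = lin (- s) 1 0 * inverse (lin d0 d1 0)" by (rule inverse_unique)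
    thus ?thesis using lin_span_mult[OF lin_in_lin_span linear] by simp
  qed
qed

lemma function_field_eq_lin_span:
  assumes \<pi>: "\<pi> \<noteq> 0"
  shows "generate_field ring_of_type_algebra (insert y (range j)) = lin_span"
proof
  let ?F = "generate_field ring_of_type_algebra (insert y (range j))"
  show "?F \<subseteq> lin_span"
  proof
    fix z assume "z \<in> ?F"
    thus "z \<in> lin_span"
    proof (induction rule: generate_field.induct)
      case one
      show ?case using lin_span_const[of 1] by (simp add: ring_of_type_algebra_simps j_1)
    next
      case (incl h)
      thus ?case using lin_span_const lin_in_lin_span[of 0 1 0] by (auto simp: lin_y)
    next
      case (a_inv h)
      show ?case unfolding a_inv_ring_of_type_algebra by (rule lin_span_minus) (rule a_inv.IH)
    next
      case (m_inv h)
      hence "m_inv ring_of_type_algebra h = inverse h"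
        by (intro m_inv_ring_of_type_algebra) (simp add: ring_of_type_algebra_simps)
      thus ?case using inverse_in_lin_span[OF \<pi> m_inv.IH] by simp
    next
      case (eng_add h1 h2)
      show ?case unfolding ring_of_type_algebra_simps by (rule lin_span_add) (fact eng_add.IH)+
    next
      case (eng_mult h1 h2)
      show ?case unfolding ring_of_type_algebra_simps by (rule lin_span_mult) (fact eng_mult.IH)+
    qed
  qed
  have jF: "j s \<in> ?F" and yF: "y \<in> ?F" for s by (rule generate_field.incl; simp)+
  have mult: "u * v \<in> ?F" and add: "u + v \<in> ?F" if "u \<in> ?F" "v \<in> ?F" for u v
    using generate_field.eng_mult[OF that] generate_field.eng_add[OF that]
    by (simp_all add: ring_of_type_algebra_simps)
  have "\<theta> = j (inverse \<pi>) * (y * y)"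
    unfolding yy using \<pi> by (simp add: mult.assoc[symmetric] j_mult[symmetric] j_1)
  hence "\<theta> \<in> ?F" using mult jF yF by metis
  thus "lin_span \<subseteq> ?F"
    by (auto elim!: lin_spanE simp: lin_def intro!: mult add jF yF)
qed

end

lemma cube_add_char_3:
  fixes u v :: "'r::comm_ring_1"
  assumes "(3::'r) = 0"
  shows "(u + v) ^ 3 = u ^ 3 + v ^ 3" and "(u - v) ^ 3 = u ^ 3 - v ^ 3"
proof -
  have "(u + v) ^ 3 = u ^ 3 + v ^ 3 + 3 * (u ^ 2 * v + u * v ^ 2)"
    "(u - v) ^ 3 = u ^ 3 - v ^ 3 + 3 * (u * v ^ 2 - u ^ 2 * v)"
    by (simp_all add: power3_eq_cube power2_eq_square algebra_simps)
  thus "(u + v) ^ 3 = u ^ 3 + v ^ 3" "(u - v) ^ 3 = u ^ 3 - v ^ 3" by (simp_all add: assms)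
qed

text \<open>Cubing is additive, so \<open>y - i\<close> is a root of \<open>T\<^sup>3 - A T + (i\<^sup>3 - i A + B)\<close>.\<close>

lemma cubic_field_algebraI:
  fixes \<iota> :: "'k::field \<Rightarrow> 'f::field"
  assumes hom: "\<iota> \<in> ring_hom ring_of_type_algebra ring_of_type_algebra"
    and root: "y ^ 3 - \<iota> A * y + \<iota> B = 0" and noroot: "\<And>r. r ^ 3 - A * r + B \<noteq> 0"
    and char: "(3::'k) = 0" "(3::'f) = 0"
    and "\<pi> \<noteq> 0" and a: "A = \<pi> * a" and c: "i ^ 3 - i * A + B = \<pi> * \<pi> * c"
  shows "cubic_field_algebra \<iota> \<pi> a c (y - \<iota> i) ((y - \<iota> i) ^ 2 / \<iota> \<pi>)"
proof -
  note h = ring_hom_type_algebra[OF hom]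
  have h0: "\<iota> 0 = 0" using h(1)[of 0 0] by (metis add_cancel_right_left)
  have hdiff: "\<iota> (u - v) = \<iota> u - \<iota> v" for u v using h(1)[of "u - v" v] by (simp add: eq_diff_eq)
  have hpow: "\<iota> (u ^ n) = \<iota> u ^ n" for u n by (induction n) (simp_all add: h)
  have hz: "\<iota> u = 0 \<longleftrightarrow> u = 0" for u
    using h(2)[of u "inverse u"] h(3) h0 by (metis mult_zero_left right_inverse zero_neq_one)
  have hdiv: "\<iota> (u / v) = \<iota> u / \<iota> v" for u v
  proof (cases "v = 0")
    case False
    hence "\<iota> (u / v) * \<iota> v = \<iota> u" by (simp add: h(2)[symmetric])
    thus ?thesis using False hz by (simp add: eq_divide_eq)
  qed (simp add: h0)
  note hs = h h0 hdiff hpow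
  define t where "t = y - \<iota> i"
  have yt: "y = t + \<iota> i" by (simp add: t_def)
  have \<pi>: "\<iota> \<pi> \<noteq> 0" using \<open>\<pi> \<noteq> 0\<close> hz by simp
  have cB: "\<iota> B = \<iota> (\<pi> * \<pi> * c) - \<iota> i ^ 3 + \<iota> i * \<iota> A"
    unfolding c[symmetric] by (simp add: hs)
  have three: "t ^ 3 = \<iota> \<pi> * \<iota> a * t - \<iota> \<pi> * \<iota> \<pi> * \<iota> c"
  proof -
    have "t ^ 3 + \<iota> i ^ 3 - \<iota> A * (t + \<iota> i) + \<iota> B = 0"
      using root unfolding yt cube_add_char_3(1)[OF char(2)] .
    thus ?thesis unfolding cB a by (simp add: hs algebra_simps)
  qed
  show ?thesis unfolding t_def[symmetric]
  proof unfold_locales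
    show "t * t = \<iota> \<pi> * (t ^ 2 / \<iota> \<pi>)" using \<pi> by (simp add: power2_eq_square)
    have "t * t ^ 2 = t ^ 3" by (simp add: power2_eq_square power3_eq_cube)
    thus y\<theta>: "t * (t ^ 2 / \<iota> \<pi>) = \<iota> a * t - \<iota> \<pi> * \<iota> c"
      using \<pi> three by (simp add: field_simps)
    have "t ^ 2 / \<iota> \<pi> * (t ^ 2 / \<iota> \<pi>) = t * (t * (t ^ 2 / \<iota> \<pi>)) / \<iota> \<pi>"
      by (simp add: power2_eq_square)
    also have "\<dots> = \<iota> a * (t ^ 2 / \<iota> \<pi>) - \<iota> c * t"
      unfolding y\<theta> using \<pi> by (simp add: field_simps power2_eq_square)
    finally show "t ^ 2 / \<iota> \<pi> * (t ^ 2 / \<iota> \<pi>) = \<iota> a * (t ^ 2 / \<iota> \<pi>) - \<iota> c * t" .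
  next
    fix c0 c1 c2 assume eq: "\<iota> c0 + \<iota> c1 * t + \<iota> c2 * (t ^ 2 / \<iota> \<pi>) = 0"
    have "\<iota> c0 = 0 \<and> \<iota> c1 = 0 \<and> \<iota> (c2 / \<pi>) = 0"
    proof (rule cubic_root_independent[of "range \<iota>" "\<iota> (\<pi> * a)" "\<iota> (\<pi> * \<pi> * c)" t])
      show "0 \<in> range \<iota>" using h0 by (metis rangeI)
      show "u - v \<in> range \<iota>" "u / v \<in> range \<iota>" if "u \<in> range \<iota>" "v \<in> range \<iota>" for u v
        using that hdiff hdiv by (metis (full_types) imageE rangeI)+
      show "t ^ 3 - \<iota> (\<pi> * a) * t + \<iota> (\<pi> * \<pi> * c) = 0" using three by (simp add: h)
      show "r ^ 3 - \<iota> (\<pi> * a) * r + \<iota> (\<pi> * \<pi> * c) \<noteq> 0" if "r \<in> range \<iota>" for r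
      proof -
        obtain s where s: "r = \<iota> s" using \<open>r \<in> range \<iota>\<close> by blast
        have "(s + i) ^ 3 - A * (s + i) + B = s ^ 3 - A * s + (i ^ 3 - i * A + B)"
          unfolding cube_add_char_3(1)[OF char(1)] by (simp add: algebra_simps)
        hence "s ^ 3 - A * s + \<pi> * \<pi> * c \<noteq> 0" using noroot[of "s + i"] unfolding c by metis
        hence "s ^ 3 - \<pi> * a * s + \<pi> * \<pi> * c \<noteq> 0" unfolding a .
        hence "\<iota> (s ^ 3 - \<pi> * a * s + \<pi> * \<pi> * c) \<noteq> 0" unfolding hz .
        thus ?thesis unfolding s by (simp add: hs)
      qed
      show "\<iota> c0 + \<iota> c1 * t + \<iota> (c2 / \<pi>) * t\<^sup>2 = 0" using eq by (simp add: hdiv)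
    qed (use rangeI in auto)
    thus "c0 = 0 \<and> c1 = 0 \<and> c2 = 0" using \<open>\<pi> \<noteq> 0\<close> by (simp add: hz)
  qed (simp_all add: h)
qed

text \<open>A root would be a polynomial \<open>g\<close>, and the factor \<open>T - g\<close> stays a nonunit over the algebraic closure
  of the constants.\<close>

lemma no_root_of_absolutely_irreducible:
  fixes A B :: "'a::field poly"
  assumes "absolutely_irreducible (cubic A B)"
  shows "r ^ 3 - to_fract A * r + to_fract B \<noteq> 0"
proof
  assume root: "r ^ 3 - to_fract A * r + to_fract B = 0"
  then obtain g where g: "r = to_fract g" by (rule rational_root_of_cubic)
  have "to_fract (g ^ 3 - A * g + B) = 0" using root unfolding g by (simp add: to_fract_power to_fract_mult)
  hence eq: "g ^ 3 - A * g + B = 0" by (simp only: to_fract_eq_0_iff)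
  let ?m = "map_poly to_ac :: 'a poly \<Rightarrow> 'a alg_closure poly"
  have madd: "?m (u + v) = ?m u + ?m v" and mmult: "?m (u * v) = ?m u * ?m v" for u v
    by (intro poly_eqI; simp add: coeff_map_poly coeff_mult to_ac_sum)+
  have mneg: "?m (- u) = - ?m u" for u by (intro poly_eqI) (simp add: coeff_map_poly)
  have mpow: "?m (u ^ n) = ?m u ^ n" for u n by (induction n) (simp_all add: mmult)
  have mdiff: "?m (u - v) = ?m u - ?m v" for u v using madd[of u "- v"] by (simp add: mneg)
  have "B = A * g - g ^ 3 + (g ^ 3 - A * g + B)" by simp
  hence B: "B = A * g - g ^ 3" unfolding eq by simp
  have "map_poly ?m (cubic A B) = [:- ?m g, 1:] * [:?m g ^ 2 - ?m A, ?m g, 1:]"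
    unfolding cubic_def B
    by (simp add: map_poly_pCons mmult mneg mdiff mpow power2_eq_square power3_eq_cube algebra_simps)
  hence "[:- ?m g, 1:] dvd (1 :: 'a alg_closure poly poly) \<or> [:?m g ^ 2 - ?m A, ?m g, 1:] dvd (1 :: 'a alg_closure poly poly)"
    using assms unfolding absolutely_irreducible_def by (metis Factorial_Ring.irreducibleD)
  thus False by (auto simp: is_unit_poly_iff)
qed

section \<open>The integral closure is a ring\<close>

lemma even_odd_parts:
  fixes p :: "'r::comm_ring_1 poly"
  obtains e d where "p = pcompose e [:0,0,1:] + [:0,1:] * pcompose d [:0,0,1:]"
proof -
  have "\<exists>e d. p = pcompose e [:0,0,1:] + [:0,1:] * pcompose d [:0,0,1:]"
  proof (induction p)
    case 0
    show ?case by (intro exI[of _ 0]) simp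
  next
    case (pCons s p)
    then obtain e d where "p = pcompose e [:0,0,1:] + [:0,1:] * pcompose d [:0,0,1:]" by blast
    hence "pCons s p = pcompose (pCons s d) [:0,0,1:] + [:0,1:] * pcompose e [:0,0,1:]"
      by (simp add: pcompose_pCons)
    thus ?case by blast
  qed
  thus thesis using that by blast
qed

text \<open>If \<open>p(T) = e(T\<^sup>2) + T d(T\<^sup>2)\<close>, then \<open>p(T) p(-T)\<close> is a polynomial in \<open>T\<^sup>2\<close> with leading coefficient
  \<open>1\<close> or \<open>-1\<close>. This is the equation for \<open>z\<^sup>2\<close>.\<close>

lemma integral_square:
  fixes h :: "'r::idom \<Rightarrow> 'f::field"
  assumes h: "\<And>u v. h (u + v) = h u + h v" "\<And>u v. h (u * v) = h u * h v" "h 0 = 0" "h 1 = 1"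
    and p: "Polynomial.lead_coeff p = 1" "poly (map_poly h p) z = 0"
  shows "\<exists>q. Polynomial.lead_coeff q = 1 \<and> poly (map_poly h q) (z ^ 2) = 0"
proof -
  have hneg: "h (- u) = - h u" for u using h(1)[of u "- u"] h(3) by (simp add: eq_neg_iff_add_eq_0 add.commute)
  have hsum: "h (sum g U) = (\<Sum>x\<in>U. h (g x))" for g :: "nat \<Rightarrow> 'r" and U
    by (induction U rule: infinite_finite_induct) (simp_all add: h)
  have hdiff: "h (u - v) = h u - h v" for u v using h(1)[of u "- v"] hneg by simp
  have madd: "map_poly h (u + v) = map_poly h u + map_poly h v"
    and mmult: "map_poly h (u * v) = map_poly h u * map_poly h v"
    and mdiff: "map_poly h (u - v) = map_poly h u - map_poly h v" for u v
    by (intro poly_eqI; simp add: coeff_map_poly coeff_mult h hsum hdiff)+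
  obtain e d where ed: "p = pcompose e [:0,0,1:] + [:0,1:] * pcompose d [:0,0,1:]"
    by (rule even_odd_parts)
  define q where "q = e * e - [:0,1:] * (d * d)"
  define s where "s = (- 1 :: 'r) ^ Polynomial.degree p"
  have flip: "pcompose (pcompose u [:0,0,1:]) [:0,-1:] = pcompose u [:0,0,1:]" for u :: "'r poly"
    by (simp add: pcompose_assoc[symmetric] pcompose_pCons)
  have "pcompose q [:0,0,1:] = p * pcompose p [:0,-1:]"
    unfolding ed q_def
    by (simp add: pcompose_add pcompose_mult pcompose_diff flip pcompose_pCons algebra_simps)
  hence "Polynomial.lead_coeff (pcompose q [:0,0,1:]) = Polynomial.lead_coeff p * Polynomial.lead_coeff (pcompose p [:0,-1:])"
    by (simp only: Polynomial.lead_coeff_mult)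
  hence lead: "Polynomial.lead_coeff q = s"
    by (subst (asm) (1 2) lead_coeff_comp) (simp_all add: p s_def)
  have ss: "s * s = 1" unfolding s_def by (simp add: power_add[symmetric] flip: mult_2)
  have "s \<noteq> 0" using ss by auto
  hence "Polynomial.lead_coeff (smult s q) = 1" using lead ss by (simp add: lead_coeff_smult)
  moreover have "poly (map_poly h (smult s q)) (z ^ 2) = 0"
  proof -
    have comp: "poly (map_poly h (pcompose u [:0,0,1:])) z = poly (map_poly h u) (z ^ 2)" for u
      by (induction u) (simp_all add: pcompose_pCons madd mmult map_poly_pCons h power2_eq_square)
    have "poly (map_poly h e) (z ^ 2) + z * poly (map_poly h d) (z ^ 2) = 0"
      using p(2) unfolding ed by (simp add: madd mmult comp map_poly_pCons h)
    hence e: "poly (map_poly h e) (z ^ 2) = - (z * poly (map_poly h d) (z ^ 2))"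
      by (simp add: eq_neg_iff_add_eq_0)
    have "poly (map_poly h q) (z ^ 2) = 0"
      unfolding q_def
      by (simp add: mdiff mmult map_poly_pCons h e, simp add: power2_eq_square mult_ac)
    thus ?thesis by (simp add: map_poly_smult h)
  qed
  ultimately show ?thesis by blast
qed

text \<open>A set that has a basis is closed under sums. Products then follow by polarization, because squares
  of integral elements are integral and two is invertible.\<close>

lemma integral_closure_subring:
  fixes h :: "'r::idom \<Rightarrow> 'f::field" and w :: "'f ^ 'n"
  assumes h: "\<And>u v. h (u + v) = h u + h v" "\<And>u v. h (u * v) = h u * h v" "h 0 = 0" "h 1 = 1"
    and F: "\<And>u v. u \<in> F \<Longrightarrow> v \<in> F \<Longrightarrow> u * v \<in> F" "range h \<subseteq> F"
    and w: "is_basis h (integral_closure h F) w" and three: "(3 :: 'f) = 0"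
  shows "h s \<in> integral_closure h F"
    and "u \<in> integral_closure h F \<Longrightarrow> v \<in> integral_closure h F \<Longrightarrow> u + v \<in> integral_closure h F"
    and "u \<in> integral_closure h F \<Longrightarrow> v \<in> integral_closure h F \<Longrightarrow> u * v \<in> integral_closure h F"
proof -
  let ?O = "integral_closure h F"
  have hneg: "h (- u) = - h u" for u using h(1)[of u "- u"] h(3) by (simp add: eq_neg_iff_add_eq_0 add.commute)
  have image: "?O = range (\<lambda>c :: 'r ^ 'n. \<Sum>i\<in>UNIV. h (c $ i) * w $ i)"
    using w unfolding is_basis_def bij_betw_def by simp
  have add: "u + v \<in> ?O" if uv: "u \<in> ?O" "v \<in> ?O" for u v
  proof -
    obtain c d :: "'r ^ 'n" where "u = (\<Sum>i\<in>UNIV. h (c $ i) * w $ i)" "v = (\<Sum>i\<in>UNIV. h (d $ i) * w $ i)"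
      using uv unfolding image by blast
    hence "u + v = (\<Sum>i\<in>UNIV. h ((c + d) $ i) * w $ i)"
      by (simp add: h distrib_right sum.distrib)
    thus ?thesis unfolding image by blast
  qed
  have neg: "- u \<in> ?O" if u: "u \<in> ?O" for u
  proof -
    obtain c :: "'r ^ 'n" where "u = (\<Sum>i\<in>UNIV. h (c $ i) * w $ i)"
      using u unfolding image by blast
    hence "- u = (\<Sum>i\<in>UNIV. h ((- c) $ i) * w $ i)" by (simp add: hneg sum_negf)
    thus ?thesis unfolding image by blast
  qed
  have square: "u * u \<in> ?O" if u: "u \<in> ?O" for u
  proof -
    obtain p where "Polynomial.lead_coeff p = 1" "poly (map_poly h p) u = 0"
      using u unfolding integral_closure_def by blast
    then obtain q where "Polynomial.lead_coeff q = 1 \<and> poly (map_poly h q) (u ^ 2) = 0"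
      using integral_square[OF h] by metis
    moreover have "u * u \<in> F" using u F(1) unfolding integral_closure_def by blast
    ultimately show ?thesis unfolding integral_closure_def power2_eq_square by blast
  qed
  show "h s \<in> ?O"
  proof -
    have "Polynomial.lead_coeff [:- s, 1:] = 1 \<and> poly (map_poly h [:- s, 1:]) (h s) = 0"
      by (simp add: map_poly_pCons h hneg)
    moreover have "h s \<in> F" using F(2) by auto
    ultimately show ?thesis unfolding integral_closure_def by blast
  qed
  show "u + v \<in> ?O" if "u \<in> ?O" "v \<in> ?O" using add[OF that] .
  show "u * v \<in> ?O" if uv: "u \<in> ?O" "v \<in> ?O"
  proof -
    have "u * v = - ((u + v) * (u + v)) + (u * u + v * v) + 3 * (u * v)"
      by (simp add: algebra_simps)
    hence eq: "u * v = - ((u + v) * (u + v)) + (u * u + v * v)" using three by simp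
    show ?thesis by (subst eq) (intro add neg square uv)
  qed
qed


section \<open>Ideals of a subring of a field\<close>

locale type_subring =
  fixes \<O> :: "'f::field set"
  assumes O_1: "1 \<in> \<O>" and O_minus: "u \<in> \<O> \<Longrightarrow> - u \<in> \<O>"
    and O_add: "u \<in> \<O> \<Longrightarrow> v \<in> \<O> \<Longrightarrow> u + v \<in> \<O>"
    and O_mult: "u \<in> \<O> \<Longrightarrow> v \<in> \<O> \<Longrightarrow> u * v \<in> \<O>"
begin

definition OR :: "'f ring" where "OR = ring_of_type_algebra \<lparr>carrier := \<O>\<rparr>"

lemma OR_simps: "carrier OR = \<O>" "monoid.mult OR = (*)" "monoid.one OR = 1" "ring.zero OR = 0"
  "ring.add OR = (+)"
  by (simp_all add: OR_def ring_of_type_algebra_def)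

lemma O_diff: "u \<in> \<O> \<Longrightarrow> v \<in> \<O> \<Longrightarrow> u - v \<in> \<O>"
  using O_add[OF _ O_minus, of u v] by simp

lemma O_0: "0 \<in> \<O>" using O_diff[OF O_1 O_1] by simp

lemma cring_OR: "cring OR"
proof (rule cringI)
  show "abelian_group OR"
    by (rule abelian_groupI) (auto simp: OR_simps O_add O_0 intro: bexI[of _ "- _"] O_minus)
  show "Group.comm_monoid OR"
    by (rule comm_monoidI) (auto simp: OR_simps O_mult O_1)
qed (simp add: OR_simps distrib_right)

lemma ideal_OR_I:
  assumes "I \<subseteq> \<O>" "0 \<in> I" "\<And>u v. u \<in> I \<Longrightarrow> v \<in> I \<Longrightarrow> u + v \<in> I"
    "\<And>u v. u \<in> \<O> \<Longrightarrow> v \<in> I \<Longrightarrow> u * v \<in> I"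
  shows "ideal I OR"
proof -
  interpret cring OR by (rule cring_OR)
  have inv: "a_inv OR u = - u" if "u \<in> \<O>" for u
    by (rule minus_equality) (use that O_minus in \<open>simp_all add: OR_simps\<close>)
  show ?thesis
  proof (rule idealI)
    show "subgroup I (add_monoid OR)"
    proof (rule add.subgroupI)
      show "a_inv OR u \<in> I" if "u \<in> I" for u
      proof -
        have "(- 1) * u \<in> I" using assms(4) O_minus[OF O_1] that by blast
        thus ?thesis using inv[of u] that assms(1) by auto
      qed
    qed (use assms in \<open>auto simp: OR_simps\<close>)
  next
    fix u v assume "u \<in> I" "v \<in> carrier OR"
    hence "v * u \<in> I" using assms(4) by (simp add: OR_simps)
    thus "v \<otimes>\<^bsub>OR\<^esub> u \<in> I" "u \<otimes>\<^bsub>OR\<^esub> v \<in> I" by (simp_all add: OR_simps mult.commute)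
  qed (rule ring_axioms)
qed

lemma ideal_OR_D:
  assumes "ideal I OR"
  shows "I \<subseteq> \<O>" "u \<in> I \<Longrightarrow> v \<in> I \<Longrightarrow> u + v \<in> I" "u \<in> I \<Longrightarrow> v \<in> I \<Longrightarrow> u - v \<in> I"
    "u \<in> \<O> \<Longrightarrow> v \<in> I \<Longrightarrow> u * v \<in> I"
proof -
  show "I \<subseteq> \<O>"
    using additive_subgroup.a_subset[OF ideal.axioms(1)[OF assms]] by (simp add: OR_simps)
  show add: "u \<in> I \<Longrightarrow> v \<in> I \<Longrightarrow> u + v \<in> I" for u v 
    using additive_subgroup.a_closed[OF ideal.axioms(1)[OF assms], of u v] by (simp add: OR_simps)
  show mult: "u \<in> \<O> \<Longrightarrow> v \<in> I \<Longrightarrow> u * v \<in> I" for u v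
    using ideal.I_l_closed[OF assms, of v u] by (simp add: OR_simps)
  show "u - v \<in> I" if "u \<in> I" "v \<in> I"
    using add[OF that(1) mult[OF O_minus[OF O_1] that(2)]] by simp
qed

lemma kernel_primeideal:
  fixes \<Phi> :: "'f \<Rightarrow> 'l::field"
  assumes add: "\<And>u v. u \<in> \<O> \<Longrightarrow> v \<in> \<O> \<Longrightarrow> \<Phi> (u + v) = \<Phi> u + \<Phi> v"
    and mult: "\<And>u v. u \<in> \<O> \<Longrightarrow> v \<in> \<O> \<Longrightarrow> \<Phi> (u * v) = \<Phi> u * \<Phi> v" and one: "\<Phi> 1 = 1"
  shows "primeideal {z \<in> \<O>. \<Phi> z = 0} OR"
proof (rule primeidealI)
  have "\<Phi> 0 + \<Phi> 0 = \<Phi> 0 + 0" using add[OF O_0 O_0] by simp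
  hence zero: "\<Phi> 0 = 0" by (simp only: add_left_cancel)
  show "ideal {z \<in> \<O>. \<Phi> z = 0} OR"
    by (rule ideal_OR_I) (auto simp: O_0 zero add mult O_add O_mult)
  show "carrier OR \<noteq> {z \<in> \<O>. \<Phi> z = 0}"
  proof
    assume "carrier OR = {z \<in> \<O>. \<Phi> z = 0}"
    hence "1 \<in> {z \<in> \<O>. \<Phi> z = 0}" using O_1 by (simp add: OR_simps)
    thus False using one by simp
  qed
qed (auto simp: OR_simps mult cring_OR)

lemma PIdl_OR: "PIdl\<^bsub>OR\<^esub> x = {z * x | z. z \<in> \<O>}"
  by (auto simp: cgenideal_def OR_simps)

lemma ideal_prod_memI: "u \<in> I \<Longrightarrow> v \<in> J \<Longrightarrow> u * v \<in> ideal_prod OR I J"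
  using ideal_prod.prod[of u I v J OR] by (simp add: OR_simps)

lemma ideal_prod_ideal: "ideal I OR \<Longrightarrow> ideal J OR \<Longrightarrow> ideal (ideal_prod OR I J) OR"
  using cring_OR ring.ideal_prod_is_ideal cring.axioms(1) by blast

lemma ideal_prod_subsetI:
  assumes "\<And>u v. u \<in> I \<Longrightarrow> v \<in> J \<Longrightarrow> u * v \<in> K" "\<And>u v. u \<in> K \<Longrightarrow> v \<in> K \<Longrightarrow> u + v \<in> K"
  shows "ideal_prod OR I J \<subseteq> K"
proof
  fix z assume "z \<in> ideal_prod OR I J"
  thus "z \<in> K" by (induction rule: ideal_prod.induct) (use assms in \<open>auto simp: OR_simps\<close>)
qed

lemma ideal_prod3_subsetI:
  assumes "\<And>u v w. u \<in> I \<Longrightarrow> v \<in> J \<Longrightarrow> w \<in> L \<Longrightarrow> u * v * w \<in> K" "\<And>u v. u \<in> K \<Longrightarrow> v \<in> K \<Longrightarrow> u + v \<in> K"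
  shows "ideal_prod OR (ideal_prod OR I J) L \<subseteq> K"
proof (rule ideal_prod_subsetI[OF _ assms(2)])
  fix u w assume "u \<in> ideal_prod OR I J" "w \<in> L"
  thus "u * w \<in> K"
    by (induction rule: ideal_prod.induct) (use assms in \<open>auto simp: OR_simps distrib_right\<close>)
qed

end

section \<open>Orders in the cubic field and their residue points\<close>

text \<open>The order spanned by \<open>1\<close>, \<open>y\<close>, \<open>\<theta>\<close> lies in the ring \<open>\<O>\<close> of integral elements. The map \<open>ev\<close> is
  reduction modulo \<open>P\<close>, followed by an embedding of the residue field into a larger field \<open>'l\<close>, in which
  the reduced cubic may have roots.\<close>

locale integral_order = cubic_algebra h \<pi> a c y \<theta> + type_subring \<O>
  for h :: "'a::field poly \<Rightarrow> 'f::field" and \<pi> a c y \<theta> and \<O> :: "'f set" +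
  fixes P :: "'a poly" and ev :: "'a poly \<Rightarrow> 'l::field"
  assumes irr: "Factorial_Ring.irreducible P"
    and O_const: "h s \<in> \<O>" and y_O: "y \<in> \<O>" and \<theta>_O: "\<theta> \<in> \<O>"
    and integral: "z \<in> \<O> \<Longrightarrow> \<exists>p. Polynomial.lead_coeff p = 1 \<and> poly (map_poly h p) z = 0"
    and frac: "z \<in> \<O> \<Longrightarrow> \<exists>m. m \<noteq> 0 \<and> h m * z \<in> lin_span"
    and ev_add: "ev (u + v) = ev u + ev v" and ev_mult: "ev (u * v) = ev u * ev v" and ev_1: "ev 1 = 1"
    and ev_eq_0_iff: "ev u = 0 \<longleftrightarrow> P dvd u"
begin

lemma ev_0: "ev 0 = 0" by (simp add: ev_eq_0_iff)
lemma ev_P: "ev P = 0" by (simp add: ev_eq_0_iff)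
lemma ev_minus: "ev (- u) = - ev u"
  using ev_add[of u "- u"] ev_0 by (simp add: eq_neg_iff_add_eq_0 add.commute)
lemma ev_diff: "ev (u - v) = ev u - ev v" using ev_add[of u "- v"] ev_minus by simp
lemma ev_power: "ev (u ^ n) = ev u ^ n" by (induction n) (simp_all add: ev_1 ev_mult)
lemmas ev_simps = ev_0 ev_1 ev_add ev_mult ev_minus ev_diff ev_power

lemma P_nonzero: "P \<noteq> 0" using irr by auto

lemma lin_O: "lin c0 c1 c2 \<in> \<O>"
  unfolding lin_def by (intro O_add O_mult O_const y_O \<theta>_O)

text \<open>A residue point consists of the values of \<open>y\<close> and \<open>\<theta>\<close> under a homomorphism from the order to \<open>'l\<close>
  that extends \<open>ev\<close>; \<open>res\<close> is that homomorphism in coordinates.\<close>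

definition residue_point :: "'l \<Rightarrow> 'l \<Rightarrow> bool" where
  "residue_point \<eta> \<tau> \<longleftrightarrow> \<eta> * \<eta> = ev \<pi> * \<tau> \<and> \<eta> * \<tau> = ev a * \<eta> - ev \<pi> * ev c \<and> \<tau> * \<tau> = ev a * \<tau> - ev c * \<eta>"

definition res :: "'l \<Rightarrow> 'l \<Rightarrow> 'a poly \<Rightarrow> 'a poly \<Rightarrow> 'a poly \<Rightarrow> 'l" where
  "res \<eta> \<tau> c0 c1 c2 = ev c0 + ev c1 * \<eta> + ev c2 * \<tau>"

lemma res_mult:
  assumes "residue_point \<eta> \<tau>"
  shows "res \<eta> \<tau> (a0 * b0 - (a1 * b2 + a2 * b1) * (\<pi> * c))
        (a0 * b1 + a1 * b0 + a * (a1 * b2 + a2 * b1) - c * (a2 * b2))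
        (a0 * b2 + a2 * b0 + \<pi> * (a1 * b1) + a * (a2 * b2)) = res \<eta> \<tau> a0 a1 a2 * res \<eta> \<tau> b0 b1 b2"
proof -
  have rp: "\<eta> * \<eta> = ev \<pi> * \<tau>" "\<eta> * \<tau> = ev a * \<eta> - ev \<pi> * ev c" "\<tau> * \<tau> = ev a * \<tau> - ev c * \<eta>"
    using assms unfolding residue_point_def by auto
  have "res \<eta> \<tau> a0 a1 a2 * res \<eta> \<tau> b0 b1 b2 =
     ev a0 * ev b0 + (ev a0 * ev b1 + ev a1 * ev b0) * \<eta> + (ev a0 * ev b2 + ev a2 * ev b0) * \<tau>
     + (ev a1 * ev b1) * (\<eta> * \<eta>) + (ev a1 * ev b2 + ev a2 * ev b1) * (\<eta> * \<tau>) + (ev a2 * ev b2) * (\<tau> * \<tau>)"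
    unfolding res_def by (simp add: algebra_simps)
  also have "\<dots> = res \<eta> \<tau> (a0 * b0 - (a1 * b2 + a2 * b1) * (\<pi> * c))
        (a0 * b1 + a1 * b0 + a * (a1 * b2 + a2 * b1) - c * (a2 * b2))
        (a0 * b2 + a2 * b0 + \<pi> * (a1 * b1) + a * (a2 * b2))"
    unfolding rp res_def by (simp add: ev_simps algebra_simps)
  finally show ?thesis ..
qed

text \<open>If \<open>u / P\<close> is integral, then some power of \<open>u\<close> is divisible by \<open>P\<close> within the order, so
  \<open>u\<close> vanishes at every residue point.\<close>

lemma integral_quotient:
  assumes rp: "residue_point \<eta> \<tau>" and z: "z \<in> \<O>" and eq: "h P * z = lin c0 c1 c2"
  shows "res \<eta> \<tau> c0 c1 c2 = 0"
proof -
  define u where "u = h P * z"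
  have pow: "\<exists>d0 d1 d2. u ^ k = lin d0 d1 d2 \<and> res \<eta> \<tau> d0 d1 d2 = res \<eta> \<tau> c0 c1 c2 ^ k" for k
  proof (induction k)
    case 0
    show ?case by (rule exI[of _ 1], rule exI[of _ 0], rule exI[of _ 0]) (simp add: lin_1 res_def ev_simps)
  next
    case (Suc k)
    then obtain d0 d1 d2 where "u ^ k = lin d0 d1 d2" "res \<eta> \<tau> d0 d1 d2 = res \<eta> \<tau> c0 c1 c2 ^ k" by blast
    thus ?case unfolding power_Suc u_def eq using lin_mult[of c0 c1 c2 d0 d1 d2] res_mult[OF rp, of c0 d0 c1 d2 c2 d1]
      by metis
  qed
  obtain p where p: "Polynomial.lead_coeff p = 1" "poly (map_poly h p) z = 0"
    using integral[OF z] by blast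
  define n where "n = Polynomial.degree p"
  have n: "n > 0"
  proof (rule ccontr)
    assume "\<not> n > 0"
    then obtain s where "p = [:s:]" unfolding n_def using degree_eq_zeroE by blast
    thus False using p by (simp add: map_poly_pCons j_simps)
  qed
  have cn: "coeff p n = 1" using p(1) unfolding n_def .
  have "Polynomial.degree (map_poly h p) = n"
    unfolding n_def by (rule degree_map_poly) (simp add: j_eq_0_iff)
  hence "(\<Sum>i\<le>n. h (coeff p i) * z ^ i) = 0"
    using p(2) by (simp add: poly_altdef coeff_map_poly j_0)
  hence sum: "(\<Sum>i<n. h (coeff p i) * z ^ i) + z ^ n = 0"
    by (simp add: lessThan_Suc_atMost[symmetric] cn j_1)
  define v where "v = (\<Sum>i<n. h (coeff p i * P ^ (n - 1 - i)) * u ^ i)"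
  have "h P * v = (\<Sum>i<n. h P ^ n * (h (coeff p i) * z ^ i))"
    unfolding v_def sum_distrib_left
  proof (rule sum.cong[OF refl])
    fix i assume "i \<in> {..<n}"
    hence "n = Suc (n - 1 - i + i)" by auto
    hence "h P ^ n = h P * h P ^ (n - 1 - i) * h P ^ i" by (metis power_Suc power_add mult.assoc)
    thus "h P * (h (coeff p i * P ^ (n - 1 - i)) * u ^ i) = h P ^ n * (h (coeff p i) * z ^ i)"
      by (simp add: u_def j_simps power_mult_distrib mult_ac)
  qed
  hence "h P * v + u ^ n = h P ^ n * ((\<Sum>i<n. h (coeff p i) * z ^ i) + z ^ n)"
    by (simp add: sum_distrib_left distrib_left u_def power_mult_distrib)
  hence "u ^ n = h P * (- v)" using sum by (simp add: eq_neg_iff_add_eq_0 add.commute)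
  moreover have "- v \<in> lin_span"
  proof -
    have "u ^ i \<in> lin_span" for i using pow[of i] lin_in_lin_span by metis
    thus ?thesis unfolding v_def by (intro lin_span_minus lin_span_sum lin_span_scale)
  qed
  then obtain e0 e1 e2 where "- v = lin e0 e1 e2" by (rule lin_spanE)
  ultimately have un: "u ^ n = lin (P * e0) (P * e1) (P * e2)" by (simp add: lin_scale)
  obtain d0 d1 d2 where d: "u ^ n = lin d0 d1 d2" "res \<eta> \<tau> d0 d1 d2 = res \<eta> \<tau> c0 c1 c2 ^ n"
    using pow[of n] by blast
  have "d0 = P * e0 \<and> d1 = P * e1 \<and> d2 = P * e2" using d(1) un by (simp add: lin_eq_iff)
  hence "res \<eta> \<tau> d0 d1 d2 = 0" by (simp add: res_def ev_mult ev_P)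
  thus ?thesis using d(2) n by simp
qed

end

text \<open>For an integral element \<open>u / P\<close> with \<open>u\<close> in the order, divisibility of the coordinates of \<open>u\<close> by
  \<open>P\<close> means that the element lies in the order itself. So \<open>P\<close> does not divide the index of the order.\<close>

locale P_maximal_order = integral_order h \<pi> a c y \<theta> \<O> P ev
  for h :: "'a::field poly \<Rightarrow> 'f::field" and \<pi> a c y \<theta> \<O> P and ev :: "'a poly \<Rightarrow> 'l::field" +
  assumes maximal: "z \<in> \<O> \<Longrightarrow> h P * z = lin c0 c1 c2 \<Longrightarrow> P dvd c0 \<and> P dvd c1 \<and> P dvd c2"
begin

text \<open>Some \<open>P\<^sup>n s z\<close> with \<open>P\<close> not dividing \<open>s\<close> lies in the order. Maximality removes the powers of \<open>P\<close> one
  by one, and \<open>s\<close> is invertible modulo \<open>P\<close>.\<close>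

lemma approximation:
  assumes "z \<in> \<O>"
  obtains c0 c1 c2 r where "r \<in> \<O>" "z = lin c0 c1 c2 + h P * r"
proof -
  obtain m where m: "m \<noteq> 0" "h m * z \<in> lin_span" using frac[OF assms] by blast
  obtain n s where s: "m = P ^ n * s" "\<not> P dvd s" using split_off_power[OF irr m(1)] .
  have "h (P ^ n * s) * z \<in> lin_span \<Longrightarrow> h s * z \<in> lin_span" for n
  proof (induction n)
    case (Suc n)
    then obtain c0 c1 c2 where c: "h (P ^ Suc n * s) * z = lin c0 c1 c2" by (auto elim: lin_spanE)
    have "h (P ^ n * s) * z \<in> \<O>" by (intro O_mult O_const assms)
    moreover have "h P * (h (P ^ n * s) * z) = lin c0 c1 c2"
      unfolding c[symmetric] by (simp add: j_simps mult_ac)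
    ultimately have "P dvd c0 \<and> P dvd c1 \<and> P dvd c2" by (rule maximal)
    then obtain d0 d1 d2 where d: "c0 = P * d0" "c1 = P * d1" "c2 = P * d2" by (auto elim!: dvdE)
    have "h P * (h (P ^ n * s) * z) = h P * lin d0 d1 d2"
      unfolding \<open>h P * (h (P ^ n * s) * z) = lin c0 c1 c2\<close> d lin_scale ..
    hence "h (P ^ n * s) * z = lin d0 d1 d2" using P_nonzero by (simp add: j_eq_0_iff)
    thus ?case using Suc.IH lin_in_lin_span by metis
  qed simp
  hence sz: "h s * z \<in> lin_span" using m(2) s(1) by blast
  obtain u v where uv: "u * s + v * P = 1" using irreducible_bezout[OF irr s(2)] .
  have "h u * (h s * z) \<in> lin_span" by (rule lin_span_scale[OF sz])
  then obtain c0 c1 c2 where c: "h u * (h s * z) = lin c0 c1 c2" by (rule lin_spanE)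
  have "z = h (u * s + v * P) * z" unfolding uv by (simp add: j_1)
  also have "\<dots> = lin c0 c1 c2 + h P * (h v * z)" unfolding c[symmetric] by (simp add: j_simps algebra_simps)
  finally show thesis using that O_mult[OF O_const assms] by blast
qed

lemma approximation_unique:
  assumes "r \<in> \<O>" "r' \<in> \<O>" "lin c0 c1 c2 + h P * r = lin d0 d1 d2 + h P * r'"
  shows "ev c0 = ev d0 \<and> ev c1 = ev d1 \<and> ev c2 = ev d2"
proof -
  have "h P * (r' - r) = lin (c0 - d0) (c1 - d1) (c2 - d2)"
    unfolding lin_diff[symmetric] using assms(3) by (simp add: algebra_simps)
  from maximal[OF O_diff[OF assms(2,1)] this] show ?thesis
    by (simp add: ev_eq_0_iff[symmetric] ev_diff)
qed

text \<open>Modulo \<open>P\<close> every integral element comes from the order, so the homomorphism given by a residue point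
  extends to all of \<open>\<O>\<close>. Its kernel is prime because its values lie in a field.\<close>

lemma character_exists:
  assumes rp: "residue_point \<eta> \<tau>"
  obtains \<Phi> :: "'f \<Rightarrow> 'l" where
    "\<And>c0 c1 c2 r. r \<in> \<O> \<Longrightarrow> \<Phi> (lin c0 c1 c2 + h P * r) = res \<eta> \<tau> c0 c1 c2"
    "primeideal {z \<in> \<O>. \<Phi> z = 0} OR"
proof -
  define \<Phi> where "\<Phi> z = (THE l. \<exists>c0 c1 c2 r. r \<in> \<O> \<and> z = lin c0 c1 c2 + h P * r \<and> l = res \<eta> \<tau> c0 c1 c2)" for z
  have \<Phi>: "\<Phi> (lin c0 c1 c2 + h P * r) = res \<eta> \<tau> c0 c1 c2" if r: "r \<in> \<O>" for c0 c1 c2 r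
    unfolding \<Phi>_def
  proof (rule the_equality)
    fix l assume "\<exists>d0 d1 d2 r'. r' \<in> \<O> \<and> lin c0 c1 c2 + h P * r = lin d0 d1 d2 + h P * r' \<and> l = res \<eta> \<tau> d0 d1 d2"
    then obtain d0 d1 d2 r' where "r' \<in> \<O>" "lin c0 c1 c2 + h P * r = lin d0 d1 d2 + h P * r'" "l = res \<eta> \<tau> d0 d1 d2"
      by blast
    thus "l = res \<eta> \<tau> c0 c1 c2" using approximation_unique[OF r] by (simp add: res_def)
  qed (use r in blast)
  have "primeideal {z \<in> \<O>. \<Phi> z = 0} OR"
  proof (rule kernel_primeideal)
    fix u v assume uv: "u \<in> \<O>" "v \<in> \<O>"
    obtain a0 a1 a2 r where r: "r \<in> \<O>" and u: "u = lin a0 a1 a2 + h P * r" using approximation[OF uv(1)] .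
    obtain b0 b1 b2 s where s: "s \<in> \<O>" and v: "v = lin b0 b1 b2 + h P * s" using approximation[OF uv(2)] .
    have "u + v = lin (a0 + b0) (a1 + b1) (a2 + b2) + h P * (r + s)"
      unfolding u v lin_add[symmetric] by (simp add: algebra_simps)
    thus "\<Phi> (u + v) = \<Phi> u + \<Phi> v"
      unfolding u v by (simp add: \<Phi> r s O_add) (simp add: res_def ev_add algebra_simps)
    have "u * v = lin a0 a1 a2 * lin b0 b1 b2 + h P * (lin a0 a1 a2 * s + r * v)"
      unfolding u v by (simp add: algebra_simps)
    moreover have "lin a0 a1 a2 * s + r * v \<in> \<O>" by (intro O_add O_mult lin_O r s uv)
    ultimately show "\<Phi> (u * v) = \<Phi> u * \<Phi> v"
      unfolding u v lin_mult by (simp add: \<Phi> r s res_mult[OF rp])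
  next
    have "1 = lin 1 0 0 + h P * 0" by (simp add: lin_1)
    hence "\<Phi> 1 = res \<eta> \<tau> 1 0 0" using \<Phi>[OF O_0] by metis
    thus "\<Phi> 1 = 1" by (simp add: res_def ev_simps)
  qed
  thus thesis using that \<Phi> by blast
qed

text \<open>Modulo \<open>P\<close> the basis of an order that is maximal at \<open>P\<close> generates all integral elements, so the
  matrix that expresses it in terms of \<open>w\<close> is invertible modulo \<open>P\<close>.\<close>

lemma index_prime_to_P:
  fixes w :: "'f ^ 3"
  assumes w: "is_basis h \<O> w"
  obtains D :: "'a poly ^ 3 ^ 3" where "\<not> P dvd det D"
    "\<And>i. (vector [1, y, \<theta>] :: 'f ^ 3) $ i = (\<Sum>l\<in>UNIV. h (D $ i $ l) * w $ l)"
proof -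
  let ?b = "vector [1, y, \<theta>] :: 'f ^ 3"
  define comb where "comb v = (\<Sum>l\<in>UNIV. h (v $ l) * w $ l)" for v :: "'a poly ^ 3"
  have inj: "inj comb" and ran: "range comb = \<O>"
    using w unfolding is_basis_def bij_betw_def comb_def by auto
  have comb3: "comb v = h (v $ 1) * w $ 1 + h (v $ 2) * w $ 2 + h (v $ 3) * w $ 3" for v
    by (simp add: comb_def sum_3)
  have bO: "?b $ i \<in> \<O>" for i using exhaust_3[of i] O_1 y_O \<theta>_O by auto
  have wO: "w $ i \<in> \<O>" for i
  proof -
    have "comb (axis i 1) = w $ i"
      using exhaust_3[of i] by (auto simp: comb3 axis_def j_simps)
    thus ?thesis using ran by (metis rangeI)
  qed
  have "\<exists>v. ?b $ i = comb v" for i using bO[of i] ran by blast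
  then obtain D' :: "3 \<Rightarrow> 'a poly ^ 3" where D': "\<And>i. ?b $ i = comb (D' i)" by metis
  define D :: "'a poly ^ 3 ^ 3" where "D = (\<chi> i. D' i)"
  have D: "?b $ i = comb (D $ i)" for i unfolding D_def by (simp add: D')
  have "\<exists>(C :: 'a poly ^ 3) (m :: 'a poly ^ 3). w $ i = lin (C $ 1) (C $ 2) (C $ 3) + h P * comb m" for i
  proof -
    obtain c0 c1 c2 r where "r \<in> \<O>" "w $ i = lin c0 c1 c2 + h P * r" using approximation[OF wO] .
    moreover then obtain m where "r = comb m" using ran by blast
    ultimately show ?thesis by (intro exI[of _ "vector [c0, c1, c2]"] exI[of _ m]) simp
  qed
  then obtain C' M' :: "3 \<Rightarrow> 'a poly ^ 3" where CM': "\<And>i. w $ i = lin (C' i $ 1) (C' i $ 2) (C' i $ 3) + h P * comb (M' i)"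
    by metis
  define C M :: "'a poly ^ 3 ^ 3" where "C = (\<chi> i. C' i)" and "M = (\<chi> i. M' i)"
  have lin_comb: "lin x0 x1 x2 = h x0 * comb (D $ 1) + h x1 * comb (D $ 2) + h x2 * comb (D $ 3)" for x0 x1 x2
    unfolding D[symmetric] by (simp add: lin_def)
  have "comb (axis i 1) = comb ((C ** D) $ i + P *s (M $ i))" for i
  proof -
    have "comb (axis i 1) = w $ i"
      using exhaust_3[of i] by (auto simp: comb3 axis_def j_simps)
    also have "\<dots> = comb ((C ** D) $ i + P *s (M $ i))"
      unfolding CM' lin_comb
      by (simp add: comb3 C_def M_def matrix_matrix_mult_def sum_3 j_simps algebra_simps)
    finally show ?thesis .
  qed
  hence eq: "axis i 1 = (C ** D) $ i + P *s (M $ i)" for i using injD[OF inj] by blast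
  \<comment> \<open>Comparing coordinates with respect to \<open>w\<close> gives \<open>C D = 1 - P M\<close>, which is invertible modulo \<open>P\<close>.\<close>
  have CD: "ev ((C ** D) $ i $ l) = (if i = l then 1 else 0)" for i l
  proof -
    have "(axis i 1 :: 'a poly ^ 3) $ l = (C ** D) $ i $ l + P * M $ i $ l" using eq[of i] by simp
    hence "(C ** D) $ i $ l = (axis i 1 :: 'a poly ^ 3) $ l - P * M $ i $ l" by simp
    thus ?thesis by (simp add: ev_simps ev_P axis_def)
  qed
  have "ev (det C) * ev (det D) = ev (det (C ** D))" by (simp add: det_mul ev_mult)
  also have "\<dots> = 1" unfolding det_3 ev_diff ev_add ev_mult CD by simp
  finally have "\<not> P dvd det D" unfolding ev_eq_0_iff[symmetric] by auto
  thus thesis using that D unfolding comb_def by blast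
qed

lemma multiple_of_P_iff:
  assumes "r \<in> \<O>"
  shows "lin c0 c1 c2 + h P * r \<in> PIdl\<^bsub>OR\<^esub> (h P) \<longleftrightarrow> ev c0 = 0 \<and> ev c1 = 0 \<and> ev c2 = 0"
proof
  assume "lin c0 c1 c2 + h P * r \<in> PIdl\<^bsub>OR\<^esub> (h P)"
  then obtain z where "z \<in> \<O>" "lin c0 c1 c2 + h P * r = lin 0 0 0 + h P * z"
    unfolding PIdl_OR by (auto simp: lin_const j_0 mult.commute)
  thus "ev c0 = 0 \<and> ev c1 = 0 \<and> ev c2 = 0" using approximation_unique[OF assms] ev_0 by metis
next
  assume "ev c0 = 0 \<and> ev c1 = 0 \<and> ev c2 = 0"
  then obtain d0 d1 d2 where "c0 = P * d0" "c1 = P * d1" "c2 = P * d2"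
    unfolding ev_eq_0_iff by (auto elim!: dvdE)
  hence "lin c0 c1 c2 + h P * r = (lin d0 d1 d2 + r) * h P"
    by (simp add: lin_scale[symmetric] algebra_simps)
  thus "lin c0 c1 c2 + h P * r \<in> PIdl\<^bsub>OR\<^esub> (h P)" unfolding PIdl_OR using O_add[OF lin_O assms] by blast
qed

lemma ideal_PIdl: "ideal (PIdl\<^bsub>OR\<^esub> (h P)) OR"
  by (rule cring.cgenideal_ideal[OF cring_OR]) (simp add: OR_simps O_const)

lemma PIdl_subset:
  assumes "ideal I OR" "h P \<in> I"
  shows "PIdl\<^bsub>OR\<^esub> (h P) \<subseteq> I"
  unfolding PIdl_OR using ideal_OR_D(4)[OF assms(1) _ assms(2)] by blast

end


section \<open>Orders that are maximal at P\<close>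

context integral_order
begin

lemma residue_point_origin:
  assumes "P dvd \<pi> * c"
  shows "residue_point 0 0"
  using assms unfolding residue_point_def ev_eq_0_iff[symmetric] by (simp add: ev_mult)

lemma integral_quotient_diff:
  assumes "z \<in> \<O>" "h P * z = lin (P * d0 + c0) (P * d1 + c1) (P * d2 + c2)"
  shows "z - lin d0 d1 d2 \<in> \<O>" "h P * (z - lin d0 d1 d2) = lin c0 c1 c2"
  using O_diff[OF assms(1) lin_O] assms(2)
  by (simp_all add: right_diff_distrib lin_scale lin_diff)

text \<open>Exactly one of \<open>\<pi>\<close> and \<open>c\<close> is divisible by \<open>P\<close>. Suppose that it is \<open>\<pi>\<close>. If \<open>x = e y / P\<close> is
  integral, then \<open>P x\<^sup>3\<close> lies in the order, and its value at the origin is \<open>e\<^sup>3\<close> times a unit; by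
  \<open>integral_quotient\<close> this value is zero, so \<open>P\<close> divides \<open>e\<close>. Multiplication by \<open>\<theta>\<close> brings other
  elements into this form. If \<open>P\<close> divides \<open>c\<close>, then \<open>y\<close> and \<open>\<theta>\<close> exchange their roles.\<close>

lemma maximal_if_totally_ramified:
  assumes a: "P dvd a" and \<pi>c: "P dvd \<pi> * c" "\<not> P ^ 2 dvd \<pi> * c"
  shows "P_maximal_order h \<pi> a c y \<theta> \<O> P ev"
proof (unfold_locales)
  fix z c0 c1 c2 assume z: "z \<in> \<O>" and eq: "h P * z = lin c0 c1 c2"
  note origin = residue_point_origin[OF \<pi>c(1)]
  obtain a' where a': "a = P * a'" using a by (rule dvdE)
  obtain m where m: "\<pi> * c = P * m" using \<pi>c(1) by (rule dvdE)
  have "\<not> P dvd m" using \<pi>c(2) unfolding m power2_eq_square using P_nonzero by simp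
  hence evm: "ev m \<noteq> 0" by (simp add: ev_eq_0_iff)
  have "ev c0 = 0" using integral_quotient[OF origin z eq] by (simp add: res_def)
  then obtain d0 where d0: "c0 = P * d0" unfolding ev_eq_0_iff by (rule dvdE)
  define z1 where "z1 = z - lin d0 0 0"
  have z1: "z1 \<in> \<O>" "h P * z1 = lin 0 c1 c2"
    unfolding z1_def using integral_quotient_diff[OF z, of d0 0 0 c1 0 c2] eq d0 by simp_all
  consider "P dvd \<pi>" "\<not> P dvd c" | "P dvd c" "\<not> P dvd \<pi>"
    using \<pi>c irreducible_dvd_mult_iff[OF irr] mult_dvd_mono[of P \<pi> P c] by (auto simp: power2_eq_square)
  thus "P dvd c0 \<and> P dvd c1 \<and> P dvd c2"
  proof cases
    case 1
    obtain \<pi>' where \<pi>': "\<pi> = P * \<pi>'" using 1(1) by (rule dvdE)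
    have m': "m = \<pi>' * c" using m P_nonzero unfolding \<pi>' by simp
    have key: "P dvd e" if "x \<in> \<O>" "h P * x = lin 0 e 0" for x e
    proof -
      have "h P * (h P * (h P * x ^ 3)) = (h P * x) * ((h P * x) * (h P * x))"
        by (simp add: power3_eq_cube mult_ac)
      also have "\<dots> = h P * (h P * lin (- (e ^ 3 * \<pi>' * m)) (e ^ 3 * \<pi>' * a') 0)"
        unfolding that(2) lin_mult lin_scale lin_eq_iff by (simp add: \<pi>' a' m' power3_eq_cube algebra_simps)
      finally have "h P * x ^ 3 = lin (- (e ^ 3 * \<pi>' * m)) (e ^ 3 * \<pi>' * a') 0"
        using P_nonzero by (simp add: j_eq_0_iff)
      moreover have "x ^ 3 \<in> \<O>" unfolding power3_eq_cube by (intro O_mult that(1))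
      ultimately have "res 0 0 (- (e ^ 3 * \<pi>' * m)) (e ^ 3 * \<pi>' * a') 0 = 0"
        using integral_quotient[OF origin] by blast
      hence "ev e ^ 3 * ev \<pi>' * ev m = 0" by (simp add: res_def ev_simps)
      moreover have "ev \<pi>' \<noteq> 0" using evm unfolding m' ev_mult by auto
      ultimately show ?thesis using evm by (simp add: ev_eq_0_iff)
    qed
    have "h P * (z1 * \<theta>) = lin 0 c1 c2 * lin 0 0 1" unfolding z1(2)[symmetric] by (simp add: lin_\<theta> mult_ac)
    also have "\<dots> = lin (P * (- (c1 * m)) + 0) (P * (a' * c1) + (- (c * c2))) (P * (a' * c2) + 0)"
      unfolding lin_mult lin_eq_iff using m a' by (simp add: mult_ac)
    finally have "P dvd - (c * c2)"
      using key integral_quotient_diff[OF O_mult[OF z1(1) \<theta>_O]] by blast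
    hence "P dvd c2" using 1(2) irreducible_dvd_mult_iff[OF irr] by simp
    then obtain d2 where d2: "c2 = P * d2" by (rule dvdE)
    have "P dvd c1" using key integral_quotient_diff[OF z1(1), of 0 0 0 c1 d2 0] z1(2) d2 by simp
    thus ?thesis using d0 d2 by simp
  next
    case 2
    obtain c' where c': "c = P * c'" using 2(1) by (rule dvdE)
    have m': "m = \<pi> * c'" using m P_nonzero unfolding c' by (simp add: mult.left_commute)
    have key: "P dvd e" if "x \<in> \<O>" "h P * x = lin 0 0 e" for x e
    proof -
      have "h P * (h P * (h P * x ^ 3)) = (h P * x) * ((h P * x) * (h P * x))"
        by (simp add: power3_eq_cube mult_ac)
      also have "\<dots> = h P * (h P * lin (e ^ 3 * c' * m) (- 2 * e ^ 3 * a' * c') (e ^ 3 * a' * a'))"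
        unfolding that(2) lin_mult lin_scale lin_eq_iff by (simp add: c' a' m' power3_eq_cube algebra_simps)
      finally have "h P * x ^ 3 = lin (e ^ 3 * c' * m) (- 2 * e ^ 3 * a' * c') (e ^ 3 * a' * a')"
        using P_nonzero by (simp add: j_eq_0_iff)
      moreover have "x ^ 3 \<in> \<O>" unfolding power3_eq_cube by (intro O_mult that(1))
      ultimately have "res 0 0 (e ^ 3 * c' * m) (- 2 * e ^ 3 * a' * c') (e ^ 3 * a' * a') = 0"
        using integral_quotient[OF origin] by blast
      hence "ev e ^ 3 * ev c' * ev m = 0" by (simp add: res_def ev_simps)
      moreover have "ev c' \<noteq> 0" using evm unfolding m' ev_mult by auto
      ultimately show ?thesis using evm by (simp add: ev_eq_0_iff)
    qed
    have "h P * (z1 * y) = lin 0 c1 c2 * lin 0 1 0" unfolding z1(2)[symmetric] by (simp add: lin_y mult_ac)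
    also have "\<dots> = lin (P * (- (c2 * m)) + 0) (P * (a' * c2) + 0) (P * 0 + \<pi> * c1)"
      unfolding lin_mult lin_eq_iff using m a' by (simp add: mult_ac)
    finally have "P dvd \<pi> * c1"
      using key integral_quotient_diff[OF O_mult[OF z1(1) y_O]] by blast
    hence "P dvd c1" using 2(2) irreducible_dvd_mult_iff[OF irr] by simp
    then obtain d1 where d1: "c1 = P * d1" by (rule dvdE)
    have "P dvd c2" using key integral_quotient_diff[OF z1(1), of 0 0 d1 0 0 c2] z1(2) d1 by simp
    thus ?thesis using d0 d1 by simp
  qed
qed

text \<open>The two residue points deal with the coefficients of \<open>1\<close> and \<open>\<theta>\<close>. The square of \<open>e y / P\<close> is
  \<open>e\<^sup>2 \<theta> / P\<close>, and \<open>\<theta>\<close> does not vanish at the second point.\<close>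

lemma maximal_if_partially_ramified:
  assumes \<pi>: "\<pi> = P" and a: "\<not> P dvd a"
  shows "P_maximal_order h \<pi> a c y \<theta> \<O> P ev"
proof (unfold_locales)
  fix z c0 c1 c2 assume z: "z \<in> \<O>" and eq: "h P * z = lin c0 c1 c2"
  have rp: "residue_point 0 0" "residue_point 0 (ev a)"
    unfolding residue_point_def by (simp_all add: \<pi> ev_P)
  have eva: "ev a \<noteq> 0" using a by (simp add: ev_eq_0_iff)
  have "ev c0 = 0" "ev c0 + ev c2 * ev a = 0"
    using integral_quotient[OF rp(1) z eq] integral_quotient[OF rp(2) z eq] by (simp_all add: res_def)
  hence "ev c0 = 0" "ev c2 = 0" using eva by simp_all
  hence dvd: "P dvd c0" "P dvd c2" by (simp_all add: ev_eq_0_iff)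
  then obtain d0 d2 where d: "c0 = P * d0" "c2 = P * d2" by (auto elim!: dvdE)
  define z1 where "z1 = z - lin d0 0 d2"
  have z1: "z1 \<in> \<O>" "h P * z1 = lin 0 c1 0"
    unfolding z1_def using integral_quotient_diff[OF z, of d0 0 0 c1 d2 0] eq d by simp_all
  have "h P * (h P * z1 ^ 2) = (h P * z1) * (h P * z1)" by (simp add: power2_eq_square mult_ac)
  also have "\<dots> = h P * lin 0 0 (c1 ^ 2)"
    unfolding z1(2) lin_mult lin_scale lin_eq_iff by (simp add: \<pi> power2_eq_square)
  finally have "h P * z1 ^ 2 = lin 0 0 (c1 ^ 2)" using P_nonzero by (simp add: j_eq_0_iff)
  moreover have "z1 ^ 2 \<in> \<O>" unfolding power2_eq_square by (intro O_mult z1(1))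
  ultimately have "res 0 (ev a) 0 0 (c1 ^ 2) = 0" using integral_quotient[OF rp(2)] by blast
  hence "P dvd c1" using eva by (simp add: res_def ev_simps ev_eq_0_iff)
  thus "P dvd c0 \<and> P dvd c1 \<and> P dvd c2" using dvd by simp
qed

text \<open>The residue points are the roots of \<open>T\<^sup>3 - a T + c\<close>. Cubing is additive, so the sum of a root and a
  solution \<open>s\<close> of \<open>s\<^sup>3 = a s\<close> is again a root.\<close>

lemma residue_points_unramified:
  assumes \<pi>: "\<pi> = 1" and t: "t ^ 3 - ev a * t + ev c = 0" and s: "s * s = ev a" and three: "(3 :: 'l) = 0"
    and x: "x = t \<or> x = t + s \<or> x = t - s"
  shows "residue_point x (x * x)"
proof -
  have s3: "s ^ 3 = ev a * s" using s by (simp add: power3_eq_cube)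
  have "x ^ 3 - ev a * x + ev c = 0"
    using x t by (auto simp: cube_add_char_3[OF three] s3 algebra_simps)
  hence "x * (x * x) - ev a * x + ev c = 0" by (simp add: power3_eq_cube mult.assoc)
  hence x3: "x * (x * x) = ev a * x - ev c" by (simp add: algebra_simps eq_diff_eq)
  have "x * x * (x * x) = x * (x * (x * x))" by (simp add: mult_ac)
  also have "\<dots> = ev a * (x * x) - ev c * x" unfolding x3 by (simp add: algebra_simps)
  finally show ?thesis unfolding residue_point_def using x3 by (simp add: \<pi> ev_1)
qed

lemma quadratic_three_zeros:
  fixes k0 k1 k2 t s :: "'l"
  assumes "s \<noteq> 0" "(3 :: 'l) = 0"
    and "k0 + k1 * t + k2 * (t * t) = 0" "k0 + k1 * (t + s) + k2 * ((t + s) * (t + s)) = 0"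
      "k0 + k1 * (t - s) + k2 * ((t - s) * (t - s)) = 0"
  shows "k0 = 0 \<and> k1 = 0 \<and> k2 = 0"
proof -
  have "s * s * k2 = 2 * (k0 + k1 * t + k2 * (t * t)) - (k0 + k1 * (t + s) + k2 * ((t + s) * (t + s)))
     - (k0 + k1 * (t - s) + k2 * ((t - s) * (t - s))) + 3 * (s * s * k2)"
    by (simp add: algebra_simps)
  hence "s * s * k2 = 0" unfolding assms by simp
  hence k2: "k2 = 0" using assms(1) by simp
  have "k1 * s = (k0 + k1 * (t + s) + k2 * ((t + s) * (t + s))) - (k0 + k1 * t + k2 * (t * t))"
    unfolding k2 by (simp add: algebra_simps)
  hence "k1 = 0" unfolding assms(3,4) using assms(1) by simp
  thus ?thesis using k2 assms(3) by simp
qed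

text \<open>An element of the order that vanishes at all three residue points is a quadratic polynomial with
  three distinct zeros.\<close>

lemma maximal_if_unramified:
  assumes \<pi>: "\<pi> = 1" and t: "t ^ 3 - ev a * t + ev c = 0" and s: "s * s = ev a" "s \<noteq> 0"
    and three: "(3 :: 'l) = 0"
  shows "P_maximal_order h \<pi> a c y \<theta> \<O> P ev"
proof (unfold_locales)
  fix z c0 c1 c2 assume z: "z \<in> \<O>" and eq: "h P * z = lin c0 c1 c2"
  have "ev c0 + ev c1 * x + ev c2 * (x * x) = 0" if "x = t \<or> x = t + s \<or> x = t - s" for x
    using integral_quotient[OF residue_points_unramified[OF \<pi> t s(1) three that] z eq] by (simp add: res_def)
  hence "ev c0 = 0 \<and> ev c1 = 0 \<and> ev c2 = 0" by (intro quadratic_three_zeros[OF s(2) three]) auto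
  thus "P dvd c0 \<and> P dvd c1 \<and> P dvd c2" by (simp add: ev_eq_0_iff)
qed

end

section \<open>Decomposition of P\<close>

context P_maximal_order
begin

text \<open>The kernel of the character at a residue point. The definition mentions the order and the multiples
  of \<open>P\<close> instead of the character, so that generators can be tested by \<open>res\<close>.\<close>

definition point_ideal :: "'l \<Rightarrow> 'l \<Rightarrow> 'f set" where
  "point_ideal \<eta> \<tau> = {lin c0 c1 c2 + h P * r | c0 c1 c2 r. r \<in> \<O> \<and> res \<eta> \<tau> c0 c1 c2 = 0}"

lemma point_ideal_iff:
  assumes "r \<in> \<O>"
  shows "lin c0 c1 c2 + h P * r \<in> point_ideal \<eta> \<tau> \<longleftrightarrow> res \<eta> \<tau> c0 c1 c2 = 0"
proof
  assume "lin c0 c1 c2 + h P * r \<in> point_ideal \<eta> \<tau>"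
  then obtain d0 d1 d2 r' where "lin c0 c1 c2 + h P * r = lin d0 d1 d2 + h P * r'" "r' \<in> \<O>"
    "res \<eta> \<tau> d0 d1 d2 = 0" unfolding point_ideal_def by blast
  thus "res \<eta> \<tau> c0 c1 c2 = 0" using approximation_unique[OF assms] by (simp add: res_def)
next
  assume "res \<eta> \<tau> c0 c1 c2 = 0"
  thus "lin c0 c1 c2 + h P * r \<in> point_ideal \<eta> \<tau>" unfolding point_ideal_def using assms by blast
qed

lemma lin_in_point_ideal_iff: "lin c0 c1 c2 \<in> point_ideal \<eta> \<tau> \<longleftrightarrow> res \<eta> \<tau> c0 c1 c2 = 0"
  using point_ideal_iff[OF O_0, of c0 c1 c2] by simp

lemma P_in_point_ideal: "h P \<in> point_ideal \<eta> \<tau>"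
  using lin_in_point_ideal_iff[of P 0 0] by (simp add: lin_const res_def ev_simps ev_P)

lemma point_idealE:
  assumes "z \<in> point_ideal \<eta> \<tau>"
  obtains c0 c1 c2 r where "r \<in> \<O>" "z = lin c0 c1 c2 + h P * r" "res \<eta> \<tau> c0 c1 c2 = 0"
  using assms unfolding point_ideal_def by blast

lemma primeideal_point_ideal:
  assumes "residue_point \<eta> \<tau>"
  shows "primeideal (point_ideal \<eta> \<tau>) OR"
proof -
  obtain \<Phi> :: "'f \<Rightarrow> 'l" where
    \<Phi>: "\<And>c0 c1 c2 r. r \<in> \<O> \<Longrightarrow> \<Phi> (lin c0 c1 c2 + h P * r) = res \<eta> \<tau> c0 c1 c2"
    and prime: "primeideal {z \<in> \<O>. \<Phi> z = 0} OR" using character_exists[OF assms] by blast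
  have "{z \<in> \<O>. \<Phi> z = 0} = point_ideal \<eta> \<tau>"
  proof (intro equalityI subsetI)
    fix z assume "z \<in> {z \<in> \<O>. \<Phi> z = 0}"
    hence z: "z \<in> \<O>" "\<Phi> z = 0" by auto
    obtain c0 c1 c2 r where r: "r \<in> \<O>" "z = lin c0 c1 c2 + h P * r" using approximation[OF z(1)] .
    thus "z \<in> point_ideal \<eta> \<tau>" using z(2) \<Phi> point_ideal_iff by simp
  next
    fix z assume "z \<in> point_ideal \<eta> \<tau>"
    then obtain c0 c1 c2 r where r: "r \<in> \<O>" "z = lin c0 c1 c2 + h P * r" "res \<eta> \<tau> c0 c1 c2 = 0"
      by (rule point_idealE)
    have "z \<in> \<O>" unfolding r(2) by (intro O_add O_mult lin_O O_const r(1))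
    moreover have "\<Phi> z = 0" unfolding r(2) using \<Phi>[OF r(1)] r(3) by simp
    ultimately show "z \<in> {z \<in> \<O>. \<Phi> z = 0}" by simp
  qed
  thus ?thesis using prime by simp
qed

lemma ideal_point_ideal: "residue_point \<eta> \<tau> \<Longrightarrow> ideal (point_ideal \<eta> \<tau>) OR"
  using primeideal_point_ideal primeideal.axioms(1) by blast

lemma approximation_mult:
  assumes "r \<in> \<O>" "s \<in> \<O>" "u \<in> \<O>" "v \<in> \<O>"
  obtains k where "k \<in> \<O>" "(u + h P * r) * (v + h P * s) = u * v + h P * k"
proof -
  have "(u + h P * r) * (v + h P * s) = u * v + h P * (u * s + r * (v + h P * s))"
    by (simp add: algebra_simps)
  moreover have "u * s + r * (v + h P * s) \<in> \<O>" by (intro O_add O_mult O_const assms)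
  ultimately show thesis using that by blast
qed

text \<open>To find \<open>P\<close> in an ideal that contains \<open>P\<^sup>2\<close>, a multiple \<open>P s\<close> with \<open>s\<close> invertible modulo \<open>P\<close>
  suffices.\<close>

lemma P_in_ideal_if_unit_multiple:
  assumes I: "ideal I OR" and PP: "h P * h P \<in> I" and s: "h P * h s \<in> I" "\<not> P dvd s"
  shows "h P \<in> I"
proof -
  obtain u v where uv: "u * s + v * P = 1" using irreducible_bezout[OF irr s(2)] .
  have "h P = h (u * s + v * P) * h P" unfolding uv by (simp add: j_1)
  also have "\<dots> = h u * (h P * h s) + h v * (h P * h P)" by (simp add: j_simps algebra_simps)
  also have "\<dots> \<in> I" by (intro PP s(1) O_const ideal_OR_D(2,4)[OF I])
  finally show ?thesis .
qed

text \<open>The prime \<open>p\<close> is generated by \<open>P\<close>, \<open>y\<close> and \<open>\<theta>\<close>. From \<open>\<pi> c = a y - y \<theta>\<close>, where \<open>\<pi> c\<close> is \<open>P\<close> times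
  a unit modulo \<open>P\<close>, it follows that \<open>P \<in> p\<^sup>2\<close>. Then \<open>\<theta> \<in> p\<^sup>2\<close> by \<open>y\<^sup>2 = \<pi> \<theta>\<close> or \<open>y \<in> p\<^sup>2\<close> by
  \<open>\<theta>\<^sup>2 = a \<theta> - c y\<close>, whichever of \<open>\<pi>\<close> and \<open>c\<close> is prime to \<open>P\<close>; so \<open>y \<theta> \<in> p\<^sup>3\<close>, and the first relation
  gives \<open>P \<in> p\<^sup>3\<close>. Conversely, a product of three elements of \<open>p\<close> has coordinates divisible by \<open>P\<close>.\<close>

theorem totally_ramified:
  assumes a: "P dvd a" and \<pi>c: "P dvd \<pi> * c" "\<not> P ^ 2 dvd \<pi> * c"
  shows "\<exists>p. primeideal p OR \<and> PIdl\<^bsub>OR\<^esub> (h P) = ideal_prod OR (ideal_prod OR p p) p"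
proof (intro exI conjI)
  let ?p = "point_ideal 0 0"
  let ?pp = "ideal_prod OR ?p ?p"
  let ?ppp = "ideal_prod OR ?pp ?p"
  have origin: "residue_point 0 0" using residue_point_origin[OF \<pi>c(1)] .
  show "primeideal ?p OR" by (rule primeideal_point_ideal[OF origin])
  have p: "ideal ?p OR" by (rule ideal_point_ideal[OF origin])
  have pp: "ideal ?pp OR" by (rule ideal_prod_ideal[OF p p])
  have ppp: "ideal ?ppp OR" by (rule ideal_prod_ideal[OF pp p])
  have eva: "ev a = 0" using a by (simp add: ev_eq_0_iff)
  have ev\<pi>c: "ev \<pi> = 0 \<or> ev c = 0" using \<pi>c(1) unfolding ev_eq_0_iff[symmetric] by (simp add: ev_mult)
  obtain a' where a': "a = P * a'" using a by (rule dvdE)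
  obtain m where m: "\<pi> * c = P * m" using \<pi>c(1) by (rule dvdE)
  have ndvd_m: "\<not> P dvd m" using \<pi>c(2) unfolding m power2_eq_square using P_nonzero by simp
  have y: "y \<in> ?p" using lin_in_point_ideal_iff[of 0 1 0] by (simp add: lin_y res_def ev_simps)
  have \<theta>: "\<theta> \<in> ?p" using lin_in_point_ideal_iff[of 0 0 1] by (simp add: lin_\<theta> res_def ev_simps)
  note Pp = P_in_point_ideal[of 0 0]
  have step: "h P \<in> I" if I: "ideal I OR" "h P * h P \<in> I" "h P * y \<in> I" "y * \<theta> \<in> I" for I
  proof (rule P_in_ideal_if_unit_multiple[OF I(1,2) _ ndvd_m])
    have "h P * h m = h a' * (h P * y) - y * \<theta>"
      unfolding y\<theta> j_mult[symmetric] m[symmetric] by (simp add: a' j_simps mult_ac)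
    also have "\<dots> \<in> I" by (intro I(3,4) O_const ideal_OR_D(3,4)[OF I(1)])
    finally show "h P * h m \<in> I" .
  qed
  have Ppp: "h P \<in> ?pp"
    by (intro step[OF pp] ideal_prod_memI Pp y \<theta>)
  have "\<not> P dvd \<pi> \<or> \<not> P dvd c"
    using \<pi>c mult_dvd_mono[of P \<pi> P c] by (auto simp: power2_eq_square)
  hence "y * \<theta> \<in> ?ppp"
  proof
    assume "\<not> P dvd \<pi>"
    then obtain u v where uv: "u * \<pi> + v * P = 1" using irreducible_bezout[OF irr] by metis
    have "\<theta> = h (u * \<pi> + v * P) * \<theta>" unfolding uv by (simp add: j_1)
    also have "\<dots> = h u * (y * y) + (h v * \<theta>) * h P" unfolding yy by (simp add: j_simps algebra_simps)
    also have "\<dots> \<in> ?pp"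
      by (intro ideal_prod_memI[OF y y] Ppp O_mult[OF O_const \<theta>_O] O_const ideal_OR_D(2,4)[OF pp])
    finally show ?thesis using ideal_prod_memI[OF _ y] by (metis mult.commute)
  next
    assume "\<not> P dvd c"
    then obtain u v where uv: "u * c + v * P = 1" using irreducible_bezout[OF irr] by metis
    have "y = h (u * c + v * P) * y" unfolding uv by (simp add: j_1)
    also have "\<dots> = h u * ((h a' * \<theta>) * h P - \<theta> * \<theta>) + (h v * y) * h P"
      unfolding \<theta>\<theta> by (simp add: j_simps a' algebra_simps)
    also have "\<dots> \<in> ?pp"
      by (intro ideal_prod_memI[OF \<theta> \<theta>] Ppp O_mult[OF O_const \<theta>_O] O_mult[OF O_const y_O] O_const
        ideal_OR_D(2,3,4)[OF pp])
    finally show ?thesis using ideal_prod_memI[OF _ \<theta>] by blast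
  qed
  hence "h P \<in> ?ppp" by (intro step[OF ppp] ideal_prod_memI[OF Ppp Pp] ideal_prod_memI[OF Ppp y])
  hence "PIdl\<^bsub>OR\<^esub> (h P) \<subseteq> ?ppp" by (rule PIdl_subset[OF ppp])
  moreover have "?ppp \<subseteq> PIdl\<^bsub>OR\<^esub> (h P)"
  proof (rule ideal_prod3_subsetI)
    fix u v w assume "u \<in> ?p" "v \<in> ?p" "w \<in> ?p"
    obtain a0 a1 a2 r where u: "r \<in> \<O>" "u = lin a0 a1 a2 + h P * r" "res 0 0 a0 a1 a2 = 0"
      using \<open>u \<in> ?p\<close> by (rule point_idealE)
    obtain b0 b1 b2 s where v: "s \<in> \<O>" "v = lin b0 b1 b2 + h P * s" "res 0 0 b0 b1 b2 = 0"
      using \<open>v \<in> ?p\<close> by (rule point_idealE)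
    obtain e0 e1 e2 t where w: "t \<in> \<O>" "w = lin e0 e1 e2 + h P * t" "res 0 0 e0 e1 e2 = 0"
      using \<open>w \<in> ?p\<close> by (rule point_idealE)
    obtain k where k: "k \<in> \<O>" "u * v = lin a0 a1 a2 * lin b0 b1 b2 + h P * k"
      unfolding u(2) v(2) by (rule approximation_mult[OF u(1) v(1) lin_O lin_O])
    obtain l where l: "l \<in> \<O>" "u * v * w = lin a0 a1 a2 * lin b0 b1 b2 * lin e0 e1 e2 + h P * l"
      unfolding k(2) w(2) by (rule approximation_mult[OF k(1) w(1) O_mult[OF lin_O lin_O] lin_O])
    have ev0: "ev a0 = 0" "ev b0 = 0" "ev e0 = 0" using u(3) v(3) w(3) by (simp_all add: res_def)
    show "u * v * w \<in> PIdl\<^bsub>OR\<^esub> (h P)"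
      unfolding l(2) lin_mult multiple_of_P_iff[OF l(1)]
      using ev\<pi>c by (auto simp: ev_simps ev0 eva)
  qed (rule ideal_OR_D(2)[OF ideal_PIdl])
  ultimately show "PIdl\<^bsub>OR\<^esub> (h P) = ?ppp" by (rule equalityI)
qed

text \<open>Here \<open>q = (P, y, \<theta>)\<close> and \<open>p = (P, y, \<theta> - a)\<close>. Since \<open>y\<^sup>2 = P \<theta>\<close>, the difference
  \<open>y\<^sup>2 - P (\<theta> - a) = P a\<close> shows \<open>P \<in> p\<^sup>2\<close>; then \<open>P (\<theta> - a)\<^sup>2\<close> and \<open>P \<theta>\<close> lie in \<open>q p\<^sup>2\<close>, and they
  combine to \<open>P a\<^sup>2\<close>.\<close>

theorem partially_ramified:
  assumes \<pi>: "\<pi> = P" and a: "\<not> P dvd a"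
  shows "\<exists>p q. primeideal p OR \<and> primeideal q OR \<and> p \<noteq> q \<and>
    PIdl\<^bsub>OR\<^esub> (h P) = ideal_prod OR q (ideal_prod OR p p)"
proof (intro exI conjI)
  let ?q = "point_ideal 0 0" and ?p = "point_ideal 0 (ev a)"
  let ?pp = "ideal_prod OR ?p ?p"
  let ?qpp = "ideal_prod OR ?q ?pp"
  have rp: "residue_point 0 0" "residue_point 0 (ev a)"
    unfolding residue_point_def by (simp_all add: \<pi> ev_P)
  have eva: "ev a \<noteq> 0" using a by (simp add: ev_eq_0_iff)
  show "primeideal ?p OR" "primeideal ?q OR" by (intro primeideal_point_ideal rp)+
  have p: "ideal ?p OR" and q: "ideal ?q OR" by (intro ideal_point_ideal rp)+
  have pp: "ideal ?pp OR" by (rule ideal_prod_ideal[OF p p])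
  have qpp: "ideal ?qpp OR" by (rule ideal_prod_ideal[OF q pp])
  have yp: "y \<in> ?p" using lin_in_point_ideal_iff[of 0 1 0] by (simp add: lin_y res_def ev_simps)
  have \<theta>p: "\<theta> - h a \<in> ?p" using lin_in_point_ideal_iff[of "- a" 0 1] by (simp add: lin_def j_simps res_def ev_simps)
  have \<theta>q: "\<theta> \<in> ?q" using lin_in_point_ideal_iff[of 0 0 1] by (simp add: lin_\<theta> res_def ev_simps)
  have "\<theta> \<notin> ?p" using lin_in_point_ideal_iff[of 0 0 1] eva by (simp add: lin_\<theta> res_def ev_simps)
  thus "?p \<noteq> ?q" using \<theta>q by blast
  have Ppp: "h P \<in> ?pp"
  proof (rule P_in_ideal_if_unit_multiple[OF pp _ _ a])
    have "y * y = h P * \<theta>" unfolding yy by (simp only: \<pi>)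
    hence "h P * h a = y * y - h P * (\<theta> - h a)" by (simp add: algebra_simps)
    also have "\<dots> \<in> ?pp"
      by (intro ideal_OR_D(3)[OF pp] ideal_prod_memI yp \<theta>p P_in_point_ideal)
    finally show "h P * h a \<in> ?pp" .
  qed (intro ideal_prod_memI P_in_point_ideal)
  have "h P \<in> ?qpp"
  proof (rule P_in_ideal_if_unit_multiple[OF qpp])
    show "\<not> P dvd a * a" using a irreducible_dvd_mult_iff[OF irr] by blast
    have O: "\<theta> - h (2 * a) \<in> \<O>" by (intro O_diff O_const \<theta>_O)
    have "h P * h (a * a) = h P * ((\<theta> - h a) * (\<theta> - h a)) - (\<theta> - h (2 * a)) * (\<theta> * h P)"
    proof -
      have "h (2 * a) = h a + h a" unfolding mult_2 j_add ..
      thus ?thesis by (simp add: j_mult algebra_simps)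
    qed
    also have "\<dots> \<in> ?qpp"
      by (intro ideal_OR_D(3)[OF qpp] ideal_OR_D(4)[OF qpp O]
        ideal_prod_memI[OF P_in_point_ideal ideal_prod_memI[OF \<theta>p \<theta>p]] ideal_prod_memI[OF \<theta>q Ppp])
    finally show "h P * h (a * a) \<in> ?qpp" .
  qed (intro ideal_prod_memI P_in_point_ideal Ppp)
  hence "PIdl\<^bsub>OR\<^esub> (h P) \<subseteq> ?qpp" by (rule PIdl_subset[OF qpp])
  moreover have "?qpp \<subseteq> PIdl\<^bsub>OR\<^esub> (h P)"
  proof (rule ideal_prod_subsetI)
    have "ideal_prod OR (ideal_prod OR ?p ?p) ?q \<subseteq> PIdl\<^bsub>OR\<^esub> (h P)"
    proof (rule ideal_prod3_subsetI)
      fix u v w assume "u \<in> ?p" "v \<in> ?p" "w \<in> ?q"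
      obtain a0 a1 a2 r where u: "r \<in> \<O>" "u = lin a0 a1 a2 + h P * r" "res 0 (ev a) a0 a1 a2 = 0"
        using \<open>u \<in> ?p\<close> by (rule point_idealE)
      obtain b0 b1 b2 s where v: "s \<in> \<O>" "v = lin b0 b1 b2 + h P * s" "res 0 (ev a) b0 b1 b2 = 0"
        using \<open>v \<in> ?p\<close> by (rule point_idealE)
      obtain e0 e1 e2 t where w: "t \<in> \<O>" "w = lin e0 e1 e2 + h P * t" "res 0 0 e0 e1 e2 = 0"
        using \<open>w \<in> ?q\<close> by (rule point_idealE)
      obtain k where k: "k \<in> \<O>" "u * v = lin a0 a1 a2 * lin b0 b1 b2 + h P * k"
        unfolding u(2) v(2) by (rule approximation_mult[OF u(1) v(1) lin_O lin_O])
      obtain l where l: "l \<in> \<O>" "u * v * w = lin a0 a1 a2 * lin b0 b1 b2 * lin e0 e1 e2 + h P * l"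
        unfolding k(2) w(2) by (rule approximation_mult[OF k(1) w(1) O_mult[OF lin_O lin_O] lin_O])
      have ev0: "ev a0 = - (ev a2 * ev a)" "ev b0 = - (ev b2 * ev a)" "ev e0 = 0"
        using u(3) v(3) w(3) by (simp_all add: res_def eq_neg_iff_add_eq_0)
      have ev\<pi>: "ev \<pi> = 0" unfolding \<pi> by (rule ev_P)
      define d0 where "d0 = a0 * b0 - (a1 * b2 + a2 * b1) * (\<pi> * c)"
      define d1 where "d1 = a0 * b1 + a1 * b0 + a * (a1 * b2 + a2 * b1) - c * (a2 * b2)"
      define d2 where "d2 = a0 * b2 + a2 * b0 + \<pi> * (a1 * b1) + a * (a2 * b2)"
      have d: "ev d0 = ev a * ev a * ev a2 * ev b2" "ev d1 = - (ev c * ev a2 * ev b2)"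
        "ev d2 = - (ev a * ev a2 * ev b2)"
        unfolding d0_def d1_def d2_def ev_simps ev0 ev\<pi> by (simp_all add: algebra_simps)
      have uvw: "u * v * w = lin d0 d1 d2 * lin e0 e1 e2 + h P * l"
        unfolding l(2) lin_mult[of a0 a1 a2] d0_def d1_def d2_def ..
      show "u * v * w \<in> PIdl\<^bsub>OR\<^esub> (h P)"
        unfolding uvw lin_mult multiple_of_P_iff[OF l(1)] ev_add ev_diff ev_mult d ev0 ev\<pi>
        by (simp add: algebra_simps)
    qed (rule ideal_OR_D(2)[OF ideal_PIdl])
    thus "u * v \<in> PIdl\<^bsub>OR\<^esub> (h P)" if "u \<in> ?q" "v \<in> ?pp" for u v
    proof -
      have "v * u \<in> ideal_prod OR ?pp ?q" by (rule ideal_prod_memI[OF that(2,1)])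
      hence "v * u \<in> PIdl\<^bsub>OR\<^esub> (h P)" using \<open>ideal_prod OR ?pp ?q \<subseteq> PIdl\<^bsub>OR\<^esub> (h P)\<close> by (rule rev_subsetD)
      thus ?thesis by (simp only: mult.commute)
    qed
  qed (rule ideal_OR_D(2)[OF ideal_PIdl])
  ultimately show "PIdl\<^bsub>OR\<^esub> (h P) = ?qpp" by (rule equalityI)
qed

lemma in_three_point_ideals:
  assumes s: "s \<noteq> 0" and three: "(3 :: 'l) = 0"
    and z: "z \<in> point_ideal t (t * t)" "z \<in> point_ideal (t + s) ((t + s) * (t + s))"
      "z \<in> point_ideal (t - s) ((t - s) * (t - s))"
  shows "z \<in> PIdl\<^bsub>OR\<^esub> (h P)"
proof -
  obtain c0 c1 c2 r where r: "r \<in> \<O>" "z = lin c0 c1 c2 + h P * r" using z(1) by (rule point_idealE)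
  have "ev c0 = 0 \<and> ev c1 = 0 \<and> ev c2 = 0"
    using z[unfolded r(2) point_ideal_iff[OF r(1)] res_def]
    by (intro quadratic_three_zeros[OF s three])
  thus ?thesis unfolding r(2) multiple_of_P_iff[OF r(1)] .
qed

lemma two_not_zero: "(3 :: 'l) = 0 \<Longrightarrow> (2 :: 'l) \<noteq> 0"
proof
  assume "(3 :: 'l) = 0" "(2 :: 'l) = 0"
  moreover have "(3 :: 'l) = 2 + 1" by simp
  ultimately show False by simp
qed

lemma range_ev_divide:
  assumes "u \<in> range ev" "v \<in> range ev"
  shows "u / v \<in> range ev"
proof (cases "v = 0")
  case True
  thus ?thesis using ev_0 by (metis div_by_0 rangeI)
next
  case False
  obtain u' v' where uv: "u = ev u'" "v = ev v'" using assms by blast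
  have "\<not> P dvd v'" using False unfolding uv ev_eq_0_iff .
  then obtain x w where "x * v' + w * P = 1" using irreducible_bezout[OF irr] by metis
  hence "ev (x * v' + w * P) = 1" by (simp add: ev_1)
  hence "ev x * v = 1" by (simp add: ev_simps ev_P uv)
  hence "u / v = ev (u' * x)" using False by (simp add: uv ev_mult field_simps)
  thus ?thesis by simp
qed

lemma range_ev_diff: "u \<in> range ev \<Longrightarrow> v \<in> range ev \<Longrightarrow> u - v \<in> range ev"
  by (metis (full_types) ev_diff imageE rangeI)

text \<open>If the reduced cubic has no root in the residue field, then \<open>1\<close>, \<open>t\<close>, \<open>t\<^sup>2\<close> are independent over it
  for a root \<open>t\<close> in \<open>'l\<close>, so the kernel of the character at \<open>t\<close> consists of the multiples of \<open>P\<close>.\<close>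

theorem inert:
  assumes \<pi>: "\<pi> = 1" and t: "t ^ 3 - ev a * t + ev c = 0" and s: "s * s = ev a"
    and three: "(3 :: 'l) = 0" and noroot: "\<And>r. ev r ^ 3 - ev a * ev r + ev c \<noteq> 0"
  shows "primeideal (PIdl\<^bsub>OR\<^esub> (h P)) OR"
proof -
  have rp: "residue_point t (t * t)" by (rule residue_points_unramified[OF \<pi> t s three]) simp
  have "point_ideal t (t * t) \<subseteq> PIdl\<^bsub>OR\<^esub> (h P)"
  proof
    fix z assume "z \<in> point_ideal t (t * t)"
    then obtain c0 c1 c2 r where r: "r \<in> \<O>" "z = lin c0 c1 c2 + h P * r" "res t (t * t) c0 c1 c2 = 0"
      by (rule point_idealE)
    have "ev c0 = 0 \<and> ev c1 = 0 \<and> ev c2 = 0"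
    proof (rule cubic_root_independent[of "range ev" "ev a" "ev c" t])
      show "0 \<in> range ev" using ev_0 by (metis rangeI)
      show "ev c0 + ev c1 * t + ev c2 * t\<^sup>2 = 0" using r(3) by (simp add: res_def power2_eq_square)
    qed (use t noroot range_ev_divide range_ev_diff in auto)
    thus "z \<in> PIdl\<^bsub>OR\<^esub> (h P)" unfolding r(2) multiple_of_P_iff[OF r(1)] .
  qed
  moreover have "PIdl\<^bsub>OR\<^esub> (h P) \<subseteq> point_ideal t (t * t)"
    by (rule PIdl_subset[OF ideal_point_ideal[OF rp] P_in_point_ideal])
  ultimately have "PIdl\<^bsub>OR\<^esub> (h P) = point_ideal t (t * t)" by blast
  thus ?thesis using primeideal_point_ideal[OF rp] by simp
qed

lemma \<theta>_eq: "\<pi> = 1 \<Longrightarrow> \<theta> = y * y" using yy by (simp add: j_1)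

lemma linear_in_point_ideal_iff: "y - h r \<in> point_ideal x (x * x) \<longleftrightarrow> x = ev r"
  using lin_in_point_ideal_iff[of "- r" 1 0 x "x * x"]
  by (simp add: lin_def j_simps res_def ev_simps)

text \<open>The primes are \<open>p = (P, y - r)\<close> and \<open>q = (P, (y - r)\<^sup>2 - a)\<close>, the kernels at \<open>r\<close> and at \<open>r + s\<close>. As
  \<open>s\<close> is quadratic over the residue field, \<open>q\<close> is also the kernel at the conjugate root \<open>r - s\<close>; hence a
  product from \<open>p\<close> and \<open>q\<close> vanishes at all three residue points.\<close>

theorem partially_split:
  assumes \<pi>: "\<pi> = 1" and t: "ev r ^ 3 - ev a * ev r + ev c = 0" and s: "s * s = ev a"
    and a: "\<not> P dvd a" and three: "(3 :: 'l) = 0" and irrational: "s \<notin> range ev"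
  shows "\<exists>p q. primeideal p OR \<and> primeideal q OR \<and> p \<noteq> q \<and> PIdl\<^bsub>OR\<^esub> (h P) = ideal_prod OR p q"
proof (intro exI conjI)
  define x where "x = ev r + s"
  let ?p = "point_ideal (ev r) (ev r * ev r)" and ?q = "point_ideal x (x * x)"
  have s0: "s \<noteq> 0" using irrational ev_0 by (metis rangeI)
  have rp: "residue_point (ev r) (ev r * ev r)" "residue_point x (x * x)"
    unfolding x_def by (rule residue_points_unramified[OF \<pi> t s three]; simp)+
  show "primeideal ?p OR" "primeideal ?q OR" by (intro primeideal_point_ideal rp)+
  have p: "ideal ?p OR" and q: "ideal ?q OR" by (intro ideal_point_ideal rp)+
  have pq: "ideal (ideal_prod OR ?p ?q) OR" by (rule ideal_prod_ideal[OF p q])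
  define v where "v = y - h r"
  have v: "v \<in> ?p" "v \<notin> ?q" unfolding v_def linear_in_point_ideal_iff x_def using s0 by simp_all
  thus "?p \<noteq> ?q" by blast
  have g: "v * v - h a \<in> ?q"
  proof -
    have "v * v - h a = lin (r * r - a) (- (r + r)) 1"
      unfolding v_def lin_def j_diff j_minus j_add j_mult j_1
      unfolding \<theta>_eq[OF \<pi>] by (simp add: algebra_simps)
    moreover have "res x (x * x) (r * r - a) (- (r + r)) 1 = 0"
      unfolding res_def x_def unfolding ev_add ev_diff ev_minus ev_mult ev_1 s[symmetric]
      by (simp add: algebra_simps)
    ultimately show ?thesis by (simp add: lin_in_point_ideal_iff)
  qed
  have "h P \<in> ideal_prod OR ?p ?q"
  proof (rule P_in_ideal_if_unit_multiple[OF pq _ _ a])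
    have "v \<in> \<O>" unfolding v_def by (intro O_diff y_O O_const)
    have "h P * h a = v * (v * h P) - h P * (v * v - h a)" by (simp add: algebra_simps)
    also have "\<dots> \<in> ideal_prod OR ?p ?q"
      by (intro ideal_OR_D(3)[OF pq] ideal_OR_D(4)[OF pq \<open>v \<in> \<O>\<close>] ideal_prod_memI[OF v(1) P_in_point_ideal]
        ideal_prod_memI[OF P_in_point_ideal g])
    finally show "h P * h a \<in> ideal_prod OR ?p ?q" .
  qed (intro ideal_prod_memI P_in_point_ideal)
  hence "PIdl\<^bsub>OR\<^esub> (h P) \<subseteq> ideal_prod OR ?p ?q" by (rule PIdl_subset[OF pq])
  moreover have "ideal_prod OR ?p ?q \<subseteq> PIdl\<^bsub>OR\<^esub> (h P)"
  proof (rule ideal_prod_subsetI)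
    fix u w assume u: "u \<in> ?p" and w: "w \<in> ?q"
    have rp': "residue_point (ev r - s) ((ev r - s) * (ev r - s))"
      by (rule residue_points_unramified[OF \<pi> t s three]) simp
    have uO: "u \<in> \<O>" and wO: "w \<in> \<O>" using u w ideal_OR_D(1)[OF p] ideal_OR_D(1)[OF q] by blast+
    have w': "w \<in> point_ideal (ev r - s) ((ev r - s) * (ev r - s))"
    proof -
      obtain c0 c1 c2 k where k: "k \<in> \<O>" "w = lin c0 c1 c2 + h P * k" "res x (x * x) c0 c1 c2 = 0"
        using w by (rule point_idealE)
      define k0 k1 where "k0 = c0 + c1 * r + c2 * (r * r + a)" and "k1 = c1 + c2 * (r + r)"
      have at: "res (ev r + e) ((ev r + e) * (ev r + e)) c0 c1 c2 = ev k0 + ev k1 * e" if "e * e = ev a" for e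
        unfolding res_def k0_def k1_def ev_add ev_mult that[symmetric] by (simp add: algebra_simps)
      have zero: "ev k0 + ev k1 * s = 0" using k(3) unfolding x_def at[OF s] .
      have "ev k1 = 0"
      proof (rule ccontr)
        assume nz: "ev k1 \<noteq> 0"
        have "s * ev k1 = ev (- k0)" using zero by (simp add: ev_minus eq_neg_iff_add_eq_0 ac_simps)
        hence "s = ev (- k0) / ev k1" using nz by (simp only: nonzero_eq_divide_eq not_False_eq_True)
        thus False using irrational range_ev_divide by blast
      qed
      hence "res (ev r + - s) ((ev r + - s) * (ev r + - s)) c0 c1 c2 = 0"
        using zero by (subst at) (simp_all add: s)
      thus ?thesis unfolding k(2) point_ideal_iff[OF k(1)] by simp
    qed
    show "u * w \<in> PIdl\<^bsub>OR\<^esub> (h P)"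
    proof (rule in_three_point_ideals[OF s0 three])
      show "u * w \<in> ?p" using ideal_OR_D(4)[OF p wO u] by (simp add: mult.commute)
      show "u * w \<in> point_ideal (ev r + s) ((ev r + s) * (ev r + s))"
        using ideal_OR_D(4)[OF q uO w] unfolding x_def .
      show "u * w \<in> point_ideal (ev r - s) ((ev r - s) * (ev r - s))"
        by (rule ideal_OR_D(4)[OF ideal_point_ideal[OF rp'] uO w'])
    qed
  qed (rule ideal_OR_D(2)[OF ideal_PIdl])
  ultimately show "PIdl\<^bsub>OR\<^esub> (h P) = ideal_prod OR ?p ?q" by (rule equalityI)
qed

text \<open>With \<open>v = y - r\<close> the primes are generated by \<open>P\<close> and one of \<open>v - s\<close>, \<open>v + s\<close>, \<open>v\<close>. They are pairwise
  comaximal because \<open>s\<close> and \<open>2 s\<close> are units modulo \<open>P\<close>.\<close>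

theorem totally_split:
  assumes \<pi>: "\<pi> = 1" and t: "ev r ^ 3 - ev a * ev r + ev c = 0" and s: "ev s * ev s = ev a"
    and a: "\<not> P dvd a" and three: "(3 :: 'l) = 0"
  shows "\<exists>p q r. primeideal p OR \<and> primeideal q OR \<and> primeideal r OR \<and> p \<noteq> q \<and> p \<noteq> r \<and> q \<noteq> r \<and>
    PIdl\<^bsub>OR\<^esub> (h P) = ideal_prod OR (ideal_prod OR p q) r"
proof (intro exI conjI)
  let ?I = "\<lambda>r. point_ideal (ev r) (ev r * ev r)"
  let ?p = "?I (r + s)" and ?q = "?I (r - s)" and ?r = "?I r"
  let ?pq = "ideal_prod OR ?p ?q"
  let ?pqr = "ideal_prod OR ?pq ?r"
  have evs: "ev s \<noteq> 0" using a s unfolding ev_eq_0_iff[symmetric] by auto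
  have rp: "residue_point (ev x) (ev x * ev x)" if "x = r \<or> x = r + s \<or> x = r - s" for x
    by (rule residue_points_unramified[OF \<pi> t s three]) (use that in \<open>auto simp: ev_simps\<close>)
  note rps = rp[of r] rp[of "r + s"] rp[of "r - s"]
  show "primeideal ?p OR" "primeideal ?q OR" "primeideal ?r OR"
    using rps by (auto intro!: primeideal_point_ideal)
  have p: "ideal ?p OR" and q: "ideal ?q OR" and r: "ideal ?r OR"
    using rps by (auto intro!: ideal_point_ideal)
  have pq: "ideal ?pq OR" by (rule ideal_prod_ideal[OF p q])
  have pqr: "ideal ?pqr OR" by (rule ideal_prod_ideal[OF pq r])
  have mem: "y - h x \<in> ?I x" and notmem: "ev x \<noteq> ev z \<Longrightarrow> y - h x \<notin> ?I z" for x z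
    by (auto simp: linear_in_point_ideal_iff)
  have "- ev s \<noteq> ev s"
  proof
    assume "- ev s = ev s"
    hence "ev s + ev s = 0" by (metis add.left_inverse)
    hence "2 * ev s = 0" by (simp only: mult_2)
    thus False using evs two_not_zero[OF three] by simp
  qed
  hence "ev (r + s) \<noteq> ev (r - s)" 
    unfolding ev_add ev_diff by (metis add_left_cancel diff_conv_add_uminus)
  moreover have "ev (r + s) \<noteq> ev r" "ev (r - s) \<noteq> ev r"
    using evs by (simp_all add: ev_add ev_diff)
  ultimately show "?p \<noteq> ?q" "?p \<noteq> ?r" "?q \<noteq> ?r"
    using mem[of "r + s"] mem[of "r - s"] notmem[of "r + s" "r - s"] notmem[of "r + s" r] notmem[of "r - s" r]
    by blast+
  define v where "v = y - h r"
  have v: "v \<in> ?r" "v - h s \<in> ?p" "v + h s \<in> ?q"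
    using mem[of r] mem[of "r + s"] mem[of "r - s"] by (simp_all add: v_def j_simps algebra_simps)
  have vO: "v \<in> \<O>" unfolding v_def by (intro O_diff y_O O_const)
  have Ppq: "h P \<in> ?pq"
  proof (rule P_in_ideal_if_unit_multiple[OF pq])
    have "ev (s + s) = 2 * ev s" unfolding ev_add by (simp only: mult_2)
    thus "\<not> P dvd s + s" using evs two_not_zero[OF three] unfolding ev_eq_0_iff[symmetric] by simp
    have "h P * h (s + s) = h P * (v + h s) - (v - h s) * h P"
      unfolding j_add by (simp add: algebra_simps)
    also have "\<dots> \<in> ?pq"
      by (intro ideal_OR_D(3)[OF pq] ideal_prod_memI[OF P_in_point_ideal v(3)] ideal_prod_memI[OF v(2) P_in_point_ideal])
    finally show "h P * h (s + s) \<in> ?pq" .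
  qed (intro ideal_prod_memI P_in_point_ideal)
  have "h P \<in> ?pqr"
  proof (rule P_in_ideal_if_unit_multiple[OF pqr])
    show "\<not> P dvd s * s" using evs unfolding ev_eq_0_iff[symmetric] by (simp add: ev_mult)
    have "h P * h (s * s) = v * (h P * v) - ((v - h s) * (v + h s)) * h P" by (simp add: j_simps algebra_simps)
    also have "\<dots> \<in> ?pqr"
      by (intro ideal_OR_D(3)[OF pqr] ideal_OR_D(4)[OF pqr vO] ideal_prod_memI[OF Ppq v(1)]
        ideal_prod_memI[OF ideal_prod_memI[OF v(2,3)] P_in_point_ideal])
    finally show "h P * h (s * s) \<in> ?pqr" .
  qed (intro ideal_prod_memI Ppq P_in_point_ideal)
  hence "PIdl\<^bsub>OR\<^esub> (h P) \<subseteq> ?pqr" by (rule PIdl_subset[OF pqr])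
  moreover have "?pqr \<subseteq> PIdl\<^bsub>OR\<^esub> (h P)"
  proof (rule ideal_prod3_subsetI)
    fix u w z assume u: "u \<in> ?p" and w: "w \<in> ?q" and z: "z \<in> ?r"
    have O: "u \<in> \<O>" "w \<in> \<O>" "z \<in> \<O>"
      using u w z ideal_OR_D(1)[OF p] ideal_OR_D(1)[OF q] ideal_OR_D(1)[OF r] by blast+
    have uwz: "(w * z) * u = u * w * z" "(u * z) * w = u * w * z" by (simp_all add: mult_ac)
    show "u * w * z \<in> PIdl\<^bsub>OR\<^esub> (h P)"
    proof (rule in_three_point_ideals[OF evs three])
      show "u * w * z \<in> ?r" by (rule ideal_OR_D(4)[OF r O_mult[OF O(1,2)] z])
      show "u * w * z \<in> point_ideal (ev r + ev s) ((ev r + ev s) * (ev r + ev s))"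
        using ideal_OR_D(4)[OF p O_mult[OF O(2,3)] u] unfolding uwz ev_add .
      show "u * w * z \<in> point_ideal (ev r - ev s) ((ev r - ev s) * (ev r - ev s))"
        using ideal_OR_D(4)[OF q O_mult[OF O(1,3)] w] unfolding uwz ev_diff .
    qed
  qed (rule ideal_OR_D(2)[OF ideal_PIdl])
  ultimately show "PIdl\<^bsub>OR\<^esub> (h P) = ?pqr" by (rule equalityI)
qed

end


section \<open>Counting roots in a finite field\<close>

context Ring.field
begin

lemma frobenius_fixes:
  assumes "finite (carrier R)" "x \<in> carrier R"
  shows "x [^] card (carrier R) = x"
proof (cases "x = \<zero>")
  case True
  have "card (carrier R) \<noteq> 0" using assms by auto
  thus ?thesis using True by (simp add: nat_pow_zero)
next
  case False
  interpret M: group "Multiplicative_Group.mult_of R" by (rule field_mult_group)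
  have "x [^]\<^bsub>Multiplicative_Group.mult_of R\<^esub> Coset.order (Multiplicative_Group.mult_of R) = \<one>\<^bsub>Multiplicative_Group.mult_of R\<^esub>"
    by (rule M.pow_order_eq_1) (use assms False in simp)
  hence one: "x [^] (card (carrier R) - 1) = \<one>"
    by (simp add: order_mult_of[OF assms(1)] Coset.order_def Multiplicative_Group.nat_pow_mult_of)
  have "card (carrier R) > 0" using assms by (auto simp: card_gt_0_iff)
  hence "card (carrier R) = Suc (card (carrier R) - 1)" by simp
  hence "x [^] card (carrier R) = x [^] (card (carrier R) - 1) \<otimes> x" using nat_pow_Suc[of x] by metis
  thus ?thesis using one assms(2) by simp
qed

lemma finite_roots:
  assumes "p \<in> carrier (poly_ring R)"
  shows "finite {x. is_root p x}" and "card {x. is_root p x} \<le> Polynomials.degree p"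
proof -
  have eq: "{x. is_root p x} = set_mset (roots p)"
    using roots_mem_iff_is_root[OF assms] by blast
  show "finite {x. is_root p x}" unfolding eq by simp
  have "card (set_mset (roots p)) = (\<Sum>x\<in>set_mset (roots p). 1)" by simp
  also have "\<dots> \<le> (\<Sum>x\<in>set_mset (roots p). count (roots p) x)"
    by (rule sum_mono) (simp add: Suc_leI)
  also have "\<dots> = size (roots p)" by (simp add: size_multiset_overloaded_eq)
  also have "\<dots> \<le> Polynomials.degree p" by (rule size_roots_le_degree[OF assms])
  finally show "card {x. is_root p x} \<le> Polynomials.degree p" unfolding eq .
qed

text \<open>All elements of a field with \<open>q\<close> elements are roots of \<open>X\<^sup>q - X = d h\<close>. At most \<open>q - deg d\<close> of them
  are roots of \<open>h\<close>, so \<open>d\<close> has as many roots as its degree allows; and \<open>d\<close> has the same roots as \<open>f\<close>,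
  because it is the gcd.\<close>

lemma card_roots_eq_degree_gcd:
  assumes fin: "finite (carrier R)" and f: "f \<in> carrier (poly_ring R)" "f \<noteq> []"
    and d: "d \<in> carrier (poly_ring R)"
    and gcd: "d gcdof\<^bsub>poly_ring R\<^esub> ((X [^]\<^bsub>poly_ring R\<^esub> card (carrier R)) \<ominus>\<^bsub>poly_ring R\<^esub> X) f"
  shows "card {x. is_root f x} = Polynomials.degree d"
proof -
  define q where "q = card (carrier R)"
  define Fr where "Fr = (X [^]\<^bsub>poly_ring R\<^esub> q) \<ominus>\<^bsub>poly_ring R\<^esub> X"
  interpret UP: domain "poly_ring R" by (rule univ_poly_is_domain[OF carrier_is_subring])
  have q1: "q > 1"
  proof -
    have "card {\<zero>, \<one>} \<le> q" unfolding q_def by (rule card_mono[OF fin]) simp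
    thus ?thesis by simp
  qed
  have Xq: "X [^]\<^bsub>poly_ring R\<^esub> q \<in> carrier (poly_ring R)" and X: "X \<in> carrier (poly_ring R)"
    by (rule var_pow_closed[OF carrier_is_subring]) (rule var_closed(1)[OF carrier_is_subring])
  hence Fr: "Fr \<in> carrier (poly_ring R)" unfolding Fr_def by simp
  have degFr: "Polynomials.degree Fr = q"
  proof -
    have "X [^]\<^bsub>poly_ring R\<^esub> q = monom \<one> q"
      using unitary_monom_eq_var_pow[OF carrier_is_subring] by simp
    hence dq: "Polynomials.degree (X [^]\<^bsub>poly_ring R\<^esub> q) = q" by (simp add: monom_def)
    have dX: "Polynomials.degree (\<ominus>\<^bsub>poly_ring R\<^esub> X) = 1"
      using univ_poly_a_inv_def'[OF carrier_is_subring X] by (simp add: var_def)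
    have "Polynomials.degree (poly_add (X [^]\<^bsub>poly_ring R\<^esub> q) (\<ominus>\<^bsub>poly_ring R\<^esub> X)) =
        max (Polynomials.degree (X [^]\<^bsub>poly_ring R\<^esub> q)) (Polynomials.degree (\<ominus>\<^bsub>poly_ring R\<^esub> X))"
      by (rule poly_add_degree_eq[OF carrier_is_subring])
        (use Xq X UP.a_inv_closed[OF X] q1 dq dX in \<open>auto simp: univ_poly_carrier\<close>)
    thus ?thesis unfolding Fr_def a_minus_def dq dX using q1 by (simp add: univ_poly_add)
  qed
  have evalFr: "eval Fr x = \<zero>" if x: "x \<in> carrier R" for x
  proof -
    interpret E: ring_hom_cring "poly_ring R" R "\<lambda>p. eval p x"
      using eval_cring_hom[OF carrier_is_subring x] .
    have "eval (X [^]\<^bsub>poly_ring R\<^esub> n) x = x [^] n" for n :: nat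
    proof (induction n)
      case (Suc n)
      have "X [^]\<^bsub>poly_ring R\<^esub> n \<in> carrier (poly_ring R)" by (rule UP.nat_pow_closed[OF X])
      thus ?case using Suc.IH X by (simp add: eval_var[OF x])
    qed simp
    hence "eval Fr x = x [^] q \<ominus> x"
      unfolding Fr_def a_minus_def using Xq X by (simp add: eval_var[OF x])
    thus ?thesis using frobenius_fixes[OF fin x] x unfolding q_def by (simp add: a_minus_def r_neg)
  qed
  have dFr: "d divides\<^bsub>poly_ring R\<^esub> Fr" and df: "d divides\<^bsub>poly_ring R\<^esub> f"
    and greatest: "\<And>g. g \<in> carrier (poly_ring R) \<Longrightarrow> g divides\<^bsub>poly_ring R\<^esub> Fr \<Longrightarrow>
      g divides\<^bsub>poly_ring R\<^esub> f \<Longrightarrow> g divides\<^bsub>poly_ring R\<^esub> d"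
    using gcd unfolding isgcd_def Fr_def q_def by auto
  obtain h where h: "h \<in> carrier (poly_ring R)" "Fr = d \<otimes>\<^bsub>poly_ring R\<^esub> h"
    using dFr unfolding factor_def by blast
  have "Fr \<noteq> []" using degFr q1 by auto
  hence dh: "d \<noteq> []" "h \<noteq> []"
    using h d UP.l_null UP.r_null by (auto simp: univ_poly_zero)
  have "Polynomials.degree Fr = Polynomials.degree d + Polynomials.degree h"
    unfolding h(2) univ_poly_mult
    using poly_mult_degree_eq[OF carrier_is_subring, of d h] d h(1) dh by (simp add: univ_poly_carrier)
  hence deg: "q = Polynomials.degree d + Polynomials.degree h" using degFr by simp
  have roots: "is_root d x \<longleftrightarrow> is_root f x" for x
  proof
    assume "is_root d x"
    thus "is_root f x" using pdivides_imp_root_sharing[OF d, of f x] df f(2)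
      unfolding is_root_def pdivides_def by blast
  next
    assume x: "is_root f x"
    hence xR: "x \<in> carrier R" unfolding is_root_def by blast
    have "is_root Fr x" using evalFr[OF xR] xR \<open>Fr \<noteq> []\<close> unfolding is_root_def by blast
    hence "[\<one>, \<ominus> x] pdivides Fr" by (rule is_root_imp_pdivides[OF Fr])
    moreover have "[\<one>, \<ominus> x] pdivides f" by (rule is_root_imp_pdivides[OF f(1) x])
    moreover have "[\<one>, \<ominus> x] \<in> carrier (poly_ring R)"
      using xR unfolding univ_poly_carrier[symmetric] polynomial_def by simp
    ultimately have "[\<one>, \<ominus> x] pdivides d" using greatest unfolding pdivides_def by blast
    thus "is_root d x" by (rule pdivides_imp_is_root[OF dh(1) xR])
  qed
  have "carrier R \<subseteq> {x. is_root d x} \<union> {x. is_root h x}"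
  proof
    fix x assume x: "x \<in> carrier R"
    interpret E: ring_hom_cring "poly_ring R" R "\<lambda>p. eval p x"
      using eval_cring_hom[OF carrier_is_subring x] .
    have "eval d x \<otimes> eval h x = \<zero>" using evalFr[OF x] d h(1) unfolding h(2) by simp
    hence "eval d x = \<zero> \<or> eval h x = \<zero>"
      using integral E.hom_closed[OF d] E.hom_closed[OF h(1)] by blast
    thus "x \<in> {x. is_root d x} \<union> {x. is_root h x}" using x dh unfolding is_root_def by blast
  qed
  hence "q \<le> card ({x. is_root d x} \<union> {x. is_root h x})"
    unfolding q_def using finite_roots(1)[OF d] finite_roots(1)[OF h(1)] by (intro card_mono) auto
  also have "\<dots> \<le> card {x. is_root d x} + card {x. is_root h x}" by (rule card_Un_le)
  also have "\<dots> \<le> card {x. is_root d x} + Polynomials.degree h" using finite_roots(2)[OF h(1)] by simp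
  finally have "Polynomials.degree d \<le> card {x. is_root d x}" using deg by simp
  hence "card {x. is_root d x} = Polynomials.degree d" using finite_roots(2)[OF d] by simp
  thus ?thesis using roots by simp
qed

end

section \<open>The residue field\<close>

locale residue_setting =
  fixes P :: "'a::{field, finite} poly"
  assumes irr: "Factorial_Ring.irreducible P"
begin

abbreviation PR :: "'a poly ring" where "PR \<equiv> ring_of_type_algebra"
abbreviation PI :: "'a poly set" where "PI \<equiv> PIdl\<^bsub>PR\<^esub> P"

lemma mem_PI: "g \<in> PI \<longleftrightarrow> P dvd g"
  by (auto simp: cgenideal_def ring_of_type_algebra_simps dvd_def mult.commute)

lemma cring_PR: "cring PR" by (rule cring_from_type_algebra)

lemma ideal_PI: "ideal PI PR"
  by (rule cring.cgenideal_ideal[OF cring_PR]) (simp add: ring_of_type_algebra_simps)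

lemma field_residue_field: "Ring.field (residue_field P)"
  unfolding residue_field_def
proof (rule maximalideal.quotient_is_field[OF _ cring_PR], rule maximalidealI[OF ideal_PI])
  have "1 \<notin> PI" unfolding mem_PI using irr by (auto simp: Factorial_Ring.irreducible_def)
  thus "carrier PR \<noteq> PI" by (auto simp: ring_of_type_algebra_simps)
next
  fix J assume J: "ideal J PR" and sub: "PI \<subseteq> J" "J \<subseteq> carrier PR"
  show "J = PI \<or> J = carrier PR"
  proof (rule disjCI)
    assume "J \<noteq> carrier PR"
    hence ne: "J \<noteq> UNIV" by (simp add: ring_of_type_algebra_simps)
    have mult: "u * v \<in> J" if "v \<in> J" for u v
      using ideal.I_l_closed[OF J that, of u] by (simp add: ring_of_type_algebra_simps)
    have add: "u + v \<in> J" if "u \<in> J" "v \<in> J" for u v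
      using additive_subgroup.a_closed[OF ideal.axioms(1)[OF J] that] by (simp add: ring_of_type_algebra_simps)
    have "g \<in> PI" if g: "g \<in> J" for g
    proof (rule ccontr)
      assume "g \<notin> PI"
      then obtain u v where uv: "u * g + v * P = 1"
        using irreducible_bezout[OF irr] unfolding mem_PI by metis
      have "P \<in> J" using sub(1) mem_PI by auto
      hence "1 \<in> J" using add[OF mult[OF g] mult] uv by metis
      hence "x \<in> J" for x using mult[of 1 x] by simp
      thus False using ne by blast
    qed
    thus "J = PI" using sub(1) by blast
  qed
qed

sublocale F: Ring.field "residue_field P" by (rule field_residue_field)

lemma residue_hom: "residue P \<in> ring_hom PR (residue_field P)"
proof -
  have "residue P = (+>\<^bsub>PR\<^esub>) PI" by (auto simp: residue_def)
  thus ?thesis unfolding residue_field_def using ideal.rcos_ring_hom[OF ideal_PI] by simp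
qed

lemma residue_closed: "residue P g \<in> carrier (residue_field P)"
  and residue_add: "residue P (g + g') = residue P g \<oplus>\<^bsub>residue_field P\<^esub> residue P g'"
  and residue_mult: "residue P (g * g') = residue P g \<otimes>\<^bsub>residue_field P\<^esub> residue P g'"
  and residue_1: "residue P 1 = \<one>\<^bsub>residue_field P\<^esub>"
  using ring_hom_closed[OF residue_hom, of g] ring_hom_add[OF residue_hom, of g g']
    ring_hom_mult[OF residue_hom, of g g'] ring_hom_one[OF residue_hom]
  by (simp_all add: ring_of_type_algebra_simps)

lemma residue_minus: "residue P (- g) = \<ominus>\<^bsub>residue_field P\<^esub> residue P g"
proof -
  have "residue P 0 \<oplus>\<^bsub>residue_field P\<^esub> residue P 0 = residue P 0" by (simp flip: residue_add)
  hence "residue P 0 = \<zero>\<^bsub>residue_field P\<^esub>" using F.add.l_cancel_one' residue_closed by metis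
  hence "residue P (- g) \<oplus>\<^bsub>residue_field P\<^esub> residue P g = \<zero>\<^bsub>residue_field P\<^esub>"
    by (simp flip: residue_add)
  thus ?thesis using F.minus_equality residue_closed by metis
qed

lemma residue_power: "residue P (g ^ n) = residue P g [^]\<^bsub>residue_field P\<^esub> n"
  by (induction n) (simp_all add: residue_1 residue_mult F.m_comm residue_closed)

lemma residue_eq_0_iff: "residue P g = \<zero>\<^bsub>residue_field P\<^esub> \<longleftrightarrow> P dvd g"
proof -
  have zero: "\<zero>\<^bsub>residue_field P\<^esub> = PI" by (simp add: residue_field_def FactRing_def)
  have "PI +>\<^bsub>PR\<^esub> g = PI \<longleftrightarrow> g \<in> PI"
    using ideal.rcos_const_imp_mem[OF ideal_PI, of g]
      abelian_subgroup.a_rcos_const[OF abelian_subgroupI3[OF ideal.axioms(1)[OF ideal_PI]], of g]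
      cring_PR by (auto simp: ring_of_type_algebra_simps cring_def ring_def)
  thus ?thesis unfolding residue_def zero mem_PI .
qed

lemma residue_eq_iff: "residue P g = residue P g' \<longleftrightarrow> P dvd g - g'"
proof -
  have "residue P (g - g') = residue P g \<oplus>\<^bsub>residue_field P\<^esub> \<ominus>\<^bsub>residue_field P\<^esub> residue P g'"
    using residue_add[of g "- g'"] by (simp add: residue_minus)
  hence "P dvd g - g' \<longleftrightarrow> residue P g \<ominus>\<^bsub>residue_field P\<^esub> residue P g' = \<zero>\<^bsub>residue_field P\<^esub>"
    unfolding residue_eq_0_iff[symmetric] a_minus_def by simp
  thus ?thesis using F.r_right_minus_eq residue_closed by simp
qed

lemma carrier_residue_field: "carrier (residue_field P) = range (residue P)"
  by (auto simp: residue_field_def residue_def FactRing_def A_RCOSETS_def' ring_of_type_algebra_simps)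

lemma residue_representative:
  obtains r where "residue P g = residue P r" "Polynomial.degree r < Polynomial.degree P"
proof
  have "P dvd g - g mod P" by (simp add: dvd_minus_mod)
  thus "residue P g = residue P (g mod P)" unfolding residue_eq_iff .
  show "Polynomial.degree (g mod P) < Polynomial.degree P"
    using degree_mod_less[of P g] irreducible_degree_pos[OF irr] by fastforce
qed

text \<open>The coefficient lists of length \<open>deg P\<close> represent every residue class exactly once.\<close>

lemma card_residue_field:
  "finite (carrier (residue_field P))" "card (carrier (residue_field P)) = CARD('a) ^ Polynomial.degree P"
proof -
  define n where "n = Polynomial.degree P"
  define L where "L = {xs :: 'a list. set xs \<subseteq> UNIV \<and> length xs = n}"
  have n: "n > 0" unfolding n_def by (rule irreducible_degree_pos[OF irr])
  have cardL: "card L = CARD('a) ^ n" unfolding L_def by (rule card_lists_length_eq) simp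
  have finL: "finite L" unfolding L_def by (rule finite_lists_length_eq) simp
  have "carrier (residue_field P) = (\<lambda>xs. residue P (Poly xs)) ` L"
  proof
    show "carrier (residue_field P) \<subseteq> (\<lambda>xs. residue P (Poly xs)) ` L"
    proof
      fix x assume "x \<in> carrier (residue_field P)"
      then obtain g where "x = residue P g" unfolding carrier_residue_field by blast
      then obtain r where r: "x = residue P r" "Polynomial.degree r < n"
        unfolding n_def using residue_representative by metis
      have "r = Poly (map (Polynomial.coeff r) [0..<n])"
        using r(2) by (intro poly_eqI) (auto simp: nth_default_def intro: Polynomial.coeff_eq_0)
      thus "x \<in> (\<lambda>xs. residue P (Poly xs)) ` L" unfolding r(1)
        by (intro image_eqI[of _ _ "map (Polynomial.coeff r) [0..<n]"]) (simp_all add: L_def)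
    qed
  qed (use residue_closed in auto)
  moreover have "inj_on (\<lambda>xs. residue P (Poly xs)) L"
  proof (rule inj_onI)
    fix xs ys assume L: "xs \<in> L" "ys \<in> L" and "residue P (Poly xs) = residue P (Poly ys)"
    hence dvd: "P dvd Poly xs - Poly ys" unfolding residue_eq_iff by simp
    have c: "Polynomial.coeff (Poly xs - Poly ys) i = 0" if "i \<ge> n" for i
      using L that by (simp add: L_def nth_default_beyond)
    have "Poly xs - Poly ys = 0"
    proof (rule ccontr)
      assume nz: "Poly xs - Poly ys \<noteq> 0"
      hence "n \<le> Polynomial.degree (Poly xs - Poly ys)" unfolding n_def by (rule dvd_imp_degree_le[OF dvd])
      hence "Polynomial.lead_coeff (Poly xs - Poly ys) = 0" by (rule c)
      thus False using nz by (simp only: leading_coeff_0_iff)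
    qed
    hence "nth_default 0 xs = nth_default 0 ys" by (metis coeff_Poly_eq eq_iff_diff_eq_0)
    thus "xs = ys" using L by (intro nth_equalityI) (auto simp: L_def nth_default_def fun_eq_iff split: if_splits)
  qed
  ultimately show "finite (carrier (residue_field P))"
    "card (carrier (residue_field P)) = CARD('a) ^ Polynomial.degree P"
    using finL cardL unfolding n_def by (simp_all add: card_image)
qed

lemma fermat: "P dvd g ^ (CARD('a) ^ Polynomial.degree P) - g"
  unfolding residue_eq_iff[symmetric] residue_power
  using F.frobenius_fixes[OF card_residue_field(1) residue_closed] card_residue_field(2) by simp

lemma is_root_residue_cubic:
  "F.is_root (residue_cubic P A B) (residue P r) \<longleftrightarrow> P dvd r ^ 3 - A * r + B"
proof -
  have "F.eval (residue_cubic P A B) (residue P r) = residue P (r ^ 3 + (- A) * r + B)"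
    unfolding residue_add residue_mult residue_minus residue_power residue_cubic_def
    by (simp add: residue_closed numeral_3_eq_3 F.m_comm F.a_ac F.m_ac)
  thus ?thesis unfolding F.is_root_def by (simp add: residue_closed residue_eq_0_iff residue_cubic_def)
qed

lemma degree_gcd_eq_card_roots:
  assumes d: "d \<in> carrier (poly_ring (residue_field P))"
    and gcd: "d gcdof\<^bsub>poly_ring (residue_field P)\<^esub> (frobenius_poly P (CARD('a) ^ Polynomial.degree P)) (residue_cubic P A B)"
  shows "card (residue P ` {r. P dvd r ^ 3 - A * r + B}) = Polynomials.degree d"
proof -
  have "residue_cubic P A B \<in> carrier (poly_ring (residue_field P))"
    unfolding univ_poly_carrier[symmetric] polynomial_def residue_cubic_def by (simp add: residue_closed)
  moreover have "residue_cubic P A B \<noteq> []" by (simp add: residue_cubic_def)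
  ultimately have "card {x. F.is_root (residue_cubic P A B) x} = Polynomials.degree d"
    using F.card_roots_eq_degree_gcd[OF card_residue_field(1) _ _ d] gcd
    unfolding frobenius_poly_def card_residue_field(2) by blast
  moreover have "{x. F.is_root (residue_cubic P A B) x} = residue P ` {r. P dvd r ^ 3 - A * r + B}"
  proof -
    have "x \<in> range (residue P)" if "F.is_root (residue_cubic P A B) x" for x
      using that unfolding F.is_root_def carrier_residue_field by blast
    thus ?thesis using is_root_residue_cubic by blast
  qed
  ultimately show ?thesis by simp
qed

end

text \<open>Evaluation at a root of \<open>P\<close> realizes reduction modulo \<open>P\<close> inside the algebraic closure of the
  constants, where the reduced cubic has all its roots.\<close>

lemma residue_evaluation:
  fixes P :: "'a::field poly"
  assumes irr: "Factorial_Ring.irreducible P"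
  obtains ev :: "'a poly \<Rightarrow> 'a alg_closure" where
    "\<And>u v. ev (u + v) = ev u + ev v" "\<And>u v. ev (u * v) = ev u * ev v" "ev 1 = 1"
    "\<And>u. ev u = 0 \<longleftrightarrow> P dvd u"
proof -
  have "Polynomial.degree (map_poly to_ac P) = Polynomial.degree P"
    by (rule degree_map_poly) simp
  then obtain \<rho> where \<rho>: "poly (map_poly to_ac P) \<rho> = 0"
    using alg_closed_imp_poly_has_root irreducible_degree_pos[OF irr] by metis
  define ev where "ev u = poly (map_poly to_ac u) \<rho>" for u :: "'a poly"
  have add: "ev (u + v) = ev u + ev v" and mult: "ev (u * v) = ev u * ev v" for u v
  proof -
    have "map_poly to_ac (u + v) = map_poly to_ac u + map_poly to_ac v"
      "map_poly to_ac (u * v) = map_poly to_ac u * map_poly to_ac v"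
      by (intro poly_eqI; simp add: coeff_map_poly coeff_mult to_ac_sum)+
    thus "ev (u + v) = ev u + ev v" "ev (u * v) = ev u * ev v" by (simp_all add: ev_def)
  qed
  have one: "ev 1 = 1" by (simp add: ev_def)
  have P: "ev P = 0" using \<rho> by (simp add: ev_def)
  have "ev u = 0 \<longleftrightarrow> P dvd u" for u
  proof
    assume u: "ev u = 0"
    show "P dvd u"
    proof (rule ccontr)
      assume "\<not> P dvd u"
      then obtain x w where "x * u + w * P = 1" using irreducible_bezout[OF irr] by metis
      hence "ev x * ev u + ev w * ev P = 1" unfolding add[symmetric] mult[symmetric] by (simp add: one)
      thus False using u P by simp
    qed
  next
    assume "P dvd u"
    thus "ev u = 0" by (auto elim!: dvdE simp: mult P)
  qed
  thus thesis using that add mult one by blast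
qed


section \<open>The ring of integers at P\<close>

lemma generate_field_subset:
  assumes "H \<subseteq> generate_field R H'"
  shows "generate_field R H \<subseteq> generate_field R H'"
proof
  fix z assume "z \<in> generate_field R H"
  thus "z \<in> generate_field R H'"
    by (induction rule: generate_field.induct) (use assms in \<open>auto intro: generate_field.intros\<close>)
qed

lemma function_field_shift: "function_field \<iota> (y - \<iota> i) = function_field \<iota> y"
proof -
  have "function_field \<iota> (y + \<iota> i) \<subseteq> function_field \<iota> y" "function_field \<iota> (y - \<iota> i) \<subseteq> function_field \<iota> y" for y i
  proof -
    let ?F = "function_field \<iota> y"
    have gens: "y \<in> ?F" "\<iota> s \<in> ?F" for s unfolding function_field_def by (rule generate_field.incl; simp)+
    have "y + \<iota> i \<in> ?F"
      using generate_field.eng_add[OF gens[unfolded function_field_def]]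
      by (simp add: function_field_def ring_of_type_algebra_simps)
    moreover have "y - \<iota> i \<in> ?F"
      using generate_field.eng_add[OF gens(1)[unfolded function_field_def]
          generate_field.a_inv[OF gens(2)[unfolded function_field_def]]]
      by (simp add: function_field_def ring_of_type_algebra_simps a_inv_ring_of_type_algebra)
    ultimately show "function_field \<iota> (y + \<iota> i) \<subseteq> ?F" "function_field \<iota> (y - \<iota> i) \<subseteq> ?F"
      using gens unfolding function_field_def by (intro generate_field_subset; auto)+
  qed
  from this(2)[of y i] this(1)[of "y - \<iota> i" i] show ?thesis by simp
qed

locale cubic_function_field =
  fixes A B :: "'a::{field, finite} poly" and \<iota> :: "'a poly fract \<Rightarrow> 'f::field" and y :: 'f and w :: "'f ^ 3"
  assumes three: "(3 :: 'a) = 0" and A_nonzero: "A \<noteq> 0"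
    and abs_irr: "absolutely_irreducible (cubic A B)"
    and hom: "\<iota> \<in> ring_hom ring_of_type_algebra ring_of_type_algebra"
    and root: "y ^ 3 - \<iota> (to_fract A) * y + \<iota> (to_fract B) = 0"
    and basis: "is_basis (\<lambda>g. \<iota> (to_fract g)) (carrier (integers_ring \<iota> y)) w"
begin

abbreviation h :: "'a poly \<Rightarrow> 'f" where "h \<equiv> \<lambda>g. \<iota> (to_fract g)"
abbreviation FF :: "'f set" where "FF \<equiv> function_field \<iota> y"
abbreviation \<O> :: "'f set" where "\<O> \<equiv> integral_closure h FF"

lemmas \<iota>_hom = ring_hom_type_algebra[OF hom]

lemma \<iota>_0: "\<iota> 0 = 0" using \<iota>_hom(1)[of 0 0] by (metis add_cancel_right_left)

lemma \<iota>_minus: "\<iota> (- u) = - \<iota> u"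
  using \<iota>_hom(1)[of u "- u"] \<iota>_0 by (simp add: eq_neg_iff_add_eq_0 add.commute)

lemma h_hom: "h (u + v) = h u + h v" "h (u * v) = h u * h v" "h 0 = 0" "h 1 = 1"
  by (simp_all add: \<iota>_hom \<iota>_0 to_fract_mult)

lemma char_three: "(3 :: 'a poly) = 0" "(3 :: 'a poly fract) = 0" "(3 :: 'f) = 0" "(3 :: 'a alg_closure) = 0"
proof -
  show p: "(3 :: 'a poly) = 0" using three by (simp add: numeral_poly)
  have "(3 :: 'a poly fract) = 1 + 1 + 1" by simp
  also have "\<dots> = to_fract (1 + 1 + 1)" by (simp only: to_fract_add to_fract_1)
  also have "(1 + 1 + 1 :: 'a poly) = 0" using p by simp
  finally show f: "(3 :: 'a poly fract) = 0" by simp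
  have "(3 :: 'f) = 1 + 1 + 1" by simp
  also have "\<dots> = \<iota> (1 + 1 + 1)" by (simp only: \<iota>_hom)
  also have "(1 + 1 + 1 :: 'a poly fract) = 0" using f by simp
  finally show "(3 :: 'f) = 0" by (simp only: \<iota>_0)
  have "to_ac (3 :: 'a) = 3" by simp
  thus "(3 :: 'a alg_closure) = 0" using three by simp
qed

lemma basis_O: "is_basis h \<O> w"
  using basis by (simp add: integers_ring_def)

lemma type_subring_O: "type_subring \<O>" and h_in_O: "h s \<in> \<O>"
proof -
  have F: "u * v \<in> FF" if "u \<in> FF" "v \<in> FF" for u v
    using generate_field.eng_mult[OF that[unfolded function_field_def]]
    by (simp add: function_field_def ring_of_type_algebra_simps)
  have hF: "range h \<subseteq> FF" unfolding function_field_def by (auto intro: generate_field.incl)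
  have sub: "h s \<in> \<O>" "u \<in> \<O> \<Longrightarrow> v \<in> \<O> \<Longrightarrow> u + v \<in> \<O>" "u \<in> \<O> \<Longrightarrow> v \<in> \<O> \<Longrightarrow> u * v \<in> \<O>" for s u v
    by (rule integral_closure_subring[OF h_hom _ hF basis_O char_three(3)]; use F in blast)+
  show "h s \<in> \<O>" by (rule sub(1))
  have minus: "- u \<in> \<O>" if "u \<in> \<O>" for u
  proof -
    have "h (- 1) * u \<in> \<O>" using sub(1) that by (rule sub(3))
    moreover have "h (- 1) = - 1" using h_hom(1)[of "- 1" 1] h_hom(3,4) by (simp add: eq_neg_iff_add_eq_0)
    ultimately show ?thesis by simp
  qed
  show "type_subring \<O>"
  proof unfold_locales
    show "1 \<in> \<O>" using sub(1)[of 1] h_hom(4) by simp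
  qed (auto intro: minus sub)
qed

lemma OR_eq: "type_subring.OR \<O> = integers_ring \<iota> y"
  unfolding type_subring.OR_def[OF type_subring_O] integers_ring_def ..

text \<open>For each factorization \<open>A = \<pi> a\<close> and \<open>i\<^sup>3 - i A + B = \<pi>\<^sup>2 c\<close> the elements \<open>1\<close>, \<open>y - i\<close> and
  \<open>(y - i)\<^sup>2 / \<pi>\<close> span an order of discriminant \<open>\<pi> a\<^sup>3\<close>.\<close>

context
  fixes i \<pi> a c :: "'a poly"
  assumes \<pi>: "\<pi> \<noteq> 0" and a: "A = \<pi> * a" and c: "i ^ 3 - i * A + B = \<pi> * \<pi> * c"
begin

abbreviation y' :: 'f where "y' \<equiv> y - h i"
abbreviation \<theta>' :: 'f where "\<theta>' \<equiv> (y - h i) ^ 2 / h \<pi>"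

lemma cubic_field_algebra_shift:
  "cubic_field_algebra \<iota> (to_fract \<pi>) (to_fract a) (to_fract c) y' \<theta>'"
proof (rule cubic_field_algebraI[OF hom root no_root_of_absolutely_irreducible[OF abs_irr] char_three(2,3)])
  have "to_fract (i ^ 3 - i * A + B) = to_fract (\<pi> * \<pi> * c)" by (simp only: c)
  thus "to_fract i ^ 3 - to_fract i * to_fract A + to_fract B = to_fract \<pi> * to_fract \<pi> * to_fract c"
    by (simp add: to_fract_mult to_fract_power)
qed (use \<pi> a in \<open>simp_all add: to_fract_mult to_fract_eq_0_iff\<close>)

lemma lin_span_eq_FF: "cubic_algebra.lin_span \<iota> y' \<theta>' = FF"
proof -
  interpret K: cubic_field_algebra \<iota> "to_fract \<pi>" "to_fract a" "to_fract c" y' \<theta>'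
    by (rule cubic_field_algebra_shift)
  have "K.lin_span = function_field \<iota> y'"
    unfolding function_field_def using K.function_field_eq_lin_span \<pi> by (simp add: to_fract_eq_0_iff)
  thus ?thesis by (simp add: function_field_shift)
qed

lemma integral_order_shift:
  fixes ev :: "'a poly \<Rightarrow> 'l::field"
  assumes irr: "Factorial_Ring.irreducible P"
    and ev: "\<And>u v. ev (u + v) = ev u + ev v" "\<And>u v. ev (u * v) = ev u * ev v" "ev 1 = 1"
      "\<And>u. ev u = 0 \<longleftrightarrow> P dvd u"
  shows "integral_order h \<pi> a c y' \<theta>' \<O> P ev"
proof -
  interpret K: cubic_field_algebra \<iota> "to_fract \<pi>" "to_fract a" "to_fract c" y' \<theta>'
    by (rule cubic_field_algebra_shift)
  interpret type_subring \<O> by (rule type_subring_O)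
  have F: "y' \<in> FF" "\<theta>' \<in> FF"
    unfolding lin_span_eq_FF[symmetric] using K.lin_in_lin_span[of 0 1 0] K.lin_in_lin_span[of 0 0 1]
    by (simp_all add: K.lin_y K.lin_\<theta>)
  note rel = K.yy K.y\<theta> K.\<theta>\<theta>
  \<comment> \<open>The equations are \<open>y\<^sup>3 - \<pi> a y + \<pi>\<^sup>2 c = 0\<close> and \<open>\<theta>\<^sup>3 - 2 a \<theta>\<^sup>2 + a\<^sup>2 \<theta> - \<pi> c\<^sup>2 = 0\<close>.\<close>
  have yO: "y' \<in> \<O>"
  proof -
    define t where "t = y'"
    note rel' = rel[folded t_def]
    have "t * (t * t) = h \<pi> * (t * (t ^ 2 / h \<pi>))" unfolding rel'(1) by (simp only: mult.left_commute)
    also have "\<dots> = h \<pi> * (h a * t - h \<pi> * h c)" unfolding rel'(2) ..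
    finally have "poly (map_poly h [:\<pi> * \<pi> * c, - (\<pi> * a), 0, 1:]) t = 0"
      by (simp add: map_poly_pCons \<iota>_hom \<iota>_0 \<iota>_minus to_fract_mult algebra_simps)
    hence "poly (map_poly h [:\<pi> * \<pi> * c, - (\<pi> * a), 0, 1:]) y' = 0" unfolding t_def .
    moreover have "Polynomial.lead_coeff [:\<pi> * \<pi> * c, - (\<pi> * a), 0, 1:] = 1" by simp
    ultimately show ?thesis using F(1) unfolding integral_closure_def by blast
  qed
  have \<theta>O: "\<theta>' \<in> \<O>"
  proof -
    define t where "t = \<theta>'"
    note rel' = rel[folded t_def]
    have cy: "h c * y' = h a * t - t * t" unfolding rel'(3) by simp
    have "t * (t * t) = t * (h a * t - h c * y')" by (simp only: rel'(3))
    also have "\<dots> = h a * (t * t) - h c * (y' * t)" by (simp add: algebra_simps)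
    also have "\<dots> = h a * (t * t) - h a * (h c * y') + h \<pi> * h c * h c"
      unfolding rel'(2) by (simp add: algebra_simps)
    finally have t3: "t * (t * t) = h a * (t * t) - h a * (h a * t - t * t) + h \<pi> * h c * h c"
      unfolding cy .
    define b where "b = a + a"
    have hb: "h b = h a + h a" unfolding b_def by (simp only: h_hom(1))
    have "poly (map_poly h [:- (\<pi> * c * c), a * a, - b, 1:]) t =
        t * (t * t) - (h a * (t * t) - h a * (h a * t - t * t) + h \<pi> * h c * h c)"
      by (simp add: map_poly_pCons \<iota>_hom \<iota>_0 \<iota>_minus to_fract_mult hb algebra_simps)
    hence "poly (map_poly h [:- (\<pi> * c * c), a * a, - b, 1:]) t = 0" using t3 by simp
    moreover have "Polynomial.lead_coeff [:- (\<pi> * c * c), a * a, - b, 1:] = 1" by simp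
    ultimately show ?thesis using F(2) unfolding integral_closure_def t_def by blast
  qed
  show ?thesis
  proof (unfold_locales)
    show "y' * y' = h \<pi> * \<theta>'" "y' * \<theta>' = h a * y' - h \<pi> * h c" "\<theta>' * \<theta>' = h a * \<theta>' - h c * y'"
      by (rule rel)+
    show "c0 = 0 \<and> c1 = 0 \<and> c2 = 0" if "h c0 + h c1 * y' + h c2 * \<theta>' = 0" for c0 c1 c2
      using K.indep[OF that] by (simp add: to_fract_eq_0_iff)
    show "\<exists>p. Polynomial.lead_coeff p = 1 \<and> poly (map_poly h p) z = 0" if "z \<in> \<O>" for z
      using that unfolding integral_closure_def by blast
    show "\<exists>m. m \<noteq> 0 \<and> h m * z \<in> cubic_algebra.lin_span h y' \<theta>'" if "z \<in> \<O>" for z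
    proof -
      interpret R: cubic_algebra h \<pi> a c y' \<theta>'
      proof
        show "y' * y' = h \<pi> * \<theta>'" "y' * \<theta>' = h a * y' - h \<pi> * h c" "\<theta>' * \<theta>' = h a * \<theta>' - h c * y'"
          by (rule rel)+
        show "c0 = 0 \<and> c1 = 0 \<and> c2 = 0" if "h c0 + h c1 * y' + h c2 * \<theta>' = 0" for c0 c1 c2
          using K.indep[OF that] by (simp add: to_fract_eq_0_iff)
      qed (rule h_hom)+
      have "z \<in> K.lin_span" using \<open>z \<in> \<O>\<close> unfolding lin_span_eq_FF integral_closure_def by blast
      then obtain c0 c1 c2 where z: "z = K.lin c0 c1 c2" by (rule K.lin_spanE)
      have "\<exists>u v. v \<noteq> 0 \<and> to_fract v * x = to_fract u" for x :: "'a poly fract"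
      proof -
        obtain u v where "x = Fract u v" "v \<noteq> 0" by (cases x) auto
        thus ?thesis by (intro exI[of _ u] exI[of _ v]) (simp add: fract_to_fract to_fract_eq_0_iff)
      qed
      then obtain num den where nd: "\<And>x :: 'a poly fract. den x \<noteq> 0 \<and> to_fract (den x) * x = to_fract (num x)"
        by metis
      define m where "m = den c0 * den c1 * den c2"
      have "h m * z = R.lin (den c1 * den c2 * num c0) (den c0 * den c2 * num c1) (den c0 * den c1 * num c2)"
      proof -
        have "to_fract m * c0 = to_fract (den c1 * den c2 * num c0)"
          "to_fract m * c1 = to_fract (den c0 * den c2 * num c1)"
          "to_fract m * c2 = to_fract (den c0 * den c1 * num c2)"
          using nd by (simp_all add: m_def to_fract_mult mult_ac flip: nd[THEN conjunct2])
        thus ?thesis unfolding z K.lin_scale by (simp add: K.lin_def R.lin_def)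
      qed
      moreover have "m \<noteq> 0" unfolding m_def using nd by simp
      ultimately show ?thesis using R.lin_in_lin_span by metis
    qed
  qed (use h_hom irr ev yO \<theta>O h_in_O in auto)
qed

text \<open>The discriminants of the order and of the field differ by the square of the index, and the index
  of an order that is maximal at \<open>P\<close> is prime to \<open>P\<close>.\<close>

lemma padic_val_disc:
  fixes ev :: "'a poly \<Rightarrow> 'l::field"
  assumes max: "P_maximal_order h \<pi> a c y' \<theta>' \<O> P ev"
    and n: "\<pi> * a ^ 3 = P ^ n * u" "\<not> P dvd u"
  shows "padic_val P (disc_of \<iota> FF w) = int n"
proof -
  interpret K: cubic_field_algebra \<iota> "to_fract \<pi>" "to_fract a" "to_fract c" y' \<theta>'
    by (rule cubic_field_algebra_shift)
  interpret M: P_maximal_order h \<pi> a c y' \<theta>' \<O> P ev by (rule max)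
  obtain D :: "'a poly ^ 3 ^ 3" where D: "\<not> P dvd det D"
    "\<And>k. (vector [1, y', \<theta>'] :: 'f ^ 3) $ k = (\<Sum>l\<in>UNIV. h (D $ k $ l) * w $ l)"
    by (rule M.index_prime_to_P[OF basis_O]) blast
  define E :: "'a poly fract ^ 3 ^ 3" where "E = (\<chi> k l. to_fract (D $ k $ l))"
  have detE: "det E = to_fract (det D)"
    by (simp add: det_3 E_def to_fract_mult)
  have wF: "w $ k \<in> K.lin_span" for k
  proof -
    have "(\<Sum>l\<in>UNIV. h ((axis k 1 :: 'a poly ^ 3) $ l) * w $ l) \<in> \<O>"
      using basis_O unfolding is_basis_def bij_betw_def by blast
    moreover have "(\<Sum>l\<in>UNIV. h ((axis k 1 :: 'a poly ^ 3) $ l) * w $ l) = w $ k"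
      using exhaust_3[of k] by (auto simp: sum_3 axis_def \<iota>_0 \<iota>_hom(3))
    ultimately show ?thesis unfolding lin_span_eq_FF integral_closure_def by simp
  qed
  have "disc_of \<iota> K.lin_span (vector [1, y', \<theta>']) = det E ^ 2 * disc_of \<iota> K.lin_span w"
    by (rule K.disc_of_change[OF wF]) (simp add: D(2) E_def)
  hence "to_fract \<pi> * to_fract a ^ 3 = to_fract (det D) ^ 2 * disc_of \<iota> FF w"
    unfolding K.disc_of_standard_basis[OF char_three(2)] detE unfolding lin_span_eq_FF .
  hence "to_fract (\<pi> * a ^ 3) = to_fract (det D) ^ 2 * disc_of \<iota> FF w"
    by (simp add: to_fract_mult to_fract_power)
  moreover have "to_fract (det D) \<noteq> 0" using D(1) by (auto simp: to_fract_eq_0_iff)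
  ultimately have "disc_of \<iota> FF w = to_fract (P ^ n * u) / to_fract (det D ^ 2)"
    unfolding n(1) by (simp add: to_fract_power)
  also have "\<dots> = to_fract P powi int n * Fract u (det D ^ 2)"
    unfolding fract_to_fract by (simp add: to_fract_mult to_fract_power)
  finally have eq: "disc_of \<iota> FF w = to_fract P powi int n * Fract u (det D ^ 2)" .
  have "\<not> P dvd det D ^ 2" using irreducible_dvd_power_iff[OF M.irr, of 2] D(1) by simp
  thus ?thesis by (rule padic_val_eqI[OF M.irr n(2) _ eq])
qed

end

text \<open>If \<open>q\<^sub>1\<close> is the number of elements of the residue field, a power of three, then \<open>-B\<close> is congruent to
  its \<open>q\<^sub>1\<close>-th power, which is the cube of \<open>(-B)\<^sup>k\<close> with \<open>3 k = q\<^sub>1\<close>.\<close>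

lemma cube_root_exists:
  assumes card: "CARD('a) = 3 ^ e" "e > 0" and irr: "Factorial_Ring.irreducible P"
  obtains i where "P dvd i ^ 3 + B"
proof -
  interpret residue_setting P by unfold_locales (rule irr)
  define k where "k = e * Polynomial.degree P"
  have "k > 0" unfolding k_def using card(2) irreducible_degree_pos[OF irr] by simp
  hence "(3 :: nat) ^ k = 3 ^ (k - 1) * 3" using power_Suc2[of "3 :: nat" "k - 1"] by simp
  hence q: "CARD('a) ^ Polynomial.degree P = 3 ^ (k - 1) * 3"
    unfolding card(1) power_mult[symmetric] k_def .
  have "P dvd (- B) ^ (3 ^ (k - 1) * 3) - (- B)" using fermat[of "- B"] unfolding q .
  hence "P dvd ((- B) ^ 3 ^ (k - 1)) ^ 3 + B" by (simp add: power_mult)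
  thus thesis by (rule that)
qed

context
  fixes P :: "'a poly" and ev :: "'a poly \<Rightarrow> 'a alg_closure"
  assumes irr: "Factorial_Ring.irreducible P"
    and ev: "\<And>u v. ev (u + v) = ev u + ev v" "\<And>u v. ev (u * v) = ev u * ev v" "ev 1 = 1"
      "\<And>u. ev u = 0 \<longleftrightarrow> P dvd u"
begin

abbreviation ZF :: "'f ring" where "ZF \<equiv> integers_ring \<iota> y"
abbreviation PZ :: "'f set" where "PZ \<equiv> PIdl\<^bsub>ZF\<^esub> (h P)"
abbreviation val :: int where "val \<equiv> padic_val P (disc_of \<iota> FF w)"

text \<open>The valuation exceeds two because \<open>P\<close> divides \<open>a\<close>, so that \<open>P\<^sup>3\<close> divides the discriminant \<open>\<pi> a\<^sup>3\<close>.\<close>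

lemma totally_ramified_case:
  assumes "\<pi> \<noteq> 0" "A = \<pi> * a" "i ^ 3 - i * A + B = \<pi> * \<pi> * c"
    and ram: "P dvd a" "P dvd \<pi> * c" "\<not> P ^ 2 dvd \<pi> * c"
  shows "val > 2" and "\<exists>p. primeideal p ZF \<and> PZ = ideal_prod ZF (ideal_prod ZF p p) p"
proof -
  interpret S: integral_order h \<pi> a c "y - h i" "(y - h i) ^ 2 / h \<pi>" \<O> P ev
    by (rule integral_order_shift[OF assms(1-3) irr ev])
  interpret M: P_maximal_order h \<pi> a c "y - h i" "(y - h i) ^ 2 / h \<pi>" \<O> P ev
    by (rule S.maximal_if_totally_ramified[OF ram])
  show "\<exists>p. primeideal p ZF \<and> PZ = ideal_prod ZF (ideal_prod ZF p p) p"
    using M.totally_ramified[OF ram] unfolding OR_eq .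
  have "\<pi> * a ^ 3 \<noteq> 0" using A_nonzero assms(2) by auto
  then obtain n u where n: "\<pi> * a ^ 3 = P ^ n * u" "\<not> P dvd u" by (rule split_off_power[OF irr])
  have "n > 2"
  proof (rule ccontr)
    assume "\<not> n > 2"
    hence "P ^ n * P dvd P ^ 3" by (metis Suc_leI le_imp_power_dvd not_less_eq numeral_2_eq_2 numeral_3_eq_3 power_Suc2 linorder_not_less)
    also have "P ^ 3 dvd \<pi> * a ^ 3" using ram(1) by (simp add: dvd_power_same)
    finally have "P dvd u" unfolding n(1) using S.P_nonzero by simp
    thus False using n(2) by blast
  qed
  moreover have "val = int n"
    by (rule padic_val_disc[OF assms(1-3) M.P_maximal_order_axioms n])
  ultimately show "val > 2" by simp
qed

lemma partially_ramified_case: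
  assumes "A = P * a" "i ^ 3 - i * A + B = P * P * c" and ram: "\<not> P dvd a"
  shows "val = 1"
    and "\<exists>p q. primeideal p ZF \<and> primeideal q ZF \<and> p \<noteq> q \<and> PZ = ideal_prod ZF q (ideal_prod ZF p p)"
proof -
  have P0: "P \<noteq> 0" using irr by auto
  interpret S: integral_order h P a c "y - h i" "(y - h i) ^ 2 / h P" \<O> P ev
    by (rule integral_order_shift[OF P0 assms(1,2) irr ev])
  interpret M: P_maximal_order h P a c "y - h i" "(y - h i) ^ 2 / h P" \<O> P ev
    by (rule S.maximal_if_partially_ramified[OF refl ram])
  show "\<exists>p q. primeideal p ZF \<and> primeideal q ZF \<and> p \<noteq> q \<and> PZ = ideal_prod ZF q (ideal_prod ZF p p)"
    using M.partially_ramified[OF refl ram] unfolding OR_eq .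
  have "P * a ^ 3 = P ^ 1 * a ^ 3" "\<not> P dvd a ^ 3"
    using ram irreducible_dvd_power_iff[OF irr, of 3] by simp_all
  from padic_val_disc[OF P0 assms(1,2) M.P_maximal_order_axioms this] show "val = 1" by simp
qed

text \<open>Two different roots in the residue field differ by a square root \<open>s\<close> of \<open>a\<close>, and one root together
  with \<open>s\<close> gives all three. So a single root means that \<open>s\<close> is not in the residue field, and three roots
  mean that it is.\<close>

lemma unramified_case:
  assumes unram: "\<not> P dvd A"
  defines "Z \<equiv> residue P ` {r. P dvd r ^ 3 - A * r + B}"
  shows "val = 0"
    and "card Z = 0 \<Longrightarrow> primeideal PZ ZF"
    and "card Z = 1 \<Longrightarrow> \<exists>p q. primeideal p ZF \<and> primeideal q ZF \<and> p \<noteq> q \<and> PZ = ideal_prod ZF p q"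
    and "card Z = 3 \<Longrightarrow> \<exists>p q r. primeideal p ZF \<and> primeideal q ZF \<and> primeideal r ZF \<and>
      p \<noteq> q \<and> p \<noteq> r \<and> q \<noteq> r \<and> PZ = ideal_prod ZF (ideal_prod ZF p q) r"
proof -
  interpret residue_setting P by unfold_locales (rule irr)
  have eqs: "(1 :: 'a poly) \<noteq> 0" "A = 1 * A" "0 ^ 3 - 0 * A + B = 1 * 1 * B" by simp_all
  interpret S: integral_order h 1 A B "y - h 0" "(y - h 0) ^ 2 / h 1" \<O> P ev
    by (rule integral_order_shift[OF eqs irr ev])
  note ac3 = char_three(4)
  obtain s where s: "s * s = ev A"
  proof -
    have "Polynomial.degree [:- ev A, 0, 1:] > 0" by simp
    then obtain s where "poly [:- ev A, 0, 1:] s = 0" using alg_closed_imp_poly_has_root by blast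
    hence "s * s = ev A" by simp
    thus thesis by (rule that)
  qed
  obtain t where t: "t ^ 3 - ev A * t + ev B = 0"
  proof -
    have "Polynomial.degree [:ev B, - ev A, 0, 1:] > 0" by simp
    then obtain t where "poly [:ev B, - ev A, 0, 1:] t = 0" using alg_closed_imp_poly_has_root by blast
    hence "t ^ 3 - ev A * t + ev B = 0" by (simp add: power3_eq_cube algebra_simps)
    thus thesis by (rule that)
  qed
  have evA: "ev A \<noteq> 0" using unram by (simp add: ev)
  hence s0: "s \<noteq> 0" using s by auto
  interpret M: P_maximal_order h 1 A B "y - h 0" "(y - h 0) ^ 2 / h 1" \<O> P ev
    by (rule S.maximal_if_unramified[OF refl t s s0 ac3])
  have "1 * A ^ 3 = P ^ 0 * A ^ 3" "\<not> P dvd A ^ 3"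
    using unram irreducible_dvd_power_iff[OF irr, of 3] by simp_all
  from padic_val_disc[OF eqs M.P_maximal_order_axioms this] show "val = 0" by simp
  have Zroot: "ev r ^ 3 - ev A * ev r + ev B = 0 \<longleftrightarrow> residue P r \<in> Z" for r
  proof -
    have "ev r ^ 3 - ev A * ev r + ev B = ev (r ^ 3 - A * r + B)" by (simp only: S.ev_simps)
    hence "ev r ^ 3 - ev A * ev r + ev B = 0 \<longleftrightarrow> P dvd r ^ 3 - A * r + B" by (simp only: ev(4))
    also have "\<dots> \<longleftrightarrow> residue P r \<in> Z"
    proof
      assume "residue P r \<in> Z"
      then obtain r' where r': "P dvd r' ^ 3 - A * r' + B" "residue P r = residue P r'"
        unfolding Z_def by blast
      thus "P dvd r ^ 3 - A * r + B" unfolding is_root_residue_cubic[symmetric] by simp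
    qed (auto simp: Z_def)
    finally show ?thesis .
  qed
  have residue_ev: "residue P r = residue P r' \<longleftrightarrow> ev r = ev r'" for r r'
    unfolding residue_eq_iff ev(4)[symmetric] S.ev_diff by simp
  have finZ: "finite Z"
    unfolding Z_def by (rule finite_subset[OF _ card_residue_field(1)]) (use residue_closed in auto)
  show "primeideal PZ ZF" if "card Z = 0"
  proof -
    have "Z = {}" using that finZ by simp
    hence "ev r ^ 3 - ev A * ev r + ev B \<noteq> 0" for r using Zroot by blast
    from M.inert[OF refl t s ac3 this] show ?thesis unfolding OR_eq .
  qed
  show "\<exists>p q. primeideal p ZF \<and> primeideal q ZF \<and> p \<noteq> q \<and> PZ = ideal_prod ZF p q" if "card Z = 1"
  proof -
    obtain x where Z: "Z = {x}" using \<open>card Z = 1\<close> by (rule card_1_singletonE)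
    then obtain r where r: "x = residue P r" unfolding Z_def by blast
    hence root: "ev r ^ 3 - ev A * ev r + ev B = 0" using Zroot Z by blast
    have "s \<notin> range ev"
    proof
      assume "s \<in> range ev"
      then obtain s' where s': "s = ev s'" by blast
      have "ev (r + s') ^ 3 - ev A * ev (r + s') + ev B = (ev r ^ 3 - ev A * ev r + ev B) + s * (s * s - ev A)"
        unfolding S.ev_add cube_add_char_3[OF ac3] s'[symmetric] by (simp add: power3_eq_cube algebra_simps)
      hence "residue P (r + s') \<in> Z" unfolding Zroot[symmetric] using root s by simp
      hence "ev (r + s') = ev r" using Z r residue_ev by blast
      thus False using s0 s' S.ev_add by simp
    qed
    from M.partially_split[OF refl root s unram ac3 this] show ?thesis unfolding OR_eq .
  qed
  show "\<exists>p q r. primeideal p ZF \<and> primeideal q ZF \<and> primeideal r ZF \<and>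
      p \<noteq> q \<and> p \<noteq> r \<and> q \<noteq> r \<and> PZ = ideal_prod ZF (ideal_prod ZF p q) r" if "card Z = 3"
  proof -
    obtain x z where xz: "x \<in> Z" "z \<in> Z" "x \<noteq> z"
      using \<open>card Z = 3\<close> by (metis card_3_iff insertCI)
    then obtain r r' where r: "x = residue P r" "z = residue P r'" unfolding Z_def by blast
    have roots: "ev r ^ 3 - ev A * ev r + ev B = 0" "ev r' ^ 3 - ev A * ev r' + ev B = 0"
      using xz Zroot r by blast+
    define d where "d = r' - r"
    have d0: "ev d \<noteq> 0" using xz(3) residue_ev unfolding r d_def S.ev_diff by auto
    have "ev d * (ev d * ev d - ev A) =
        (ev r' ^ 3 - ev A * ev r' + ev B) - (ev r ^ 3 - ev A * ev r + ev B)"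
    proof -
      have "ev d * (ev d * ev d - ev A) = ev d ^ 3 - ev A * ev d" by (simp add: power3_eq_cube algebra_simps)
      also have "\<dots> = (ev r' ^ 3 - ev r ^ 3) - ev A * (ev r' - ev r)"
        unfolding d_def S.ev_diff cube_add_char_3[OF ac3] ..
      finally show ?thesis by (simp add: algebra_simps)
    qed
    hence "ev d * ev d = ev A" using roots d0 by simp
    from M.totally_split[OF refl roots(1) this unram ac3] show ?thesis unfolding OR_eq .
  qed
qed

end

end

section \<open>Decomposition of primes in terms of the discriminant\<close>

theorem theorem4p1:
  fixes A B P :: "'a::{field, finite} poly"
    and \<iota> :: "'a poly fract \<Rightarrow> 'f::field"
    and y :: 'f
    and \<Delta> :: "'a poly fract"
    and q e q\<^sub>1 :: nat
    and OF :: "'f ring"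
    and I :: "'f set"
  assumes "CARD('a) = q" and "q = 3 ^ e" and "e > 0"
    and "A \<noteq> 0"
    and "absolutely_irreducible (cubic A B)"
    and "\<iota> \<in> ring_hom ring_of_type_algebra ring_of_type_algebra"
    and "y ^ 3 - \<iota> (to_fract A) * y + \<iota> (to_fract B) = 0"
    and "OF = integers_ring \<iota> y"
    and "standard_form A B"
    and "is_field_disc \<iota> y \<Delta>"
    and "Factorial_Ring.irreducible P"
    and "q\<^sub>1 = q ^ Polynomial.degree P"
    and "I = PIdl\<^bsub>OF\<^esub> (\<iota> (to_fract P))"
  shows
    "(padic_val P \<Delta> > 2 \<longrightarrow>
        (\<exists>\<pp>. primeideal \<pp> OF \<and> I = \<pp> \<cdot>\<^bsub>OF\<^esub> \<pp> \<cdot>\<^bsub>OF\<^esub> \<pp>))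
   \<and> (padic_val P \<Delta> = 1 \<longrightarrow>
        (\<exists>\<pp> \<qq>. primeideal \<pp> OF \<and> primeideal \<qq> OF \<and> \<pp> \<noteq> \<qq> \<and>
           I = \<qq> \<cdot>\<^bsub>OF\<^esub> (\<pp> \<cdot>\<^bsub>OF\<^esub> \<pp>)))
   \<and> (\<not> padic_val P \<Delta> > 2 \<and> padic_val P \<Delta> \<noteq> 1 \<longrightarrow>
        \<not> P dvd A \<and>
        (\<forall>d \<in> carrier (poly_ring (residue_field P)).
           d gcdof\<^bsub>poly_ring (residue_field P)\<^esub> (frobenius_poly P q\<^sub>1) (residue_cubic P A B) \<longrightarrow>
             (Polynomials.degree d = 0 \<longrightarrow> primeideal I OF)
           \<and> (Polynomials.degree d = 1 \<longrightarrow>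
                (\<exists>\<pp> \<qq>. primeideal \<pp> OF \<and> primeideal \<qq> OF \<and> \<pp> \<noteq> \<qq> \<and>
                   I = \<pp> \<cdot>\<^bsub>OF\<^esub> \<qq>))
           \<and> (Polynomials.degree d = 3 \<longrightarrow>
                (\<exists>\<pp> \<qq> \<rr>. primeideal \<pp> OF \<and> primeideal \<qq> OF \<and> primeideal \<rr> OF \<and>
                   \<pp> \<noteq> \<qq> \<and> \<pp> \<noteq> \<rr> \<and> \<qq> \<noteq> \<rr> \<and>
                   I = \<pp> \<cdot>\<^bsub>OF\<^esub> \<qq> \<cdot>\<^bsub>OF\<^esub> \<rr>))))"
    (is "?ramified \<and> ?partial \<and> ?unramified")
proof -
  note irr = assms(11)
  have card: "CARD('a) = 3 ^ e" using assms(1,2) by simp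
  obtain w :: "'f ^ 3" where w: "is_basis (\<lambda>g. \<iota> (to_fract g)) (carrier (integers_ring \<iota> y)) w"
    and \<Delta>: "\<Delta> = disc_of \<iota> (function_field \<iota> y) w"
    using assms(10) unfolding is_field_disc_def by blast
  interpret C: cubic_function_field A B \<iota> y w
    by unfold_locales (rule three_eq_0[OF card] assms(4-7) w)+
  obtain ev :: "'a poly \<Rightarrow> 'a alg_closure" where
    ev: "\<And>u v. ev (u + v) = ev u + ev v" "\<And>u v. ev (u * v) = ev u * ev v" "ev 1 = 1"
      "\<And>u. ev u = 0 \<longleftrightarrow> P dvd u" by (rule residue_evaluation[OF irr]) blast
  have totally: "?ramified \<and> ?partial \<and> ?unramified"
    if "\<pi> \<noteq> 0" "A = \<pi> * a" "i ^ 3 - i * A + B = \<pi> * \<pi> * c" "P dvd a" "P dvd \<pi> * c" "\<not> P ^ 2 dvd \<pi> * c"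
    for \<pi> a c i
  proof -
    note ram = C.totally_ramified_case[OF irr ev that]
    have gt: "padic_val P \<Delta> > 2" unfolding \<Delta> by (rule ram(1))
    hence ne: "padic_val P \<Delta> \<noteq> 1" by simp
    have ?ramified unfolding assms(8,13) by (rule impI) (rule ram(2))
    moreover have ?partial by (rule impI, rule notE[OF ne])
    moreover have ?unramified by (rule impI, elim conjE, erule notE, rule gt)
    ultimately show ?thesis by (intro conjI)
  qed
  show ?thesis
  proof (cases "P dvd A")
    case False
    note unram = C.unramified_case[OF irr ev False]
    interpret residue_setting P by unfold_locales (rule irr)
    have v: "padic_val P \<Delta> = 0" unfolding \<Delta> by (rule unram(1))
    hence gt: "\<not> padic_val P \<Delta> > 2" and ne: "padic_val P \<Delta> \<noteq> 1" by simp_all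
    have ?ramified by (rule impI, rule notE[OF gt])
    moreover have ?partial by (rule impI, rule notE[OF ne])
    moreover have ?unramified
    proof (intro impI conjI ballI)
      show "\<not> P dvd A" by (rule False)
      fix d assume d: "d \<in> carrier (poly_ring (residue_field P))"
        and "d gcdof\<^bsub>poly_ring (residue_field P)\<^esub> (frobenius_poly P q\<^sub>1) (residue_cubic P A B)"
      hence deg: "card (residue P ` {r. P dvd r ^ 3 - A * r + B}) = Polynomials.degree d"
        unfolding assms(12) assms(1)[symmetric] by (intro degree_gcd_eq_card_roots)
      show "Polynomials.degree d = 0 \<Longrightarrow> primeideal I OF"
        unfolding assms(8,13) deg[symmetric] by (rule unram(2))
      show "Polynomials.degree d = 1 \<Longrightarrow> \<exists>p q. primeideal p OF \<and> primeideal q OF \<and> p \<noteq> q \<and>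
          I = ideal_prod OF p q"
        unfolding assms(8,13) deg[symmetric] by (rule unram(3))
      show "Polynomials.degree d = 3 \<Longrightarrow> \<exists>p q r. primeideal p OF \<and> primeideal q OF \<and> primeideal r OF \<and>
          p \<noteq> q \<and> p \<noteq> r \<and> q \<noteq> r \<and> I = ideal_prod OF (ideal_prod OF p q) r"
        unfolding assms(8,13) deg[symmetric] by (rule unram(4))
    qed
    ultimately show ?thesis by (intro conjI)
  next
    case True
    obtain i where i: "P dvd i ^ 3 + B" by (rule C.cube_root_exists[OF card assms(3) irr])
    define C where "C = i ^ 3 - i * A + B"
    have "C = (i ^ 3 + B) - i * A" by (simp add: C_def)
    hence PC: "P dvd C" using i True by (simp add: dvd_diff)
    show ?thesis
    proof (cases "P ^ 2 dvd C")
      case False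
      \<comment> \<open>Eisenstein: the order generated by \<open>y - i\<close> is maximal at \<open>P\<close>.\<close>
      have "(1 :: 'a poly) \<noteq> 0" "A = 1 * A" "i ^ 3 - i * A + B = 1 * 1 * C" "P dvd 1 * C" "\<not> P ^ 2 dvd 1 * C"
        using False PC by (simp_all add: C_def)
      thus ?thesis by (rule totally[OF _ _ _ True])
    next
      case sq: True
      obtain a where a: "A = P * a" using True by (rule dvdE)
      obtain c where "C = P ^ 2 * c" using sq by (rule dvdE)
      hence c: "i ^ 3 - i * A + B = P * P * c" by (simp add: C_def power2_eq_square)
      have P0: "P \<noteq> 0" using irr by auto
      show ?thesis
      proof (cases "P dvd a")
        case False
        \<comment> \<open>Now \<open>\<pi> = P\<close>: the element \<open>(y - i)\<^sup>2 / P\<close> is integral.\<close>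
        note ram = C.partially_ramified_case[OF irr ev a c False]
        have v: "padic_val P \<Delta> = 1" unfolding \<Delta> by (rule ram(1))
        hence gt: "\<not> padic_val P \<Delta> > 2" by simp
        have ?ramified by (rule impI, rule notE[OF gt])
        moreover have ?partial unfolding assms(8,13) by (rule impI) (rule ram(2))
        moreover have ?unramified by (rule impI, elim conjE, erule notE[of "_ = _"], rule v)
        ultimately show ?thesis by (intro conjI)
      next
        case Pa: True
        have "P ^ 2 dvd A" using Pa a by (simp add: power2_eq_square mult_dvd_mono)
        \<comment> \<open>Condition (a) of the standard form, with \<open>Q = P\<close>.\<close>
        hence "\<not> P ^ 3 dvd i ^ 3 - i * A + B"
          using assms(9) irreducible_degree_pos[OF irr] unfolding standard_form_def by blast
        hence "\<not> P * P * P dvd P * P * c" unfolding c unfolding power3_eq_cube .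
        hence "\<not> P dvd c" using mult_dvd_mono[OF dvd_refl, of P c "P * P"] by blast
        hence "\<not> P ^ 2 dvd P * c" unfolding power2_eq_square using P0 by simp
        thus ?thesis by (rule totally[OF P0 a c Pa dvd_triv_left])
      qed
    qed
  qed
qed

end
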